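(* Let $k\ge2$ be an integer, $N\ge1$, $\chi$ a Dirichlet character modulo $N$, and let $f,g\in M_k(\Gamma_0(N),\chi)$ (not necessarily cusp forms) be such that at each cusp either $f$ or $g$ vanishes. Let $\Gamma=\mathrm{SL}_2(\mathbb{Z})$, let $r=[\Gamma:\Gamma_0(N)]$, let $(\gamma_j)_{1\le j\le r}$ satisfy $\Gamma=\bigsqcup_{j=1}^r\Gamma_0(N)\gamma_j$, and set $f_j=f|_k\gamma_j$, $g_j=g|_k\gamma_j$. Let $E$ be the set of $j\in\{1,\dots,r\}$ such that $f_j(\tau)$ vanishes as $\tau\to i\infty$ (so that if $j\notin E$ then $g_j$ vanishes as $\tau\to i\infty$). Let $S=\begin{pmatrix}0&-1\\1&0\end{pmatrix}$, let $j\mapsto S(j)$ be the bijection of $\{1,\dots,r\}$ defined by $\gamma_jS\in\Gamma_0(N)\gamma_{S(j)}$, let $S(E)$ be the image of $E$ under it, and let $\rho=e^{2\pi i/3}$. Then $$r(2i)^{k-1}\langle f,g\rangle_{\Gamma_0(N)}=S_1+S_2+S_3$$ with \begin{align*} S_1&=\sum_{j\in E}G_j(\rho+1,i\infty;i,i+1)\;,\\ S_2&=\sum_{j\notin E,\ j\in S(E)}G_j(\rho+1,\rho;i,i\infty)\;,\\ S_3&=\sum_{j\notin E,\ j\notin S(E)}G_j(\rho,i;i\infty,0)\;, \end{align*} and each $G_j$ occurring here can be expressed as a linear combination of products of two convergent single integrals by the binomial theorem, i.e. $$G_j(A,B;C,D)=\sum_{0\le n\le k-2}(-1)^n\binom{k-2}{n}\int_A^B\tau^{k-2-n}f_j(\tau)\,d\tau\cdot\overline{\int_C^D\tau^{n}g_j(\tau)\,d\tau}$$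 with all the integrals convergent.
   Context: $\mathfrak{H}$ is the upper half-plane, and for $\gamma=\begin{pmatrix}a&b\\c&d\end{pmatrix}\in\mathrm{SL}_2(\mathbb{Z})$, $(f|_k\gamma)(\tau)=(c\tau+d)^{-k}f(\gamma\tau)$. Forms in $M_k(\Gamma_0(N),\chi)$ satisfy $f|_k\gamma=\chi(d)f$ for $\gamma\in\Gamma_0(N)$. For $A,B,C,D$ in the completed upper half-plane, $$G_j(A,B;C,D)=\int_A^B\int_C^Df_j(\tau)\overline{g_j(\tau_2)}(\tau-\overline{\tau_2})^{k-2}\,d\tau\,d\overline{\tau_2},$$ with $\tau$ going from $A$ to $B$ and $\tau_2$ from $C$ to $D$, along paths in $\mathfrak{H}$ joining these points (for instance hyperbolic geodesics). The Petersson product is normalized as $$\langle f,g\rangle_{\Gamma_0(N)}=\frac{1}{[\Gamma:\Gamma_0(N)]}\int_{\Gamma_0(N)\backslash\mathfrak{H}}f(\tau)\overline{g(\tau)}\,y^k\,\frac{dx\,dy}{y^2},\qquad \tau=x+iy.$$ *)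

theory Defs
  imports "HOL-Analysis.Analysis" "HOL-Algebra.Coset"
begin

definition upper_halfplane :: "complex set" where
  "upper_halfplane = {\<tau>. Im \<tau> > 0}"

definition SL2Z :: "(int^2^2) monoid" where
  "SL2Z = \<lparr>carrier = {\<gamma>. det \<gamma> = 1}, monoid.mult = (**), one = mat 1\<rparr>"

definition Gamma0 :: "nat \<Rightarrow> (int^2^2) set" where
  "Gamma0 N = {\<gamma> \<in> carrier SL2Z. int N dvd \<gamma> $ 2 $ 1}"

definition index_Gamma0 :: "nat \<Rightarrow> nat" where
  "index_Gamma0 N = card (rcosets\<^bsub>SL2Z\<^esub> (Gamma0 N))"

definition S_mat :: "int^2^2" where
  "S_mat = vector [vector [0, -1], vector [1, 0]]"

definition moebius :: "int^2^2 \<Rightarrow> complex \<Rightarrow> complex" where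
  "moebius \<gamma> \<tau> = (of_int (\<gamma> $ 1 $ 1) * \<tau> + of_int (\<gamma> $ 1 $ 2)) /
                  (of_int (\<gamma> $ 2 $ 1) * \<tau> + of_int (\<gamma> $ 2 $ 2))"

definition slash :: "nat \<Rightarrow> (complex \<Rightarrow> complex) \<Rightarrow> int^2^2 \<Rightarrow> complex \<Rightarrow> complex" where
  "slash k f \<gamma> \<tau> =
     (of_int (\<gamma> $ 2 $ 1) * \<tau> + of_int (\<gamma> $ 2 $ 2)) powi (- int k) * f (moebius \<gamma> \<tau>)"

definition dirichlet_character :: "nat \<Rightarrow> (int \<Rightarrow> complex) \<Rightarrow> bool" where
  "dirichlet_character N chi \<longleftrightarrow>
     (\<forall>a b. chi (a * b) = chi a * chi b) \<and>
     (\<forall>a. chi (a + int N) = chi a) \<and>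
     (\<forall>a. chi a \<noteq> 0 \<longleftrightarrow> coprime a (int N))"

text \<open>The filter \<open>\<tau> \<rightarrow> i\<infinity>\<close>, i.e. \<open>Im \<tau> \<rightarrow> \<infinity>\<close> uniformly in the real part.\<close>

abbreviation at_i_inf :: "complex filter" where
  "at_i_inf \<equiv> filtercomap Im at_top"

definition vanishes_at_i_inf :: "(complex \<Rightarrow> complex) \<Rightarrow> bool" where
  "vanishes_at_i_inf f \<longleftrightarrow> (f \<longlongrightarrow> 0) at_i_inf"

text \<open>
  Every cusp is of the form \<open>\<alpha>(i\<infinity>)\<close> with \<open>\<alpha> \<in> SL\<^sub>2(\<int>)\<close>; behaviour of \<open>f\<close> at this cusp
  is by definition behaviour of \<open>f|\<^sub>k\<alpha>\<close> at \<open>i\<infinity>\<close>.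
\<close>

definition vanishes_at_cusp :: "nat \<Rightarrow> (complex \<Rightarrow> complex) \<Rightarrow> int^2^2 \<Rightarrow> bool" where
  "vanishes_at_cusp k f \<alpha> \<longleftrightarrow> vanishes_at_i_inf (slash k f \<alpha>)"

text \<open>
  Holomorphy at the cusps is boundedness of every \<open>f|\<^sub>k\<alpha>\<close> near \<open>i\<infinity>\<close>.
  Values outside the upper half-plane are unconstrained.
\<close>

definition modular_forms :: "nat \<Rightarrow> nat \<Rightarrow> (int \<Rightarrow> complex) \<Rightarrow> (complex \<Rightarrow> complex) set" where
  "modular_forms k N chi =
     {f. f holomorphic_on upper_halfplane \<and>
         (\<forall>\<gamma>\<in>Gamma0 N. \<forall>\<tau>\<in>upper_halfplane. slash k f \<gamma> \<tau> = chi (\<gamma> $ 2 $ 2) * f \<tau>) \<and>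
         (\<forall>\<alpha>\<in>carrier SL2Z. Bfun (slash k f \<alpha>) at_i_inf)}"

text \<open>
  The integral over the quotient by \<open>\<Gamma>\<^sub>0(N)\<close> is the integral over a measurable fundamental
  domain, i.e. a set meeting almost every orbit in exactly one point. The integrand of the
  Petersson product is \<open>\<Gamma>\<^sub>0(N)\<close>-invariant, so the choice of domain is irrelevant.
\<close>

definition is_fundamental_domain :: "nat \<Rightarrow> complex set \<Rightarrow> bool" where
  "is_fundamental_domain N D \<longleftrightarrow>
     D \<in> sets borel \<and> D \<subseteq> upper_halfplane \<and>
     (AE \<tau> in lborel. \<tau> \<in> upper_halfplane \<longrightarrow> (\<exists>!w. w \<in> D \<and> (\<exists>\<gamma>\<in>Gamma0 N. w = moebius \<gamma> \<tau>)))"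

definition fundamental_domain :: "nat \<Rightarrow> complex set" where
  "fundamental_domain N = (SOME D. is_fundamental_domain N D)"

definition petersson_integrand ::
    "nat \<Rightarrow> (complex \<Rightarrow> complex) \<Rightarrow> (complex \<Rightarrow> complex) \<Rightarrow> complex \<Rightarrow> complex" where
  "petersson_integrand k f g \<tau> = f \<tau> * cnj (g \<tau>) * of_real (Im \<tau> ^ k / (Im \<tau>)\<^sup>2)"

definition petersson_convergent ::
    "nat \<Rightarrow> nat \<Rightarrow> (complex \<Rightarrow> complex) \<Rightarrow> (complex \<Rightarrow> complex) \<Rightarrow> bool" where
  "petersson_convergent N k f g \<longleftrightarrow>
     set_integrable lborel (fundamental_domain N) (petersson_integrand k f g)"

definition petersson ::
    "nat \<Rightarrow> nat \<Rightarrow> (complex \<Rightarrow> complex) \<Rightarrow> (complex \<Rightarrow> complex) \<Rightarrow> complex" where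
  "petersson N k f g =
     1 / of_nat (index_Gamma0 N) *
     (LINT \<tau>:fundamental_domain N|lborel. petersson_integrand k f g \<tau>)"

text \<open>
  Points of the completed upper half-plane: \<open>I_Inf\<close> is \<open>i\<infinity>\<close>, and \<open>Pt z\<close> is meant for \<open>z\<close>
  in the upper half-plane or \<open>z\<close> rational.
\<close>

datatype hpoint = Pt complex | I_Inf

text \<open>
  \<open>geodesic A B = (s, e, p)\<close>: the hyperbolic geodesic from \<open>A\<close> to \<open>B\<close> is traced by \<open>p t\<close> as \<open>t\<close>
  runs from \<open>s\<close> to \<open>e\<close> (possibly \<open>e < s\<close>). It is a vertical line, or an arc of the circle
  through both points whose centre \<open>c\<close> is real, obtained by solving \<open>|a - c| = |b - c|\<close>.
  The clause for \<open>I_Inf I_Inf\<close> is degenerate.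
\<close>

fun geodesic :: "hpoint \<Rightarrow> hpoint \<Rightarrow> ereal \<times> ereal \<times> (real \<Rightarrow> complex)" where
  "geodesic (Pt a) (Pt b) =
     (if Re a = Re b then (ereal (Im a), ereal (Im b), \<lambda>t. Complex (Re a) t)
      else let c = complex_of_real (((cmod a)\<^sup>2 - (cmod b)\<^sup>2) / (2 * (Re a - Re b)))
           in (ereal (Arg (a - c)), ereal (Arg (b - c)), \<lambda>t. c + of_real (cmod (a - c)) * cis t))"
| "geodesic (Pt a) I_Inf = (ereal (Im a), \<infinity>, \<lambda>t. Complex (Re a) t)"
| "geodesic I_Inf (Pt b) = (\<infinity>, ereal (Im b), \<lambda>t. Complex (Re b) t)"
| "geodesic I_Inf I_Inf = (\<infinity>, \<infinity>, \<lambda>t. Complex 0 t)"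

text \<open>The integrals \<open>\<integral>\<^sub>A\<^sup>B h(\<tau>) d\<tau>\<close> and \<open>\<integral>\<^sub>A\<^sup>B h(\<tau>) d\<tau>'\<close>, with \<open>\<tau>'\<close> the conjugate of \<open>\<tau>\<close>.\<close>

definition line_integral :: "hpoint \<Rightarrow> hpoint \<Rightarrow> (complex \<Rightarrow> complex) \<Rightarrow> complex" where
  "line_integral A B h =
     (case geodesic A B of (s, e, p) \<Rightarrow> LBINT t=s..e. h (p t) * vector_derivative p (at t))"

definition line_integrable :: "hpoint \<Rightarrow> hpoint \<Rightarrow> (complex \<Rightarrow> complex) \<Rightarrow> bool" where
  "line_integrable A B h \<longleftrightarrow>
     (case geodesic A B of (s, e, p) \<Rightarrow>
        interval_lebesgue_integrable lborel s e (\<lambda>t. h (p t) * vector_derivative p (at t)))"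

definition line_integral_cnj :: "hpoint \<Rightarrow> hpoint \<Rightarrow> (complex \<Rightarrow> complex) \<Rightarrow> complex" where
  "line_integral_cnj A B h =
     (case geodesic A B of (s, e, p) \<Rightarrow> LBINT t=s..e. h (p t) * cnj (vector_derivative p (at t)))"

definition line_integrable_cnj :: "hpoint \<Rightarrow> hpoint \<Rightarrow> (complex \<Rightarrow> complex) \<Rightarrow> bool" where
  "line_integrable_cnj A B h \<longleftrightarrow>
     (case geodesic A B of (s, e, p) \<Rightarrow>
        interval_lebesgue_integrable lborel s e (\<lambda>t. h (p t) * cnj (vector_derivative p (at t))))"

definition G_integral ::
    "nat \<Rightarrow> (complex \<Rightarrow> complex) \<Rightarrow> (complex \<Rightarrow> complex) \<Rightarrow>
     hpoint \<Rightarrow> hpoint \<Rightarrow> hpoint \<Rightarrow> hpoint \<Rightarrow> complex" where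
  "G_integral k f g A B C D =
     line_integral A B (\<lambda>\<tau>. line_integral_cnj C D (\<lambda>\<tau>\<^sub>2. f \<tau> * cnj (g \<tau>\<^sub>2) * (\<tau> - cnj \<tau>\<^sub>2) ^ (k - 2)))"

definition G_convergent ::
    "nat \<Rightarrow> (complex \<Rightarrow> complex) \<Rightarrow> (complex \<Rightarrow> complex) \<Rightarrow>
     hpoint \<Rightarrow> hpoint \<Rightarrow> hpoint \<Rightarrow> hpoint \<Rightarrow> bool" where
  "G_convergent k f g A B C D \<longleftrightarrow>
     (\<forall>\<tau>\<in>upper_halfplane.
        line_integrable_cnj C D (\<lambda>\<tau>\<^sub>2. f \<tau> * cnj (g \<tau>\<^sub>2) * (\<tau> - cnj \<tau>\<^sub>2) ^ (k - 2))) \<and>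
     line_integrable A B
       (\<lambda>\<tau>. line_integral_cnj C D (\<lambda>\<tau>\<^sub>2. f \<tau> * cnj (g \<tau>\<^sub>2) * (\<tau> - cnj \<tau>\<^sub>2) ^ (k - 2)))"

end

theory Submission
  imports Defs "HOL-Complex_Analysis.Complex_Analysis" "HOL-Number_Theory.Cong"
begin

text \<open>
  Unfolding \<open>\<Gamma>\<^sub>0(N)\<backslash>\<HH>\<close> along the cosets turns the Petersson product into the sum over \<open>j\<close> of
  the integrals of \<open>f\<^sub>j \<cdot> cnj g\<^sub>j \<cdot> y\<^sup>k\<^sup>-\<^sup>2\<close> over the standard fundamental domain. Since
  \<open>(2 i y)\<^sup>k\<^sup>-\<^sup>2 = (\<tau> - cnj \<tau>)\<^sup>k\<^sup>-\<^sup>2\<close>, the integrand is the derivative with respect to \<open>cnj \<tau>\<close> of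
  \<open>f\<^sub>j(\<tau>) \<integral>\<^sub>C\<^sup>\<tau> cnj (g\<^sub>j(s)) (\<tau> - cnj s)\<^sup>k\<^sup>-\<^sup>2 d(cnj s)\<close>, so Green's formula gives a boundary
  integral. For \<open>j \<in> E\<close> take the base point \<open>C = i\<close>: translation by 1 permutes \<open>E\<close>, and what the two
  vertical sides leave over is \<open>S\<^sub>1\<close>. For \<open>j \<notin> E\<close> take \<open>C = i\<infinity>\<close>: the vertical sides cancel
  completely, and moving the base point back to \<open>i\<close> on the arc produces
  \<open>G\<^sub>j(\<rho>+1,\<rho>;i,i\<infinity>)\<close>. The remaining arc integrals with base point \<open>i\<close> sum to zero over all \<open>j\<close>,
  because \<open>S\<close> fixes \<open>i\<close> and reverses the arc. Finally, when \<open>j\<close> and \<open>S(j)\<close> both lie outside \<open>E\<close>,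
  splitting at \<open>i\<close> and applying \<open>S\<close> to one half turns \<open>G\<^sub>j(\<rho>+1,\<rho>;i,i\<infinity>)\<close> into
  \<open>G\<^sub>j(\<rho>,i;i\<infinity>,0)\<close>.
\<close>

section \<open>Matrices, Moebius action and the slash operator\<close>

text \<open>For j in \<open>E\<close> the form \<open>g_at j\<close> may have a nonzero constant
  term at i infinity, and for j outside \<open>E\<close> the form \<open>f_at j\<close> may. An
  integral up to the cusp is therefore only available on the side of the decaying form, which
  dictates the two base points and the shape of the three sums. The double integrals are not
  transformed as integrals over paths. The binomial theorem turns each into a finite sum of products
  of primitives \<open>prim\<close> normalised at i, and identities between such sums are proved by
  differentiating in an endpoint, where the weight k of the form, -m of the kernel and -2 of the
  derivative cancel because k = m + 2. Cusps enter only as limits of these primitives. The character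
  gives both forms the same factor of modulus 1, which meets its own conjugate. Green's formula is
  proved on a rectangle, because the fundamental domain is the arc \<open>rim x\<close> moved up by
  t. The vertical sides stay a limit in the height T, since they are simplified only after summation
  over j.\<close>

no_notation fps_nth (infixl \<open>$\<close> 75)

abbreviation "SL \<equiv> carrier SL2Z"

text \<open>The classical automorphy factor, a cocycle by \<open>autfac_mult\<close>; with it
  \<open>slash\<close> becomes a plain quotient, see \<open>slash_alt\<close>.\<close>

definition autfac :: "int^2^2 \<Rightarrow> complex \<Rightarrow> complex" where
  "autfac \<gamma> \<tau> = of_int (\<gamma> $ 2 $ 1) * \<tau> + of_int (\<gamma> $ 2 $ 2)"

lemma in_upper_halfplane [simp]: "\<tau> \<in> upper_halfplane \<longleftrightarrow> Im \<tau> > 0"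
  by (simp add: upper_halfplane_def)

lemma open_upper_halfplane [simp, intro]: "open upper_halfplane"
  by (simp add: upper_halfplane_def open_halfspace_Im_gt)

lemma convex_upper_halfplane [simp, intro]: "convex upper_halfplane"
  by (simp add: upper_halfplane_def convex_halfspace_Im_gt)

lemma SL2Z_simps [simp]: "mult SL2Z = (**)" "one SL2Z = mat 1"
  by (auto simp: SL2Z_def)

lemma mem_SL: "\<gamma> \<in> SL \<longleftrightarrow> \<gamma>$1$1 * \<gamma>$2$2 - \<gamma>$1$2 * \<gamma>$2$1 = 1"
  by (simp add: SL2Z_def det_2)

lemma SL_det: "\<gamma> \<in> SL \<Longrightarrow> \<gamma>$1$1 * \<gamma>$2$2 - \<gamma>$1$2 * \<gamma>$2$1 = 1"
  by (simp add: mem_SL)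

lemma SL_det_C:
  fixes \<gamma> :: "int^2^2"
  assumes "\<gamma> \<in> SL"
  shows "(of_int (\<gamma>$1$1) * of_int (\<gamma>$2$2) - of_int (\<gamma>$1$2) * of_int (\<gamma>$2$1) :: 'a::ring_1) = 1"
  using arg_cong[OF SL_det[OF assms], of "of_int :: int \<Rightarrow> 'a"] by simp

lemma mat2_mult_nth [simp]:
  fixes A B :: "int^2^2"
  shows "(A ** B) $ i $ j = A$i$1 * B$1$j + A$i$2 * B$2$j"
  by (simp add: matrix_matrix_mult_def sum_2)

lemma mat2_eqI: "A$1$1 = B$1$1 \<Longrightarrow> A$1$2 = B$1$2 \<Longrightarrow> A$2$1 = B$2$1 \<Longrightarrow> A$2$2 = B$2$2 \<Longrightarrow> A = B"
  for A B :: "'a^2^2"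
  by (simp add: vec_eq_iff forall_2)

lemma mat_1_nth [simp]: "(mat 1 :: int^2^2) $ 1 $ 1 = 1" "(mat 1 :: int^2^2) $ 1 $ 2 = 0"
  "(mat 1 :: int^2^2) $ 2 $ 1 = 0" "(mat 1 :: int^2^2) $ 2 $ 2 = 1"
  by (auto simp: mat_def)

definition mat2 :: "int \<Rightarrow> int \<Rightarrow> int \<Rightarrow> int \<Rightarrow> int^2^2" where
  "mat2 a b c d = vector [vector [a, b], vector [c, d]]"

lemma mat2_nth [simp]: "mat2 a b c d $ 1 $ 1 = a" "mat2 a b c d $ 1 $ 2 = b"
  "mat2 a b c d $ 2 $ 1 = c" "mat2 a b c d $ 2 $ 2 = d"
  by (auto simp: mat2_def)

lemma S_mat_eq: "S_mat = mat2 0 (-1) 1 0"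
  by (simp add: S_mat_def mat2_def)

text \<open>The adjugate is the inverse when the determinant is 1. Being an explicit integral
  formula, it lets entries and membership in \<open>Gamma0 N\<close> be read off.\<close>

definition adj2 :: "int^2^2 \<Rightarrow> int^2^2" where
  "adj2 \<gamma> = mat2 (\<gamma>$2$2) (- \<gamma>$1$2) (- \<gamma>$2$1) (\<gamma>$1$1)"

definition T_mat :: "int \<Rightarrow> int^2^2" where "T_mat n = mat2 1 n 0 1"

lemma SL_mult [simp, intro]: "\<alpha> \<in> SL \<Longrightarrow> \<beta> \<in> SL \<Longrightarrow> \<alpha> ** \<beta> \<in> SL"
  by (simp add: SL2Z_def det_mul)

lemma SL_one [simp]: "mat 1 \<in> SL" by (simp add: mem_SL)
lemma SL_adj [simp, intro]: "\<alpha> \<in> SL \<Longrightarrow> adj2 \<alpha> \<in> SL"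
  by (simp add: mem_SL adj2_def algebra_simps)
lemma SL_S [simp]: "S_mat \<in> SL" by (simp add: mem_SL S_mat_eq)
lemma SL_T [simp]: "T_mat n \<in> SL" by (simp add: mem_SL T_mat_def)
lemma SL_uminus [simp]: "- \<alpha> \<in> SL \<longleftrightarrow> \<alpha> \<in> SL" by (simp add: mem_SL)

lemma adj2_mult [simp]: "\<alpha> \<in> SL \<Longrightarrow> adj2 \<alpha> ** \<alpha> = mat 1" "\<alpha> \<in> SL \<Longrightarrow> \<alpha> ** adj2 \<alpha> = mat 1"
  by (auto intro!: mat2_eqI dest!: SL_det simp: adj2_def algebra_simps)

lemma adj2_adj2 [simp]: "adj2 (adj2 \<alpha>) = \<alpha>"
  by (auto intro!: mat2_eqI simp: adj2_def)

lemma mult_uminus_mat2: "(- \<alpha>) ** \<beta> = - (\<alpha> ** \<beta>)" "\<alpha> ** (- \<beta>) = - (\<alpha> ** \<beta>)"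
  for \<alpha> \<beta> :: "int^2^2"
  by (auto intro!: mat2_eqI)

section \<open>The congruence subgroup and its cosets\<close>

lemma Gamma0_SL: "\<beta> \<in> Gamma0 N \<Longrightarrow> \<beta> \<in> SL" by (simp add: Gamma0_def)
lemma Gamma0_mult [simp, intro]: "\<alpha> \<in> Gamma0 N \<Longrightarrow> \<beta> \<in> Gamma0 N \<Longrightarrow> \<alpha> ** \<beta> \<in> Gamma0 N"
  by (simp add: Gamma0_def)
lemma Gamma0_one [simp]: "mat 1 \<in> Gamma0 N" by (simp add: Gamma0_def)
lemma Gamma0_adj [simp, intro]: "\<alpha> \<in> Gamma0 N \<Longrightarrow> adj2 \<alpha> \<in> Gamma0 N"
  by (auto simp: Gamma0_def) (simp add: adj2_def)
lemma Gamma0_uminus [simp]: "- \<alpha> \<in> Gamma0 N \<longleftrightarrow> \<alpha> \<in> Gamma0 N"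
  by (simp add: Gamma0_def)

lemma Gamma0_coset_iff:
  assumes "\<gamma> \<in> SL" "\<alpha> \<in> SL"
  shows "\<alpha> \<in> Gamma0 N #>\<^bsub>SL2Z\<^esub> \<gamma> \<longleftrightarrow> \<alpha> ** adj2 \<gamma> \<in> Gamma0 N"
proof
  assume "\<alpha> \<in> Gamma0 N #>\<^bsub>SL2Z\<^esub> \<gamma>"
  then obtain \<beta> where "\<beta> \<in> Gamma0 N" "\<alpha> = \<beta> ** \<gamma>" by (auto simp: r_coset_def)
  thus "\<alpha> ** adj2 \<gamma> \<in> Gamma0 N"
    using assms by (simp flip: matrix_mul_assoc)
next
  assume *: "\<alpha> ** adj2 \<gamma> \<in> Gamma0 N"
  have "\<alpha> = (\<alpha> ** adj2 \<gamma>) ** \<gamma>" using assms by (simp flip: matrix_mul_assoc)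
  thus "\<alpha> \<in> Gamma0 N #>\<^bsub>SL2Z\<^esub> \<gamma>" using * unfolding r_coset_def by auto
qed

text \<open>Countability allows almost-everywhere statements to hold for all matrices at once, and
  sums over \<open>SL\<close> to be exchanged with integrals.\<close>

lemma countable_SL: "countable SL"
proof -
  have "inj (\<lambda>\<gamma>::int^2^2. (\<gamma>$1$1, \<gamma>$1$2, \<gamma>$2$1, \<gamma>$2$2))"
    by (intro injI mat2_eqI) auto
  hence "countable (UNIV :: (int^2^2) set)"
    by (metis countableI_type countable_image_inj_eq)
  thus ?thesis using countable_subset by blast
qed

section \<open>The Moebius action and its automorphy factor\<close>

lemma moebius_alt: "moebius \<gamma> \<tau> = (of_int (\<gamma>$1$1) * \<tau> + of_int (\<gamma>$1$2)) / autfac \<gamma> \<tau>"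
  by (simp add: moebius_def autfac_def)

lemma slash_alt: "slash k f \<gamma> \<tau> = f (moebius \<gamma> \<tau>) / autfac \<gamma> \<tau> ^ k"
  by (simp add: slash_def autfac_def power_int_minus field_simps)

lemma autfac_nonzero:
  assumes "\<gamma> \<in> SL" "Im \<tau> \<noteq> 0"
  shows "autfac \<gamma> \<tau> \<noteq> 0"
proof
  assume *: "autfac \<gamma> \<tau> = 0"
  have "Im (autfac \<gamma> \<tau>) = of_int (\<gamma>$2$1) * Im \<tau>" by (simp add: autfac_def)
  hence "\<gamma>$2$1 = 0" using * assms by simp
  moreover from this have "\<gamma>$2$2 = 0" using * by (simp add: autfac_def)
  ultimately show False using SL_det[OF assms(1)] by simp
qed

lemma Im_moebius:
  assumes "\<gamma> \<in> SL"
  shows "Im (moebius \<gamma> \<tau>) = Im \<tau> / (cmod (autfac \<gamma> \<tau>))\<^sup>2"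
proof -
  let ?n = "of_int (\<gamma>$1$1) * \<tau> + of_int (\<gamma>$1$2)"
  have "Im (?n * cnj (autfac \<gamma> \<tau>)) = (real_of_int (\<gamma>$1$1 * \<gamma>$2$2 - \<gamma>$1$2 * \<gamma>$2$1)) * Im \<tau>"
    by (simp add: autfac_def algebra_simps)
  hence "Im (?n * cnj (autfac \<gamma> \<tau>)) = Im \<tau>" using SL_det[OF assms] by simp
  thus ?thesis
    unfolding moebius_alt by (subst complex_div_cnj) (simp add: Im_divide_of_real flip: of_real_power)
qed

lemma autfac_nonzero' [simp]: "\<gamma> \<in> SL \<Longrightarrow> Im \<tau> > 0 \<Longrightarrow> autfac \<gamma> \<tau> \<noteq> 0"
  by (rule autfac_nonzero) auto

lemma moebius_in_upper [simp, intro]: "\<gamma> \<in> SL \<Longrightarrow> Im \<tau> > 0 \<Longrightarrow> Im (moebius \<gamma> \<tau>) > 0"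
  by (simp add: Im_moebius autfac_nonzero)

lemma autfac_mult:
  assumes "autfac \<beta> \<tau> \<noteq> 0"
  shows "autfac (\<alpha> ** \<beta>) \<tau> = autfac \<alpha> (moebius \<beta> \<tau>) * autfac \<beta> \<tau>"
  using assms by (simp add: moebius_alt autfac_def field_simps)

lemma moebius_mult:
  assumes "\<beta> \<in> SL" "Im \<tau> > 0"
  shows "moebius (\<alpha> ** \<beta>) \<tau> = moebius \<alpha> (moebius \<beta> \<tau>)"
proof -
  let ?j = "autfac \<beta> \<tau>"
  have j: "?j \<noteq> 0" using assms autfac_nonzero[of \<beta> \<tau>] by auto
  have "moebius \<alpha> (moebius \<beta> \<tau>) =
      ((of_int (\<alpha>$1$1) * moebius \<beta> \<tau> + of_int (\<alpha>$1$2)) * ?j) / (autfac \<alpha> (moebius \<beta> \<tau>) * ?j)"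
    using j by (simp add: moebius_alt)
  also have "autfac \<alpha> (moebius \<beta> \<tau>) * ?j = autfac (\<alpha> ** \<beta>) \<tau>" using autfac_mult[OF j] by simp
  also have "(of_int (\<alpha>$1$1) * moebius \<beta> \<tau> + of_int (\<alpha>$1$2)) * ?j =
      of_int ((\<alpha> ** \<beta>)$1$1) * \<tau> + of_int ((\<alpha> ** \<beta>)$1$2)"
    using j unfolding moebius_alt by (simp add: field_simps) (simp add: autfac_def algebra_simps)
  finally show ?thesis by (simp add: moebius_alt)
qed

lemma moebius_one [simp]: "moebius (mat 1) \<tau> = \<tau>"
  by (simp add: moebius_def)

lemma moebius_uminus [simp]: "moebius (- \<alpha>) \<tau> = moebius \<alpha> \<tau>"
proof -
  have "moebius (- \<alpha>) \<tau> = (- (of_int (\<alpha>$1$1) * \<tau> + of_int (\<alpha>$1$2))) / (- autfac \<alpha> \<tau>)"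
    by (simp add: moebius_alt autfac_def)
  thus ?thesis unfolding moebius_alt minus_divide_divide .
qed

lemma moebius_adj [simp]: "\<alpha> \<in> SL \<Longrightarrow> Im \<tau> > 0 \<Longrightarrow> moebius (adj2 \<alpha>) (moebius \<alpha> \<tau>) = \<tau>"
   "\<alpha> \<in> SL \<Longrightarrow> Im \<tau> > 0 \<Longrightarrow> moebius \<alpha> (moebius (adj2 \<alpha>) \<tau>) = \<tau>"
  by (simp_all flip: moebius_mult)

lemma moebius_T [simp]: "moebius (T_mat n) \<tau> = \<tau> + of_int n"
  by (simp add: moebius_def T_mat_def)
lemma autfac_T [simp]: "autfac (T_mat n) \<tau> = 1"
  by (simp add: autfac_def T_mat_def)
lemma moebius_S [simp]: "moebius S_mat \<tau> = - (1 / \<tau>)"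
  by (simp add: moebius_def S_mat_eq)
lemma autfac_S [simp]: "autfac S_mat \<tau> = \<tau>"
  by (simp add: autfac_def S_mat_eq)

lemma slash_mult:
  assumes "\<beta> \<in> SL" "Im \<tau> > 0"
  shows "slash k f (\<alpha> ** \<beta>) \<tau> = slash k (slash k f \<alpha>) \<beta> \<tau>"
  using assms by (simp add: slash_alt autfac_mult moebius_mult autfac_nonzero power_mult_distrib)

lemma has_field_derivative_moebius:
  assumes "\<gamma> \<in> SL" "autfac \<gamma> \<tau> \<noteq> 0"
  shows "(moebius \<gamma> has_field_derivative 1 / autfac \<gamma> \<tau> ^ 2) (at \<tau>)"
proof -
  have "((\<lambda>\<tau>. (of_int (\<gamma>$1$1) * \<tau> + of_int (\<gamma>$1$2)) / (of_int (\<gamma>$2$1) * \<tau> + of_int (\<gamma>$2$2)))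
     has_field_derivative 
      ((of_int (\<gamma>$1$1) * of_int (\<gamma>$2$2) - of_int (\<gamma>$1$2) * of_int (\<gamma>$2$1)) / autfac \<gamma> \<tau> ^ 2)) (at \<tau>)"
    using assms(2) unfolding autfac_def
    by (auto intro!: derivative_eq_intros simp: field_simps power2_eq_square)
  thus ?thesis
    unfolding SL_det_C[OF assms(1)] by (simp add: moebius_def[abs_def])
qed

text \<open>After clearing denominators only the determinant remains as a factor. This is why the
  kernel, the m-th power of such a difference, has weight -m in both variables.\<close>

lemma moebius_diff:
  assumes "\<gamma> \<in> SL" "autfac \<gamma> p \<noteq> 0" "autfac \<gamma> s \<noteq> 0"
  shows "moebius \<gamma> p - moebius \<gamma> s = (p - s) / (autfac \<gamma> p * autfac \<gamma> s)"
proof -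
  have "moebius \<gamma> p - moebius \<gamma> s = 
    (of_int (\<gamma>$1$1) * of_int (\<gamma>$2$2) - of_int (\<gamma>$1$2) * of_int (\<gamma>$2$1)) * (p - s) / (autfac \<gamma> p * autfac \<gamma> s)"
    using assms(2,3) unfolding moebius_alt
    by (simp add: divide_simps) (simp add: autfac_def algebra_simps)
  thus ?thesis unfolding SL_det_C[OF assms(1)] by simp
qed

lemma holomorphic_slash:
  assumes "f holomorphic_on upper_halfplane" "\<gamma> \<in> SL"
  shows "slash k f \<gamma> holomorphic_on upper_halfplane"
proof -
  have m: "moebius \<gamma> holomorphic_on upper_halfplane"
    using has_field_derivative_moebius[OF assms(2)] autfac_nonzero[OF assms(2)]
    by (subst holomorphic_on_open) (use order_less_imp_not_eq2 in \<open>auto, blast\<close>)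
  have "f \<circ> moebius \<gamma> holomorphic_on upper_halfplane"
    using assms by (intro holomorphic_on_compose_gen[OF m assms(1)]) auto
  moreover have "autfac \<gamma> holomorphic_on upper_halfplane"
    unfolding autfac_def[abs_def] by (intro holomorphic_intros)
  ultimately have "(\<lambda>\<tau>. (f \<circ> moebius \<gamma>) \<tau> / autfac \<gamma> \<tau> ^ k) holomorphic_on upper_halfplane"
    using autfac_nonzero[OF assms(2)] by (intro holomorphic_on_divide holomorphic_on_power) (auto simp: o_def)
  thus ?thesis by (simp add: slash_alt[abs_def] o_def)
qed

section \<open>Values of Dirichlet characters\<close>

lemma dirichlet_character_cong:
  assumes "dirichlet_character N chi" "[a = b] (mod int N)"
  shows "chi a = chi b"
proof -
  have shift: "chi (a + int N * int m) = chi a" for a m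
  proof (induction m)
    case (Suc m)
    have "chi (a + int N * int (Suc m)) = chi ((a + int N * int m) + int N)" by (simp add: algebra_simps)
    also have "\<dots> = chi (a + int N * int m)" using assms(1) unfolding dirichlet_character_def by blast
    finally show ?case using Suc by simp
  qed simp
  obtain m where m: "b = a + int N * m" using assms(2) unfolding cong_iff_lin by blast
  show ?thesis
  proof (cases "m \<ge> 0")
    case True
    thus ?thesis using shift[of a "nat m"] m by simp
  next
    case False
    thus ?thesis using shift[of b "nat (- m)"] m by simp
  qed
qed

lemma dirichlet_character_one:
  assumes "dirichlet_character N chi" shows "chi 1 = 1"
proof -
  have "chi (1 * 1) = chi 1 * chi 1" "chi 1 \<noteq> 0"
    using assms coprime_1_left unfolding dirichlet_character_def by blast+
  thus ?thesis by simp
qed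

text \<open>By the pigeonhole principle two powers of d agree modulo N; cancelling the smaller one
  shows that some positive power of d is 1, so that \<open>chi d\<close> is a root of unity.\<close>

lemma dirichlet_character_norm:
  assumes "dirichlet_character N chi" "N \<ge> 1" "coprime d (int N)"
  shows "cmod (chi d) = 1"
proof -
  have per: "chi a = chi b" if "[a = b] (mod int N)" for a b
    using dirichlet_character_cong[OF assms(1) that] .
  have one: "chi 1 = 1" by (rule dirichlet_character_one[OF assms(1)])
  have mult: "chi (a * b) = chi a * chi b" for a b using assms(1) by (auto simp: dirichlet_character_def)
  have pow: "chi (a ^ n) = chi a ^ n" for a n by (induction n) (auto simp: one mult)
  have "\<exists>n>0. [d ^ n = 1] (mod int N)"
  proof (cases "N = 1")
    case False
    have "\<exists>i j. i < j \<and> [d ^ i = d ^ j] (mod int N)"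
    proof -
      have "finite (range (\<lambda>i::nat. d ^ i mod int N))"
        by (rule finite_subset[of _ "{0..<int N}"]) (use assms(2) in auto)
      hence "\<not> inj (\<lambda>i::nat. d ^ i mod int N)" using finite_imageD infinite_UNIV_nat by blast
      then obtain i j where "i \<noteq> j" "d ^ i mod int N = d ^ j mod int N" by (auto simp: inj_def)
      thus ?thesis by (metis cong_def linorder_neqE_nat)
    qed
    then obtain i j where ij: "i < j" "[d ^ i = d ^ j] (mod int N)" by auto
    have "[d ^ i * 1 = d ^ i * d ^ (j - i)] (mod int N)"
      using ij by (simp flip: power_add)
    hence "[1 = d ^ (j - i)] (mod int N)"
      using assms(3) by (subst (asm) cong_mult_lcancel) auto
    thus ?thesis using ij(1) by (intro exI[of _ "j - i"]) (auto simp: cong_sym_eq)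
  qed auto
  then obtain n where "n > 0" "[d ^ n = 1] (mod int N)" by auto
  hence "chi d ^ n = 1" using per pow one by metis
  hence "cmod (chi d) ^ n = 1 ^ n" by (simp flip: norm_power)
  thus ?thesis using power_eq_iff_eq_base[OF \<open>n > 0\<close>, of "cmod (chi d)" 1] by simp
qed

section \<open>Reduction theory\<close>

text \<open>Taken open, so that two equivalent points in it are related by plus or minus the
  identity only. The omitted boundary and all its images are null sets.\<close>

definition std_domain :: "complex set" where
  "std_domain = {z. \<bar>Re z\<bar> < 1/2 \<and> cmod z > 1 \<and> Im z > 0}"

lemma round_Re_le_half: "\<bar>x - of_int (round x)\<bar> \<le> (1/2 :: real)"
  using of_int_round_abs_le[of x] by (simp add: abs_minus_commute)

text \<open>The values are points of the lattice spanned by 1 and \<tau>. Norm at most 1 bounds the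
  coefficient of \<tau> through the imaginary part, and then the other coefficient.\<close>

lemma finite_small_autfac:
  assumes "Im \<tau> > 0"
  shows "finite {autfac \<alpha> \<tau> | \<alpha>. cmod (autfac \<alpha> \<tau>) \<le> 1}"
proof -
  define m where "m = \<lceil>1 / Im \<tau>\<rceil>"
  define n where "n = \<lceil>1 + (1 / Im \<tau>) * cmod \<tau>\<rceil>"
  have "{autfac \<alpha> \<tau> | \<alpha>. cmod (autfac \<alpha> \<tau>) \<le> 1} \<subseteq> (\<lambda>(c,d). of_int c * \<tau> + of_int d) ` ({-m..m} \<times> {-n..n})"
  proof safe
    fix \<alpha> assume *: "cmod (autfac \<alpha> \<tau>) \<le> 1"
    have "\<bar>Im (autfac \<alpha> \<tau>)\<bar> \<le> 1" using abs_Im_le_cmod * order_trans by blast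
    hence c: "real_of_int \<bar>\<alpha>$2$1\<bar> \<le> 1 / Im \<tau>" using assms by (simp add: autfac_def abs_mult field_simps)
    have "cmod (of_int (\<alpha>$2$2)) = cmod (autfac \<alpha> \<tau> - of_int (\<alpha>$2$1) * \<tau>)" by (simp add: autfac_def)
    also have "\<dots> \<le> 1 + \<bar>of_int (\<alpha>$2$1)\<bar> * cmod \<tau>"
      using norm_triangle_ineq4[of "autfac \<alpha> \<tau>" "of_int (\<alpha>$2$1) * \<tau>"] * by (simp add: norm_mult)
    also have "\<dots> \<le> 1 + (1 / Im \<tau>) * cmod \<tau>"
      using c by (intro add_left_mono mult_right_mono) auto
    finally have d: "real_of_int \<bar>\<alpha>$2$2\<bar> \<le> 1 + (1 / Im \<tau>) * cmod \<tau>" by simp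
    have "\<bar>\<alpha>$2$1\<bar> \<le> m" "\<bar>\<alpha>$2$2\<bar> \<le> n" using c d unfolding m_def n_def by linarith+
    thus "autfac \<alpha> \<tau> \<in> (\<lambda>(c,d). of_int c * \<tau> + of_int d) ` ({-m..m} \<times> {-n..n})"
      unfolding autfac_def by (intro image_eqI[of _ _ "(\<alpha>$2$1, \<alpha>$2$2)"]) (auto simp: abs_le_iff)
  qed
  thus ?thesis by (rule finite_subset) auto
qed

text \<open>A matrix with smallest \<open>autfac\<close> moves \<tau> as high as possible, and a
  translation then fixes the real part. If the result were inside the unit circle,
  \<open>S_mat\<close> would make the factor smaller still.\<close>

lemma SL_reduction:
  assumes "Im \<tau> > 0"
  obtains \<alpha> where "\<alpha> \<in> SL" "\<bar>Re (moebius \<alpha> \<tau>)\<bar> \<le> 1/2" "cmod (moebius \<alpha> \<tau>) \<ge> 1"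
proof -
  \<comment> \<open>The cut at 1 makes the set finite, and the identity matrix, whose factor is
    exactly 1, keeps it nonempty.\<close>
  define V where "V = (\<lambda>\<alpha>. cmod (autfac \<alpha> \<tau>)) ` {\<alpha> \<in> SL. cmod (autfac \<alpha> \<tau>) \<le> 1}"
  have "V \<subseteq> cmod ` {autfac \<alpha> \<tau> | \<alpha>. cmod (autfac \<alpha> \<tau>) \<le> 1}" by (auto simp: V_def)
  hence fin: "finite V" using finite_small_autfac[OF assms] finite_surj by blast
  have "cmod (autfac (mat 1) \<tau>) \<in> V" unfolding V_def by (rule imageI) (simp add: autfac_def)
  hence "Min V \<in> V" using fin by (intro Min_in) auto
  then obtain \<alpha> where \<alpha>: "\<alpha> \<in> SL" "cmod (autfac \<alpha> \<tau>) \<le> 1" "cmod (autfac \<alpha> \<tau>) = Min V"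
    by (subst (asm) (2) V_def) auto
  define \<beta> where "\<beta> = T_mat (- round (Re (moebius \<alpha> \<tau>))) ** \<alpha>"
  have \<beta>: "\<beta> \<in> SL" using \<alpha> by (simp add: \<beta>_def)
  have j: "autfac \<beta> \<tau> = autfac \<alpha> \<tau>" unfolding \<beta>_def
    using \<alpha>(1) assms autfac_nonzero by (subst autfac_mult) auto
  have "moebius \<beta> \<tau> = moebius \<alpha> \<tau> - of_int (round (Re (moebius \<alpha> \<tau>)))"
    unfolding \<beta>_def using \<alpha>(1) assms by (subst moebius_mult) auto
  hence re: "\<bar>Re (moebius \<beta> \<tau>)\<bar> \<le> 1/2" using round_Re_le_half by simp
  have "cmod (moebius \<beta> \<tau>) \<ge> 1"
  proof (rule ccontr)
    assume *: "\<not> cmod (moebius \<beta> \<tau>) \<ge> 1"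
    have jb: "autfac \<beta> \<tau> \<noteq> 0" using \<beta> assms autfac_nonzero by auto
    have "autfac (S_mat ** \<beta>) \<tau> = moebius \<beta> \<tau> * autfac \<beta> \<tau>"
      using jb by (subst autfac_mult) auto
    hence less: "cmod (autfac (S_mat ** \<beta>) \<tau>) < cmod (autfac \<alpha> \<tau>)"
      using * jb unfolding j by (simp add: norm_mult)
    hence "cmod (autfac (S_mat ** \<beta>) \<tau>) \<in> V" using \<alpha>(2) \<beta> by (auto simp: V_def)
    hence "Min V \<le> cmod (autfac (S_mat ** \<beta>) \<tau>)" using fin by simp
    thus False using less \<alpha>(3) by simp
  qed
  thus ?thesis using that \<beta> re by blast
qed

text \<open>The square of the norm is c^2 |z|^2 + 2 c d Re z + d^2, which exceeds c^2 - |c d| + d^2.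
  The latter is a positive integer, being a value of a positive definite form.\<close>

lemma std_domain_autfac_gt_1:
  assumes "z \<in> std_domain" "\<alpha>$2$1 \<noteq> 0"
  shows "cmod (autfac \<alpha> z) > 1"
proof -
  define c d where "c = \<alpha>$2$1" and "d = \<alpha>$2$2"
  have z: "\<bar>Re z\<bar> < 1/2" "cmod z > 1" using assms by (auto simp: std_domain_def)
  \<comment> \<open>Four times the form c^2 - |c| |d| + d^2, with the square completed.\<close>
  have "(2 * \<bar>d\<bar> - \<bar>c\<bar>)\<^sup>2 + 3 * \<bar>c\<bar>\<^sup>2 > 0" using assms(2) by (simp add: c_def add_nonneg_pos)
  hence "0 < c\<^sup>2 - \<bar>c\<bar> * \<bar>d\<bar> + d\<^sup>2" by (simp add: power2_eq_square algebra_simps)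
  hence int: "1 \<le> c\<^sup>2 - \<bar>c\<bar> * \<bar>d\<bar> + d\<^sup>2" by linarith
  have "real_of_int 1 \<le> real_of_int (c\<^sup>2 - \<bar>c\<bar> * \<bar>d\<bar> + d\<^sup>2)" using int of_int_le_iff by blast
  hence ge: "1 \<le> (real_of_int c)\<^sup>2 - \<bar>real_of_int c\<bar> * \<bar>real_of_int d\<bar> + (real_of_int d)\<^sup>2" by simp
  have "\<bar>2 * real_of_int c * real_of_int d * Re z\<bar> \<le> \<bar>real_of_int c\<bar> * \<bar>real_of_int d\<bar> * 1"
    using z(1) mult_left_mono[of "2 * \<bar>Re z\<bar>" 1 "\<bar>real_of_int c\<bar> * \<bar>real_of_int d\<bar>"]
    by (simp add: abs_mult algebra_simps)
  hence m: "2 * real_of_int c * real_of_int d * Re z \<ge> - (\<bar>real_of_int c\<bar> * \<bar>real_of_int d\<bar>)" by linarith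
  have "(cmod z)\<^sup>2 > 1" using z(2) by (simp add: power2_gt_1_iff)
  hence n: "(real_of_int c)\<^sup>2 * (cmod z)\<^sup>2 > (real_of_int c)\<^sup>2"
    using assms(2) by (simp add: c_def)
  have "(cmod (autfac \<alpha> z))\<^sup>2 = (real_of_int c)\<^sup>2 * (cmod z)\<^sup>2 + 2 * real_of_int c * real_of_int d * Re z + (real_of_int d)\<^sup>2"
    unfolding cmod_power2 by (simp add: autfac_def c_def d_def power2_eq_square algebra_simps)
  hence "(cmod (autfac \<alpha> z))\<^sup>2 > 1" using ge m n by linarith
  thus ?thesis by (metis norm_ge_zero one_power2 power_less_imp_less_base)
qed

text \<open>If the lower left entry were nonzero, both the matrix and its inverse would strictly
  lower the imaginary part. With entry 0 the map is an integral translation, and the width of the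
  domain forces it to be trivial.\<close>

lemma std_domain_inequivalent:
  assumes "z \<in> std_domain" "\<alpha> \<in> SL" "moebius \<alpha> z \<in> std_domain"
  shows "\<alpha> = mat 1 \<or> \<alpha> = - mat 1"
proof -
  have im: "Im z > 0" using assms(1) by (auto simp: std_domain_def)
  have shrink: "Im (moebius \<alpha> z) < Im z" if "z \<in> std_domain" "\<alpha> \<in> SL" "\<alpha>$2$1 \<noteq> 0" for z \<alpha>
  proof -
    have "(cmod (autfac \<alpha> z))\<^sup>2 > 1" using std_domain_autfac_gt_1[OF that(1,3)] by (simp add: power2_gt_1_iff)
    thus ?thesis using that by (simp add: Im_moebius std_domain_def divide_less_eq)
  qed
  have c: "\<alpha>$2$1 = 0"
  proof (rule ccontr)
    assume *: "\<alpha>$2$1 \<noteq> 0"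
    have "Im (moebius \<alpha> z) < Im z" using shrink assms * by blast
    \<comment> \<open>The inverse has lower left entry -c, so it shrinks heights as well.\<close>
    moreover have "Im (moebius (adj2 \<alpha>) (moebius \<alpha> z)) < Im (moebius \<alpha> z)"
      using * assms by (intro shrink SL_adj) (auto simp: adj2_def)
    ultimately show False using im assms by simp
  qed
  have ad: "\<alpha>$1$1 * \<alpha>$2$2 = 1" using SL_det[OF assms(2)] c by simp
  hence d: "(\<alpha>$1$1 = 1 \<and> \<alpha>$2$2 = 1) \<or> (\<alpha>$1$1 = -1 \<and> \<alpha>$2$2 = -1)"
    using zmult_eq_1_iff by blast
  hence "moebius \<alpha> z = z + of_int (\<alpha>$1$1 * \<alpha>$1$2)" using c by (auto simp: moebius_def)
  hence "Re (moebius \<alpha> z) = Re z + real_of_int (\<alpha>$1$1 * \<alpha>$1$2)" by simp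
  moreover have "\<bar>Re z\<bar> < 1/2" "\<bar>Re (moebius \<alpha> z)\<bar> < 1/2" using assms by (auto simp: std_domain_def)
  ultimately have "\<bar>real_of_int (\<alpha>$1$1 * \<alpha>$1$2)\<bar> < 1" by linarith
  hence "\<bar>\<alpha>$1$1 * \<alpha>$1$2\<bar> < 1" by linarith
  hence "\<alpha>$1$2 = 0" using d by auto
  thus ?thesis using c d by (auto intro!: mat2_eqI)
qed

section \<open>The hyperbolic measure\<close>

lemma borel_measurable_Complex [measurable (raw)]:
  assumes [measurable]: "f \<in> borel_measurable M" "g \<in> borel_measurable M"
  shows "(\<lambda>x. Complex (f x) (g x)) \<in> borel_measurable M"
  unfolding Complex_eq by measurable

text \<open>A measure with the right values on boxes is \<open>lborel\<close>. The product form
  makes Fubini available for integrals over \<open>complex\<close>.\<close>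

lemma lborel_complex: "(lborel :: complex measure) = distr (lborel \<Otimes>\<^sub>M lborel) borel (\<lambda>(x, y). Complex x y)"
proof (rule lborel_eqI)
  fix l u :: complex
  assume le: "\<And>b. b \<in> Basis \<Longrightarrow> l \<bullet> b \<le> u \<bullet> b"
  have [simp]: "Re l \<le> Re u" "Im l \<le> Im u"
    using le[of 1] le[of \<i>] by (auto simp: Basis_complex_def)
  have meas: "(\<lambda>(x, y). Complex x y) \<in> (lborel \<Otimes>\<^sub>M lborel) \<rightarrow>\<^sub>M borel" by measurable
  have "emeasure (distr (lborel \<Otimes>\<^sub>M lborel) borel (\<lambda>(x, y). Complex x y)) (box l u) =
      emeasure (lborel \<Otimes>\<^sub>M lborel) ({Re l<..<Re u} \<times> {Im l<..<Im u})"
    by (subst emeasure_distr[OF meas])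
       (auto intro!: arg_cong2[where f = emeasure] simp: space_pair_measure box_def Basis_complex_def)
  also have "\<dots> = ennreal (Re u - Re l) * ennreal (Im u - Im l)"
    by (subst lborel.emeasure_pair_measure_Times) auto
  also have "\<dots> = (\<Prod>b\<in>Basis. (u - l) \<bullet> b)"
    by (simp add: Basis_complex_def ennreal_mult)
  finally show "emeasure (distr (lborel \<Otimes>\<^sub>M lborel) borel (\<lambda>(x, y). Complex x y)) (box l u)
      = (\<Prod>b\<in>Basis. (u - l) \<bullet> b)" .
qed simp

lemma nn_integral_lborel_complex:
  fixes h :: "complex \<Rightarrow> ennreal"
  assumes [measurable]: "h \<in> borel_measurable borel"
  shows "(\<integral>\<^sup>+z. h z \<partial>lborel) = (\<integral>\<^sup>+y. \<integral>\<^sup>+x. h (Complex x y) \<partial>lborel \<partial>lborel)"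
proof -
  have "(\<integral>\<^sup>+z. h z \<partial>lborel) = (\<integral>\<^sup>+p. h (Complex (fst p) (snd p)) \<partial>(lborel \<Otimes>\<^sub>M lborel))"
    by (subst lborel_complex, subst nn_integral_distr) (auto simp: case_prod_beta')
  also have "\<dots> = (\<integral>\<^sup>+y. \<integral>\<^sup>+x. h (Complex x y) \<partial>lborel \<partial>lborel)"
    by (subst lborel_pair.nn_integral_snd[symmetric]) auto
  finally show ?thesis .
qed

text \<open>Substitution y = exp t on growing compact intervals, followed by monotone convergence on
  both sides.\<close>

lemma nn_integral_exp_substitution:
  fixes k :: "real \<Rightarrow> ennreal"
  assumes [measurable]: "k \<in> borel_measurable borel"
  shows "(\<integral>\<^sup>+y. k y * indicator {0<..} y \<partial>lborel) = (\<integral>\<^sup>+t. k (exp t) * ennreal (exp t) \<partial>lborel)"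
proof -
  \<comment> \<open>\<open>Suc n\<close> keeps the intervals nondegenerate already at n = 0.\<close>
  define I where "I n = {-real (Suc n)..real (Suc n)}" for n
  define J where "J n = {exp (-real (Suc n))..exp (real (Suc n))}" for n
  have inc: "incseq I" by (auto simp: incseq_def I_def)
  have incJ: "incseq J" by (auto simp: incseq_def J_def elim: order_trans[rotated] order_trans)
  have [measurable]: "I n \<in> sets borel" "J n \<in> sets borel" for n by (auto simp: I_def J_def)
  have UI: "(\<Union>n. I n) = UNIV"
  proof safe
    fix x :: real
    obtain n where "\<bar>x\<bar> \<le> real n" using real_arch_simple by blast
    thus "x \<in> (\<Union>n. I n)" by (auto simp: I_def intro!: exI[of _ n])
  qed auto
  have UJ: "(\<Union>n. J n) = {0<..}"
  proof safe
    fix x n assume "x \<in> J n"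
    thus "0 < x" unfolding J_def using exp_gt_zero[of "-real (Suc n)"]
      by (metis atLeastAtMost_iff less_le_trans)
  next
    fix x :: real assume "x > 0"
    obtain n where "ln x \<in> I n" using UI by blast
    hence "exp (ln x) \<in> J n" unfolding I_def J_def by simp
    thus "x \<in> (\<Union>n. J n)" using \<open>x > 0\<close> by auto
  qed
  have SUP_ind: "(SUP n. indicator (A n) x :: ennreal) = indicator (\<Union>n. A n) x" if "incseq A" for A and x :: real
    by (rule LIMSEQ_unique[OF LIMSEQ_SUP LIMSEQ_indicator_incseq[OF that, of x]])
       (use that in \<open>auto simp: incseq_def le_fun_def split: split_indicator\<close>)
  have "(\<integral>\<^sup>+y. k y * indicator {0<..} y \<partial>lborel) = (\<integral>\<^sup>+y. (SUP n. k y * indicator (J n) y) \<partial>lborel)"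
    by (intro nn_integral_cong) (simp add: SUP_mult_left_ennreal[symmetric] SUP_ind[OF incJ] UJ)
  also have "\<dots> = (SUP n. \<integral>\<^sup>+y. k y * indicator (J n) y \<partial>lborel)"
    using incJ by (intro nn_integral_monotone_convergence_SUP)
       (auto simp: incseq_def le_fun_def intro!: mult_left_mono split: split_indicator)
  also have "\<dots> = (SUP n. \<integral>\<^sup>+t. k (exp t) * ennreal (exp t) * indicator (I n) t \<partial>lborel)"
    unfolding I_def J_def
    by (intro SUP_cong refl nn_integral_substitution_aux) (auto intro!: derivative_eq_intros continuous_intros)
  also have "\<dots> = (\<integral>\<^sup>+t. (SUP n. k (exp t) * ennreal (exp t) * indicator (I n) t) \<partial>lborel)"
    using inc by (intro nn_integral_monotone_convergence_SUP[symmetric])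
       (auto simp: incseq_def le_fun_def intro!: mult_left_mono split: split_indicator)
  also have "\<dots> = (\<integral>\<^sup>+t. k (exp t) * ennreal (exp t) \<partial>lborel)"
    by (intro nn_integral_cong) (simp add: SUP_mult_left_ennreal[symmetric] SUP_ind[OF inc] UI)
  finally show ?thesis .
qed

text \<open>The invariant measure dx dy / y^2, extended by zero to the plane so that its sets are
  all Borel sets of \<open>complex\<close>.\<close>

definition hyp_measure :: "complex measure" where
  "hyp_measure = density lborel (\<lambda>z. indicator upper_halfplane z * ennreal (1 / (Im z)\<^sup>2))"

lemma sets_hyp_measure [simp, measurable_cong]: "sets hyp_measure = sets borel" by (simp add: hyp_measure_def)
lemma space_hyp_measure [simp]: "space hyp_measure = UNIV" by (simp add: hyp_measure_def)

lemma upper_halfplane_borel [measurable]: "upper_halfplane \<in> sets borel"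
  by (rule borel_open) simp

lemma nn_integral_hyp_measure:
  assumes [measurable]: "h \<in> borel_measurable borel"
  shows "(\<integral>\<^sup>+z. h z \<partial>hyp_measure) = (\<integral>\<^sup>+z. indicator upper_halfplane z * ennreal (1 / (Im z)\<^sup>2) * h z \<partial>lborel)"
  unfolding hyp_measure_def by (subst nn_integral_density) auto

text \<open>In the coordinates \<open>z = e\<^sup>t (w + i)\<close> the hyperbolic measure is \<open>dw dt\<close>.\<close>

lemma nn_integral_hyp_measure_polar:
  assumes [measurable]: "h \<in> borel_measurable borel"
  shows "(\<integral>\<^sup>+z. h z \<partial>hyp_measure) = (\<integral>\<^sup>+w. \<integral>\<^sup>+t. h (of_real (exp t) * Complex w 1) \<partial>lborel \<partial>lborel)"
proof -
  have "(\<integral>\<^sup>+z. h z \<partial>hyp_measure) = (\<integral>\<^sup>+y. \<integral>\<^sup>+x. indicator upper_halfplane (Complex x y) * ennreal (1 / y\<^sup>2) * h (Complex x y) \<partial>lborel \<partial>lborel)"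
    by (simp add: nn_integral_hyp_measure nn_integral_lborel_complex)
  also have "\<dots> = (\<integral>\<^sup>+y. (\<integral>\<^sup>+w. ennreal (1 / y) * h (Complex (w * y) y) \<partial>lborel) * indicator {0<..} y \<partial>lborel)"
  proof (intro nn_integral_cong)
    fix y :: real
    show "(\<integral>\<^sup>+x. indicator upper_halfplane (Complex x y) * ennreal (1 / y\<^sup>2) * h (Complex x y) \<partial>lborel) =
      (\<integral>\<^sup>+w. ennreal (1 / y) * h (Complex (w * y) y) \<partial>lborel) * indicator {0<..} y"
    proof (cases "y > 0")
      case True
      have "(\<integral>\<^sup>+x. indicator upper_halfplane (Complex x y) * ennreal (1 / y\<^sup>2) * h (Complex x y) \<partial>lborel)
         = (\<integral>\<^sup>+x. ennreal (1 / y\<^sup>2) * h (Complex x y) \<partial>lborel)"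
        using True by simp
      also have "\<dots> = ennreal \<bar>y\<bar> * (\<integral>\<^sup>+w. ennreal (1 / y\<^sup>2) * h (Complex (0 + y * w) y) \<partial>lborel)"
        using True by (intro nn_integral_real_affine) auto
      also have "\<dots> = (\<integral>\<^sup>+w. ennreal (1 / y) * h (Complex (w * y) y) \<partial>lborel)"
        using True by (subst nn_integral_cmult[symmetric], simp)
           (auto intro!: nn_integral_cong simp: mult.assoc[symmetric] mult.commute power2_eq_square simp flip: ennreal_mult)
      finally show ?thesis using True by simp
    qed auto
  qed
  also have "\<dots> = (\<integral>\<^sup>+t. (\<integral>\<^sup>+w. ennreal (1 / exp t) * h (Complex (w * exp t) (exp t)) \<partial>lborel) * ennreal (exp t) \<partial>lborel)"
    by (rule nn_integral_exp_substitution) auto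
  also have "\<dots> = (\<integral>\<^sup>+t. \<integral>\<^sup>+w. h (of_real (exp t) * Complex w 1) \<partial>lborel \<partial>lborel)"
    by (intro nn_integral_cong, subst nn_integral_multc[symmetric], simp, intro nn_integral_cong)
       (simp add: mult.commute mult.left_commute complex_eq_iff Complex_eq algebra_simps 
          flip: ennreal_mult mult.assoc)
  also have "\<dots> = (\<integral>\<^sup>+w. \<integral>\<^sup>+t. h (of_real (exp t) * Complex w 1) \<partial>lborel \<partial>lborel)"
    by (rule lborel_pair.Fubini') auto
  finally show ?thesis .
qed

section \<open>Invariance of the hyperbolic measure\<close>

lemma nn_integral_hyp_measure_translation:
  assumes [measurable]: "h \<in> borel_measurable borel"
  shows "(\<integral>\<^sup>+z. h (z + of_real b) \<partial>hyp_measure) = (\<integral>\<^sup>+z. h z \<partial>hyp_measure)"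
proof -
  have "(\<integral>\<^sup>+z. h z \<partial>hyp_measure) = (\<integral>\<^sup>+z. indicator upper_halfplane z * ennreal (1 / (Im z)\<^sup>2) * h z \<partial>distr lborel borel ((+) (of_real b)))"
    by (simp add: nn_integral_hyp_measure lborel_distr_plus)
  also have "\<dots> = (\<integral>\<^sup>+z. h (z + of_real b) \<partial>hyp_measure)"
    by (subst nn_integral_distr) (auto simp: nn_integral_hyp_measure add.commute indicator_def intro!: nn_integral_cong)
  finally show ?thesis by simp
qed

text \<open>In the coordinates (w, t) a scaling is the shift of t by ln m.\<close>

lemma nn_integral_hyp_measure_scaling:
  assumes [measurable]: "h \<in> borel_measurable borel" and "m > 0"
  shows "(\<integral>\<^sup>+z. h (of_real m * z) \<partial>hyp_measure) = (\<integral>\<^sup>+z. h z \<partial>hyp_measure)"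
proof -
  have "(\<integral>\<^sup>+t. h (of_real m * (of_real (exp t) * Complex w 1)) \<partial>lborel) = (\<integral>\<^sup>+t. h (of_real (exp t) * Complex w 1) \<partial>lborel)" for w
  proof -
    have "(\<integral>\<^sup>+t. h (of_real (exp t) * Complex w 1) \<partial>lborel) =
        ennreal \<bar>1\<bar> * (\<integral>\<^sup>+t. h (of_real (exp (ln m + 1 * t)) * Complex w 1) \<partial>lborel)"
      by (intro nn_integral_real_affine) auto
    thus ?thesis using \<open>m > 0\<close> by (simp add: exp_add mult.assoc)
  qed
  thus ?thesis by (simp add: nn_integral_hyp_measure_polar)
qed

text \<open>In the coordinates (w, t) the map is (-w, - t - ln (1 + w^2)): a reflection in w and,
  for fixed w, a reflection with shift in t.\<close>

lemma nn_integral_hyp_measure_inversion: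
  assumes [measurable]: "h \<in> borel_measurable borel"
  shows "(\<integral>\<^sup>+z. h (- (1 / z)) \<partial>hyp_measure) = (\<integral>\<^sup>+z. h z \<partial>hyp_measure)"
proof -
  have *: "(\<integral>\<^sup>+t. h (- (1 / (of_real (exp t) * Complex w 1))) \<partial>lborel) = (\<integral>\<^sup>+t. h (of_real (exp t) * Complex (-w) 1) \<partial>lborel)" for w
  proof -
    have pos: "1 + w\<^sup>2 > 0" by (simp add: add_pos_nonneg)
    have "(\<integral>\<^sup>+t. h (of_real (exp t) * Complex (-w) 1) \<partial>lborel) =
        ennreal \<bar>-1\<bar> * (\<integral>\<^sup>+t. h (of_real (exp (- ln (1 + w\<^sup>2) + (-1) * t)) * Complex (-w) 1) \<partial>lborel)"
      by (intro nn_integral_real_affine) auto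
    also have "\<dots> = (\<integral>\<^sup>+t. h (- (1 / (of_real (exp t) * Complex w 1))) \<partial>lborel)"
    proof -
      have "of_real (exp (- ln (1 + w\<^sup>2) + (-1) * t)) * Complex (-w) 1 = - (1 / (of_real (exp t) * Complex w 1))" for t
      proof -
        have e: "exp (- ln (1 + w\<^sup>2) + (-1) * t) = inverse (exp t * (1 + w\<^sup>2))"
          using pos by (simp add: exp_add exp_minus exp_diff field_simps)
        have "Complex (-w) 1 * Complex w 1 = - of_real (1 + w\<^sup>2)"
          by (simp add: complex_eq_iff power2_eq_square)
        moreover have "Complex w 1 \<noteq> 0" by (simp add: complex_eq_iff)
        ultimately have "Complex (-w) 1 = - of_real (1 + w\<^sup>2) / Complex w 1" by (simp add: field_simps)
        moreover have cancel: "inverse (x * D) * (- D / z) = - (1 / (x * z))" if "D \<noteq> 0" for x D z :: complex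
          using that by (simp add: divide_simps)
        moreover have "complex_of_real (1 + w\<^sup>2) \<noteq> 0" using pos by (metis of_real_eq_0_iff less_irrefl)
        ultimately have "inverse (of_real (exp t) * of_real (1 + w\<^sup>2)) * Complex (-w) 1 = - (1 / (of_real (exp t) * Complex w 1))"
          by metis
        thus ?thesis unfolding e of_real_inverse of_real_mult .
      qed
      thus ?thesis by simp
    qed
    finally show ?thesis by simp
  qed
  have "(\<integral>\<^sup>+z. h z \<partial>hyp_measure) = ennreal \<bar>-1\<bar> * (\<integral>\<^sup>+w. \<integral>\<^sup>+t. h (of_real (exp t) * Complex (0 + (-1) * w) 1) \<partial>lborel \<partial>lborel)"
    unfolding nn_integral_hyp_measure_polar[OF assms] by (intro nn_integral_real_affine) auto
  thus ?thesis by (simp add: nn_integral_hyp_measure_polar *)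
qed

lemma borel_measurable_moebius [measurable]: "moebius \<alpha> \<in> borel_measurable borel"
  unfolding moebius_def[abs_def] by measurable

text \<open>For c nonzero the map equals a/c - 1 / (c^2 (z + d/c)), a composition of translation,
  scaling, inversion and translation. The parameters are rational, which is why the elementary
  invariances are proved for real ones.\<close>

lemma nn_integral_hyp_measure_moebius:
  assumes [measurable]: "h \<in> borel_measurable borel" and \<alpha>: "\<alpha> \<in> SL"
  shows "(\<integral>\<^sup>+z. h (moebius \<alpha> z) \<partial>hyp_measure) = (\<integral>\<^sup>+z. h z \<partial>hyp_measure)"
proof -
  have AE: "AE z in hyp_measure. Im z > 0" unfolding hyp_measure_def by (subst AE_density) (auto split: split_indicator)
  define a b c d where "a = real_of_int (\<alpha>$1$1)" and "b = real_of_int (\<alpha>$1$2)"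
     and "c = real_of_int (\<alpha>$2$1)" and "d = real_of_int (\<alpha>$2$2)"
  have det: "a * d - b * c = 1" using SL_det_C[OF \<alpha>, where 'a = real] by (simp add: a_def b_def c_def d_def)
  have eq: "moebius \<alpha> z = (of_real a * z + of_real b) / (of_real c * z + of_real d)" for z
    by (simp add: moebius_def a_def b_def c_def d_def)
  show ?thesis
  proof (cases "c = 0")
    case True
    have "\<alpha>$2$1 = 0" using True by (simp add: c_def)
    hence "\<alpha>$1$1 * \<alpha>$2$2 = 1" using SL_det[OF \<alpha>] by simp
    hence "a = d" "d \<noteq> 0" by (auto simp: zmult_eq_1_iff a_def d_def)
    hence "moebius \<alpha> z = z + of_real (b / d)" for z
      using True unfolding eq by (simp add: field_simps)
    thus ?thesis using nn_integral_hyp_measure_translation[OF assms(1), of "b / d"] by simp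
  next
    case False
    have *: "moebius \<alpha> z = - (1 / (of_real (c\<^sup>2) * (z + of_real (d / c)))) + of_real (a / c)" if "Im z > 0" for z
    proof -
      have nz: "of_real c * z + of_real d \<noteq> 0" using that False by (simp add: complex_eq_iff)
      have "moebius \<alpha> z = (of_real (a * d - b * c) * (-1) + of_real a * (of_real c * z + of_real d)) / (of_real c * (of_real c * z + of_real d))"
      proof -
        have "of_real (a * d - b * c) * (-1) + of_real a * (of_real c * z + of_real d) = of_real c * (of_real a * z + of_real b)"
          by (simp add: algebra_simps)
        thus ?thesis unfolding eq using False by simp
      qed
      also have "\<dots> = - (1 / (of_real c * (of_real c * z + of_real d))) + of_real (a / c)"
      proof -
        have "(1 * (-1) + x * D) / (y * D) = - (1 / (y * D)) + x / y" if "y \<noteq> 0" "D \<noteq> 0" for x y D :: complex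
          using that by (simp add: divide_simps)
        from this[OF _ nz] show ?thesis unfolding det using False by simp
      qed
      also have "of_real c * (of_real c * z + of_real d) = of_real (c\<^sup>2) * (z + of_real (d / c))"
        using False by (simp add: field_simps power2_eq_square)
      finally show ?thesis .
    qed
    have "(\<integral>\<^sup>+z. h (moebius \<alpha> z) \<partial>hyp_measure) =
        (\<integral>\<^sup>+z. h (- (1 / (of_real (c\<^sup>2) * (z + of_real (d / c)))) + of_real (a / c)) \<partial>hyp_measure)"
      using AE by (intro nn_integral_cong_AE) (auto simp: *)
    also have "\<dots> = (\<integral>\<^sup>+z. h (- (1 / (of_real (c\<^sup>2) * z)) + of_real (a / c)) \<partial>hyp_measure)"
      by (rule nn_integral_hyp_measure_translation) measurable
    also have "\<dots> = (\<integral>\<^sup>+z. h (- (1 / z) + of_real (a / c)) \<partial>hyp_measure)"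
      using False by (intro nn_integral_hyp_measure_scaling) (auto, measurable)
    also have "\<dots> = (\<integral>\<^sup>+z. h (z + of_real (a / c)) \<partial>hyp_measure)"
      by (rule nn_integral_hyp_measure_inversion) measurable
    also have "\<dots> = (\<integral>\<^sup>+z. h z \<partial>hyp_measure)"
      by (rule nn_integral_hyp_measure_translation) measurable
    finally show ?thesis .
  qed
qed

lemma AE_hyp_measure_moebius:
  assumes "AE z in hyp_measure. P z" "\<alpha> \<in> SL"
  shows "AE z in hyp_measure. P (moebius \<alpha> z)"
proof -
  obtain A where A: "{z. \<not> P z} \<subseteq> A" "A \<in> sets borel" "emeasure hyp_measure A = 0"
    using AE_E[OF assms(1)] by auto
  have [measurable]: "A \<in> sets borel" by fact
  have "(\<integral>\<^sup>+z. indicator A (moebius \<alpha> z) \<partial>hyp_measure) = (\<integral>\<^sup>+z. indicator A z \<partial>hyp_measure)"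
    by (rule nn_integral_hyp_measure_moebius) (use assms(2) in auto)
  also have "\<dots> = 0" using A by simp
  finally have "AE z in hyp_measure. (indicator A (moebius \<alpha> z) :: ennreal) = 0"
    by (subst (asm) nn_integral_0_iff_AE) auto
  thus ?thesis by eventually_elim (use A in \<open>auto split: split_indicator_asm\<close>)
qed

lemma AE_hyp_measure_iff: "(AE z in hyp_measure. P z) \<longleftrightarrow> (AE z in lborel. Im z > 0 \<longrightarrow> P z)"
  unfolding hyp_measure_def by (subst AE_density) (auto intro!: AE_cong simp: indicator_def)

section \<open>Unfolding over cosets\<close>

lemma std_domain_upper: "z \<in> std_domain \<Longrightarrow> Im z > 0" by (simp add: std_domain_def)

lemma std_domain_borel [measurable]: "std_domain \<in> sets borel"
proof -
  have "std_domain = {z. \<bar>Re z\<bar> < 1/2 \<and> cmod z > 1 \<and> Im z > 0}" by (simp add: std_domain_def)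
  also have "\<dots> \<in> sets borel" by measurable
  finally show ?thesis .
qed

lemma AE_hyp_measure_boundary: "AE z in hyp_measure. \<bar>Re z\<bar> \<noteq> 1/2 \<and> cmod z \<noteq> 1"
proof -
  have null: "A \<in> null_sets lborel" if "closed A" "negligible A" for A :: "complex set"
    using that by (auto simp: negligible_iff_null_sets null_sets_completion_iff)
  have null_re: "{z. Re z = a} \<in> null_sets lborel" for a
  proof (rule null)
    have "negligible {z::complex. z \<bullet> 1 = a}"
      by (rule negligible_standard_hyperplane) (simp add: Basis_complex_def)
    thus "negligible {z. Re z = a}" unfolding complex_inner_1_right .
  qed (rule closed_halfspace_Re_eq)
  have re: "AE z in lborel. Re z \<noteq> a" for a
    using AE_not_in[OF null_re[of a]] by simp
  have sphere: "sphere (0::complex) 1 \<in> null_sets lborel"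
    by (intro null closed_sphere negligible_sphere)
  have "AE z in lborel. cmod z \<noteq> 1"
    using AE_not_in[OF sphere] by simp
  with re[of "1/2"] re[of "-1/2"] have "AE z in lborel. \<bar>Re z\<bar> \<noteq> 1/2 \<and> cmod z \<noteq> 1"
    by eventually_elim auto
  thus ?thesis unfolding AE_hyp_measure_iff by eventually_elim auto
qed

text \<open>Every point can be moved to the closed domain. Outside the countably many images of the
  boundary, which are null sets, it lands in the open one.\<close>

lemma AE_hyp_measure_std_domain: "AE z in hyp_measure. \<exists>\<alpha>\<in>SL. moebius \<alpha> z \<in> std_domain"
proof -
  have 1: "AE z in hyp_measure. \<forall>\<alpha>\<in>SL. \<bar>Re (moebius \<alpha> z)\<bar> \<noteq> 1/2 \<and> cmod (moebius \<alpha> z) \<noteq> 1"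
    using AE_hyp_measure_moebius[OF AE_hyp_measure_boundary] by (subst AE_ball_countable[OF countable_SL]) auto
  have 2: "AE z in hyp_measure. Im z > 0" unfolding AE_hyp_measure_iff by auto
  from 1 2 show ?thesis
  proof eventually_elim
    case (elim z)
    then obtain \<alpha> where \<alpha>: "\<alpha> \<in> SL" "\<bar>Re (moebius \<alpha> z)\<bar> \<le> 1/2" "cmod (moebius \<alpha> z) \<ge> 1"
      using SL_reduction by blast
    moreover have "\<bar>Re (moebius \<alpha> z)\<bar> \<noteq> 1/2" "cmod (moebius \<alpha> z) \<noteq> 1" using elim \<alpha>(1) by auto
    ultimately have "moebius \<alpha> z \<in> std_domain" using elim unfolding std_domain_def by auto
    thus ?case using \<alpha> by blast
  qed
qed

lemma std_domain_equivalent_pm: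
  assumes "\<alpha> \<in> SL" "\<beta> \<in> SL" "Im z > 0" "moebius \<alpha> z \<in> std_domain" "moebius \<beta> z \<in> std_domain"
  shows "\<beta> = \<alpha> \<or> \<beta> = - \<alpha>"
proof -
  have "moebius (\<beta> ** adj2 \<alpha>) (moebius \<alpha> z) \<in> std_domain"
    using assms moebius_in_upper[of \<alpha> z] by (subst moebius_mult) auto
  hence "\<beta> ** adj2 \<alpha> = mat 1 \<or> \<beta> ** adj2 \<alpha> = - mat 1"
    using assms by (intro std_domain_inequivalent[OF assms(4)]) auto
  moreover have "\<beta> = (\<beta> ** adj2 \<alpha>) ** \<alpha>" using assms by (simp flip: matrix_mul_assoc)
  ultimately show ?thesis by (auto simp: mult_uminus_mat2)
qed

text \<open>Ensures that the multiplicity in the counting argument below is exactly 2.\<close>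

lemma SL_neq_uminus: "\<alpha> \<in> SL \<Longrightarrow> \<alpha> \<noteq> - \<alpha>"
proof
  assume "\<alpha> \<in> SL" "\<alpha> = - \<alpha>"
  hence "\<alpha>$i$j = - \<alpha>$i$j" for i j by (metis vector_uminus_component)
  hence "\<alpha>$i$j = 0" for i j by (metis equal_neg_zero)
  thus False using SL_det[OF \<open>\<alpha> \<in> SL\<close>] by simp
qed

lemma set_integral_hyp_measure:
  fixes \<phi> :: "complex \<Rightarrow> complex"
  assumes [measurable]: "A \<in> sets borel" "\<phi> \<in> borel_measurable borel" and "A \<subseteq> upper_halfplane"
  shows "set_integrable hyp_measure A \<phi> \<longleftrightarrow> set_integrable lborel A (\<lambda>z. \<phi> z * of_real (1 / (Im z)\<^sup>2))"
    and "(LINT z:A|hyp_measure. \<phi> z) = (LINT z:A|lborel. \<phi> z * of_real (1 / (Im z)\<^sup>2))"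
proof -
  have eq: "hyp_measure = density lborel (\<lambda>z. ennreal (indicator upper_halfplane z * (1 / (Im z)\<^sup>2)))"
    unfolding hyp_measure_def by (intro arg_cong2[where f = density]) (auto split: split_indicator)
  have *: "(indicator upper_halfplane z * (1 / (Im z)\<^sup>2)) *\<^sub>R indicator A z *\<^sub>R \<phi> z = indicator A z *\<^sub>R (\<phi> z * of_real (1 / (Im z)\<^sup>2))" for z
    using assms(3) by (auto split: split_indicator simp: scaleR_conv_of_real)
  have [measurable]: "(\<lambda>z. indicator A z *\<^sub>R \<phi> z) \<in> borel_measurable lborel"
    "(\<lambda>z. indicator upper_halfplane z * (1 / (Im z)\<^sup>2)) \<in> borel_measurable lborel" by measurable
  have nonneg: "AE z in lborel. 0 \<le> indicator upper_halfplane z * (1 / (Im z)\<^sup>2)" by simp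
  show "set_integrable hyp_measure A \<phi> \<longleftrightarrow> set_integrable lborel A (\<lambda>z. \<phi> z * of_real (1 / (Im z)\<^sup>2))"
    unfolding set_integrable_def eq *[symmetric] by (rule integrable_density) (use nonneg in measurable)
  show "(LINT z:A|hyp_measure. \<phi> z) = (LINT z:A|lborel. \<phi> z * of_real (1 / (Im z)\<^sup>2))"
    unfolding set_lebesgue_integral_def eq *[symmetric] by (rule integral_density) (use nonneg in measurable)
qed

locale coset_reps =
  fixes N r :: nat and \<gamma> :: "nat \<Rightarrow> int^2^2"
  assumes cover: "carrier SL2Z = (\<Union>j\<in>{1..r}. Gamma0 N #>\<^bsub>SL2Z\<^esub> \<gamma> j)"
    and disj: "disjoint_family_on (\<lambda>j. Gamma0 N #>\<^bsub>SL2Z\<^esub> \<gamma> j) {1..r}"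
begin

abbreviation "coset j \<equiv> Gamma0 N #>\<^bsub>SL2Z\<^esub> \<gamma> j"

lemma \<gamma>_SL [simp, intro]:
  assumes "j \<in> {1..r}" shows "\<gamma> j \<in> SL"
proof -
  have "mat 1 ** \<gamma> j \<in> coset j" unfolding r_coset_def using Gamma0_one
    by (auto intro!: bexI[of _ "mat 1"])
  hence "\<gamma> j \<in> coset j" by (simp add: matrix_mul_lid)
  thus ?thesis using assms cover by blast
qed

lemma ex_coset: "\<alpha> \<in> SL \<Longrightarrow> \<exists>j\<in>{1..r}. \<alpha> \<in> coset j"
  using cover by blast

lemma coset_unique: "\<alpha> \<in> coset i \<Longrightarrow> \<alpha> \<in> coset j \<Longrightarrow> i \<in> {1..r} \<Longrightarrow> j \<in> {1..r} \<Longrightarrow> i = j"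
  using disj unfolding disjoint_family_on_def by blast

lemma r_pos: "r \<ge> 1"
  using ex_coset[OF SL_one] by auto

lemma coset_SL: "\<alpha> \<in> coset j \<Longrightarrow> j \<in> {1..r} \<Longrightarrow> \<alpha> \<in> SL"
  using cover by blast

lemma coset_uminus: "\<alpha> \<in> coset j \<Longrightarrow> - \<alpha> \<in> coset j"
  unfolding r_coset_def by (auto simp: mult_uminus_mat2(1)[symmetric] intro!: bexI)

lemma coset_iff: "\<alpha> \<in> SL \<Longrightarrow> j \<in> {1..r} \<Longrightarrow> \<alpha> \<in> coset j \<longleftrightarrow> \<alpha> ** adj2 (\<gamma> j) \<in> Gamma0 N"
  by (intro Gamma0_coset_iff) auto

lemma cosetE:
  assumes "\<alpha> \<in> coset j" obtains \<beta> where "\<beta> \<in> Gamma0 N" "\<alpha> = \<beta> ** \<gamma> j"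
  using assms unfolding r_coset_def by auto

text \<open>\<open>fundamental_domain\<close> is a choice, so a domain has to be exhibited: the
  union of the images of \<open>std_domain\<close> under the \<gamma> j. If \<alpha> brings \<tau>
  into \<open>std_domain\<close>, the orbit meets only the piece whose coset contains the inverse of
  \<alpha>.\<close>

lemma is_fundamental_domain_fundamental_domain: "is_fundamental_domain N (fundamental_domain N)"
proof -
  \<comment> \<open>The images are written as preimages under the inverse matrices, which makes
    measurability immediate.\<close>
  define D where "D = (\<Union>j\<in>{1..r}. {z. Im z > 0 \<and> moebius (adj2 (\<gamma> j)) z \<in> std_domain})"
  have "D \<in> sets borel" unfolding D_def by (intro sets.finite_UN) (simp, measurable)
  moreover have "D \<subseteq> upper_halfplane" by (auto simp: D_def)
  moreover have "AE \<tau> in hyp_measure. \<exists>!w. w \<in> D \<and> (\<exists>\<beta>\<in>Gamma0 N. w = moebius \<beta> \<tau>)"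
  proof -
    have "AE z in hyp_measure. Im z > 0" unfolding AE_hyp_measure_iff by auto
    with AE_hyp_measure_std_domain show ?thesis
    proof eventually_elim
      case (elim \<tau>)
      then obtain \<alpha> where \<alpha>: "\<alpha> \<in> SL" "moebius \<alpha> \<tau> \<in> std_domain" by auto
      obtain j where j: "j \<in> {1..r}" "adj2 \<alpha> \<in> coset j" using ex_coset \<alpha>(1) by blast
      \<comment> \<open>Passing to inverses exchanges the product \<gamma> l ** \<alpha> with the
        coset condition on the inverse of \<alpha>.\<close>
      have key: "\<gamma> l ** \<alpha> \<in> Gamma0 N \<longleftrightarrow> adj2 \<alpha> \<in> coset l" if "l \<in> {1..r}" for l
      proof -
        have "adj2 (\<gamma> l ** \<alpha>) = adj2 \<alpha> ** adj2 (\<gamma> l)"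
          by (intro mat2_eqI) (simp_all add: adj2_def algebra_simps)
        hence "adj2 \<alpha> \<in> coset l \<longleftrightarrow> adj2 (\<gamma> l ** \<alpha>) \<in> Gamma0 N"
          using that \<alpha>(1) by (simp add: coset_iff)
        thus ?thesis using Gamma0_adj adj2_adj2 by metis
      qed
      show ?case
      proof (rule ex1I)
        show "moebius (\<gamma> j ** \<alpha>) \<tau> \<in> D \<and> (\<exists>\<beta>\<in>Gamma0 N. moebius (\<gamma> j ** \<alpha>) \<tau> = moebius \<beta> \<tau>)"
        proof (intro conjI bexI)
          show "\<gamma> j ** \<alpha> \<in> Gamma0 N" using key j by blast
          have "moebius (adj2 (\<gamma> j)) (moebius (\<gamma> j ** \<alpha>) \<tau>) = moebius \<alpha> \<tau>"
            using j \<alpha> elim moebius_in_upper[of \<alpha> \<tau>] by (subst moebius_mult) auto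
          thus "moebius (\<gamma> j ** \<alpha>) \<tau> \<in> D" unfolding D_def using j \<alpha> elim by (auto intro!: bexI[of _ j])
        qed auto
      next
        fix w assume w: "w \<in> D \<and> (\<exists>\<beta>\<in>Gamma0 N. w = moebius \<beta> \<tau>)"
        then obtain l \<beta> where l: "l \<in> {1..r}" "moebius (adj2 (\<gamma> l)) w \<in> std_domain" "\<beta> \<in> Gamma0 N" "w = moebius \<beta> \<tau>"
          by (auto simp: D_def)
        have \<beta>: "\<beta> \<in> SL" using l Gamma0_SL by blast
        have "moebius (adj2 (\<gamma> l) ** \<beta>) \<tau> \<in> std_domain" using l \<beta> elim by (subst moebius_mult) auto
        hence "adj2 (\<gamma> l) ** \<beta> = \<alpha> \<or> adj2 (\<gamma> l) ** \<beta> = - \<alpha>"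
          using \<alpha> l \<beta> elim by (intro std_domain_equivalent_pm) auto
        moreover have "\<beta> = \<gamma> l ** (adj2 (\<gamma> l) ** \<beta>)" using l(1) by (simp add: matrix_mul_assoc matrix_mul_lid)
        ultimately have eq: "\<beta> = \<gamma> l ** \<alpha> \<or> \<beta> = - (\<gamma> l ** \<alpha>)" by (auto simp: mult_uminus_mat2)
        hence "\<gamma> l ** \<alpha> \<in> Gamma0 N" using l(3) by auto
        hence "adj2 \<alpha> \<in> coset l" using key l(1) by blast
        hence "l = j" using coset_unique j l(1) by blast
        thus "w = moebius (\<gamma> j ** \<alpha>) \<tau>" using eq l(4) by auto
      qed
    qed
  qed
  ultimately have "is_fundamental_domain N D"
    unfolding is_fundamental_domain_def AE_hyp_measure_iff by auto
  thus ?thesis unfolding fundamental_domain_def by (rule someI)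
qed

text \<open>Almost every orbit meets \<open>std_domain\<close> under exactly two matrices \<open>\<plusminus>\<alpha>\<close>, and likewise for \<open>D\<close>
  within each coset; counting both sides with this multiplicity 2 avoids working modulo \<open>\<plusminus>1\<close>.\<close>

lemma nn_integral_fundamental_domain:
  fixes \<psi> :: "complex \<Rightarrow> ennreal"
  assumes D: "is_fundamental_domain N D"
    and \<psi> [measurable]: "\<psi> \<in> borel_measurable borel"
    and inv: "\<And>\<beta> z. \<beta> \<in> Gamma0 N \<Longrightarrow> Im z > 0 \<Longrightarrow> \<psi> (moebius \<beta> z) = \<psi> z"
  shows "(\<integral>\<^sup>+z. indicator D z * \<psi> z \<partial>hyp_measure) = (\<Sum>j\<in>{1..r}. \<integral>\<^sup>+z. indicator std_domain z * \<psi> (moebius (\<gamma> j) z) \<partial>hyp_measure)"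
proof -
  have [measurable]: "D \<in> sets borel" using D by (simp add: is_fundamental_domain_def)
  have AE_D: "AE \<tau> in hyp_measure. \<exists>!w. w \<in> D \<and> (\<exists>\<beta>\<in>Gamma0 N. w = moebius \<beta> \<tau>)"
    using D by (simp add: is_fundamental_domain_def AE_hyp_measure_iff)
  have upper: "AE z in hyp_measure. Im z > 0" unfolding AE_hyp_measure_iff by auto
  define K where "K = count_space SL"
  have "2 * (\<integral>\<^sup>+z. indicator D z * \<psi> z \<partial>hyp_measure) = (\<integral>\<^sup>+z. indicator D z * \<psi> z * 2 \<partial>hyp_measure)"
    by (subst nn_integral_multc) (auto simp: mult.commute)
  \<comment> \<open>The factor 2 becomes the number of matrices that carry z into
    \<open>std_domain\<close>.\<close>
  also have "\<dots> = (\<integral>\<^sup>+z. \<integral>\<^sup>+\<alpha>. indicator D z * \<psi> z * indicator std_domain (moebius \<alpha> z) \<partial>K \<partial>hyp_measure)"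
  proof (rule nn_integral_cong_AE)
    show "AE z in hyp_measure. indicator D z * \<psi> z * 2 = (\<integral>\<^sup>+\<alpha>. indicator D z * \<psi> z * indicator std_domain (moebius \<alpha> z) \<partial>K)"
      using AE_hyp_measure_std_domain upper
    proof eventually_elim
      case (elim z)
      then obtain \<alpha> where \<alpha>: "\<alpha> \<in> SL" "moebius \<alpha> z \<in> std_domain" by blast
      have set: "{\<beta>\<in>SL. moebius \<beta> z \<in> std_domain} = {\<alpha>, -\<alpha>}"
        using std_domain_equivalent_pm[OF \<alpha>(1) _ _ \<alpha>(2)] elim \<alpha> by auto
      have "(\<integral>\<^sup>+\<beta>. indicator std_domain (moebius \<beta> z) \<partial>K) = (\<integral>\<^sup>+\<beta>. indicator {\<beta>\<in>SL. moebius \<beta> z \<in> std_domain} \<beta> \<partial>K)"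
        by (intro nn_integral_cong) (auto simp: K_def split: split_indicator)
      also have "\<dots> = emeasure K {\<alpha>, -\<alpha>}"
        unfolding set using \<alpha> by (subst nn_integral_indicator) (auto simp: K_def)
      also have "\<dots> = 2" using \<alpha> SL_neq_uminus[OF \<alpha>(1)] by (simp add: K_def emeasure_count_space)
      finally show ?case by (simp add: K_def nn_integral_cmult)
    qed
  qed
  also have "\<dots> = (\<integral>\<^sup>+\<alpha>. \<integral>\<^sup>+z. indicator D z * \<psi> z * indicator std_domain (moebius \<alpha> z) \<partial>hyp_measure \<partial>K)"
    unfolding K_def by (rule nn_integral_count_space_nn_integral[OF countable_SL]) measurable
  \<comment> \<open>Invariance of the measure moves \<alpha> from \<open>std_domain\<close> onto D;
    reindexing by inverses and exchanging back leaves, for z in \<open>std_domain\<close>, a sum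
    over all its images in D.\<close>
  also have "\<dots> = (\<integral>\<^sup>+\<alpha>. \<integral>\<^sup>+z. indicator D (moebius (adj2 \<alpha>) z) * \<psi> (moebius (adj2 \<alpha>) z) * indicator std_domain z \<partial>hyp_measure \<partial>K)"
  proof (rule nn_integral_cong)
    fix \<alpha> assume "\<alpha> \<in> space K"
    hence \<alpha>: "\<alpha> \<in> SL" by (simp add: K_def)
    have "(\<integral>\<^sup>+z. indicator D (moebius (adj2 \<alpha>) z) * \<psi> (moebius (adj2 \<alpha>) z) * indicator std_domain z \<partial>hyp_measure) =
        (\<integral>\<^sup>+z. indicator D (moebius (adj2 \<alpha>) (moebius \<alpha> z)) * \<psi> (moebius (adj2 \<alpha>) (moebius \<alpha> z)) * indicator std_domain (moebius \<alpha> z) \<partial>hyp_measure)"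
      by (rule nn_integral_hyp_measure_moebius[symmetric]) (use \<alpha> in auto)
    also have "\<dots> = (\<integral>\<^sup>+z. indicator D z * \<psi> z * indicator std_domain (moebius \<alpha> z) \<partial>hyp_measure)"
      using upper by (intro nn_integral_cong_AE) (auto simp: \<alpha>)
    finally show "(\<integral>\<^sup>+z. indicator D z * \<psi> z * indicator std_domain (moebius \<alpha> z) \<partial>hyp_measure) =
      (\<integral>\<^sup>+z. indicator D (moebius (adj2 \<alpha>) z) * \<psi> (moebius (adj2 \<alpha>) z) * indicator std_domain z \<partial>hyp_measure)" ..
  qed
  also have "\<dots> = (\<integral>\<^sup>+\<alpha>. \<integral>\<^sup>+z. indicator D (moebius \<alpha> z) * \<psi> (moebius \<alpha> z) * indicator std_domain z \<partial>hyp_measure \<partial>K)"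
    unfolding K_def
    by (rule nn_integral_bij_count_space) (auto intro!: bij_betwI[where g = adj2])
  also have "\<dots> = (\<integral>\<^sup>+z. \<integral>\<^sup>+\<alpha>. indicator D (moebius \<alpha> z) * \<psi> (moebius \<alpha> z) * indicator std_domain z \<partial>K \<partial>hyp_measure)"
    unfolding K_def by (rule nn_integral_count_space_nn_integral[OF countable_SL, symmetric]) measurable
  also have "\<dots> = (\<integral>\<^sup>+z. (\<Sum>j\<in>{1..r}. 2 * (indicator std_domain z * \<psi> (moebius (\<gamma> j) z))) \<partial>hyp_measure)"
  proof (rule nn_integral_cong_AE)
    have "AE z in hyp_measure. \<forall>j\<in>{1..r}. \<exists>!w. w \<in> D \<and> (\<exists>\<beta>\<in>Gamma0 N. w = moebius \<beta> (moebius (\<gamma> j) z))"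
      using AE_hyp_measure_moebius[OF AE_D] by (subst AE_ball_countable) auto
    thus "AE z in hyp_measure. (\<integral>\<^sup>+\<alpha>. indicator D (moebius \<alpha> z) * \<psi> (moebius \<alpha> z) * indicator std_domain z \<partial>K) =
        (\<Sum>j\<in>{1..r}. 2 * (indicator std_domain z * \<psi> (moebius (\<gamma> j) z)))"
    proof eventually_elim
      case (elim z)
      show ?case
      proof (cases "z \<in> std_domain")
        case True
        hence z: "Im z > 0" by (rule std_domain_upper)
        \<comment> \<open>Within one coset the images of z form a single orbit under
          \<open>Gamma0 N\<close>, which meets D in one point w. Two matrices sending z to w differ
          by an element fixing z, hence by a sign.\<close>
        have card: "emeasure K {\<alpha>\<in>coset j. moebius \<alpha> z \<in> D} = 2" if j: "j \<in> {1..r}" for j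
        proof -
          obtain w where w: "w \<in> D" "\<exists>\<beta>\<in>Gamma0 N. w = moebius \<beta> (moebius (\<gamma> j) z)"
            and uniq: "\<And>w'. w' \<in> D \<and> (\<exists>\<beta>\<in>Gamma0 N. w' = moebius \<beta> (moebius (\<gamma> j) z)) \<Longrightarrow> w' = w"
            using elim j by (auto elim!: ballE ex1E)
          obtain \<beta> where \<beta>: "\<beta> \<in> Gamma0 N" "w = moebius \<beta> (moebius (\<gamma> j) z)" using w by auto
          define \<alpha> where "\<alpha> = \<beta> ** \<gamma> j"
          have \<alpha>: "\<alpha> \<in> coset j" "w = moebius \<alpha> z"
            using \<beta> j z by (auto simp: \<alpha>_def r_coset_def moebius_mult)
          have \<alpha>SL: "\<alpha> \<in> SL" using \<alpha> coset_SL j by blast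
          have "{\<alpha>\<in>coset j. moebius \<alpha> z \<in> D} = {\<alpha>, -\<alpha>}"
          proof (intro equalityI subsetI)
            fix \<delta> assume \<delta>: "\<delta> \<in> {\<alpha>\<in>coset j. moebius \<alpha> z \<in> D}"
            hence \<delta>SL: "\<delta> \<in> SL" using coset_SL j by blast
            obtain \<beta>' where "\<beta>' \<in> Gamma0 N" "\<delta> = \<beta>' ** \<gamma> j" using \<delta> by (auto elim: cosetE)
            hence "moebius \<delta> z = w" using \<delta> j z by (intro uniq) (auto simp: moebius_mult)
            hence "moebius (adj2 \<alpha> ** \<delta>) z = z"
              using \<alpha> \<alpha>SL \<delta>SL z by (subst moebius_mult) auto
            hence "adj2 \<alpha> ** \<delta> = mat 1 \<or> adj2 \<alpha> ** \<delta> = - mat 1"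
              using True \<alpha>SL \<delta>SL by (intro std_domain_inequivalent[of z]) auto
            moreover have "\<delta> = \<alpha> ** (adj2 \<alpha> ** \<delta>)" using \<alpha>SL by (simp add: matrix_mul_assoc matrix_mul_lid)
            ultimately show "\<delta> \<in> {\<alpha>, -\<alpha>}" by (auto simp: mult_uminus_mat2 matrix_mul_rid)
          qed (use \<alpha> w coset_uminus in auto)
          thus ?thesis using \<alpha>SL SL_neq_uminus[OF \<alpha>SL] by (simp add: K_def emeasure_count_space)
        qed
        have "(\<integral>\<^sup>+\<alpha>. indicator D (moebius \<alpha> z) * \<psi> (moebius \<alpha> z) \<partial>K) =
            (\<integral>\<^sup>+\<alpha>. (\<Sum>j\<in>{1..r}. \<psi> (moebius (\<gamma> j) z) * indicator {\<alpha>\<in>coset j. moebius \<alpha> z \<in> D} \<alpha>) \<partial>K)"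
        proof (rule nn_integral_cong)
          fix \<alpha> assume "\<alpha> \<in> space K"
          hence \<alpha>: "\<alpha> \<in> SL" by (simp add: K_def)
          then obtain i where i: "i \<in> {1..r}" "\<alpha> \<in> coset i" using ex_coset by blast
          then obtain \<beta> where \<beta>: "\<beta> \<in> Gamma0 N" "\<alpha> = \<beta> ** \<gamma> i" by (auto elim: cosetE)
          have "\<psi> (moebius \<alpha> z) = \<psi> (moebius (\<gamma> i) z)"
            using \<beta> i z by (simp add: moebius_mult inv)
          moreover have "(\<Sum>j\<in>{1..r}. \<psi> (moebius (\<gamma> j) z) * indicator {\<alpha>\<in>coset j. moebius \<alpha> z \<in> D} \<alpha>) =
             (\<Sum>j\<in>{1..r}. if j = i then \<psi> (moebius (\<gamma> i) z) * indicator D (moebius \<alpha> z) else 0)"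
            using i coset_unique by (intro sum.cong) (auto split: split_indicator)
          ultimately show "indicator D (moebius \<alpha> z) * \<psi> (moebius \<alpha> z) =
             (\<Sum>j\<in>{1..r}. \<psi> (moebius (\<gamma> j) z) * indicator {\<alpha>\<in>coset j. moebius \<alpha> z \<in> D} \<alpha>)"
            using i by (simp add: mult.commute)
        qed
        also have "\<dots> = (\<Sum>j\<in>{1..r}. \<psi> (moebius (\<gamma> j) z) * 2)"
        proof (subst nn_integral_sum)
          show "(\<Sum>j\<in>{1..r}. \<integral>\<^sup>+\<alpha>. \<psi> (moebius (\<gamma> j) z) * indicator {\<alpha>\<in>coset j. moebius \<alpha> z \<in> D} \<alpha> \<partial>K) =
              (\<Sum>j\<in>{1..r}. \<psi> (moebius (\<gamma> j) z) * 2)"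
          proof (intro sum.cong refl)
            fix j assume j: "j \<in> {1..r}"
            have "{\<alpha>\<in>coset j. moebius \<alpha> z \<in> D} \<in> sets K" using j by (auto simp: K_def coset_SL)
            thus "(\<integral>\<^sup>+\<alpha>. \<psi> (moebius (\<gamma> j) z) * indicator {\<alpha>\<in>coset j. moebius \<alpha> z \<in> D} \<alpha> \<partial>K) = \<psi> (moebius (\<gamma> j) z) * 2"
              using card[OF j] by (simp add: nn_integral_cmult_indicator)
          qed
        qed (auto simp: K_def)
        finally show ?thesis using True by (simp add: mult.commute)
      qed auto
    qed
  qed
  also have "\<dots> = 2 * (\<Sum>j\<in>{1..r}. \<integral>\<^sup>+z. indicator std_domain z * \<psi> (moebius (\<gamma> j) z) \<partial>hyp_measure)"
    by (simp add: nn_integral_sum nn_integral_cmult sum_distrib_left)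
  finally show ?thesis
    by (subst (asm) ennreal_mult_cancel_left) auto
qed

text \<open>The nonnegative case is applied to the absolute value for integrability, and to the
  positive and negative parts for the value.\<close>

lemma integral_fundamental_domain_real:
  fixes u :: "complex \<Rightarrow> real"
  assumes D: "is_fundamental_domain N D"
    and u [measurable]: "u \<in> borel_measurable borel"
    and inv: "\<And>\<beta> z. \<beta> \<in> Gamma0 N \<Longrightarrow> Im z > 0 \<Longrightarrow> u (moebius \<beta> z) = u z"
    and int: "\<And>j. j \<in> {1..r} \<Longrightarrow> integrable hyp_measure (\<lambda>z. indicator std_domain z * u (moebius (\<gamma> j) z))"
  shows "integrable hyp_measure (\<lambda>z. indicator D z * u z)"
    and "(\<integral>z. indicator D z * u z \<partial>hyp_measure) = (\<Sum>j\<in>{1..r}. \<integral>z. indicator std_domain z * u (moebius (\<gamma> j) z) \<partial>hyp_measure)"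
proof -
  have [measurable]: "D \<in> sets borel" using D by (simp add: is_fundamental_domain_def)
  have ind: "ennreal (indicator A z * x) = indicator A z * ennreal x" for A and z :: complex and x
    by (auto split: split_indicator)
  have fin: "(\<integral>\<^sup>+z. ennreal \<bar>indicator std_domain z * u (moebius (\<gamma> j) z)\<bar> \<partial>hyp_measure) < \<infinity>" if "j \<in> {1..r}" for j
    using int[OF that] unfolding integrable_iff_bounded by simp
  have "(\<integral>\<^sup>+z. ennreal (norm (indicator D z * u z)) \<partial>hyp_measure) = (\<integral>\<^sup>+z. indicator D z * ennreal \<bar>u z\<bar> \<partial>hyp_measure)"
    by (simp add: abs_mult ind)
  also have "\<dots> = (\<Sum>j\<in>{1..r}. \<integral>\<^sup>+z. indicator std_domain z * ennreal \<bar>u (moebius (\<gamma> j) z)\<bar> \<partial>hyp_measure)"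
    by (rule nn_integral_fundamental_domain[OF D]) (auto simp: inv)
  also have "\<dots> < \<infinity>" using fin by (auto simp: abs_mult ind)
  finally show I: "integrable hyp_measure (\<lambda>z. indicator D z * u z)" by (subst integrable_iff_bounded) auto
  \<comment> \<open>\<open>ennreal\<close> sends negative numbers to 0, so s = 1 and s = -1 give the
    positive and the negative part.\<close>
  have part: "enn2real (\<integral>\<^sup>+z. ennreal (s * (indicator D z * u z)) \<partial>hyp_measure) =
     (\<Sum>j\<in>{1..r}. enn2real (\<integral>\<^sup>+z. ennreal (s * (indicator std_domain z * u (moebius (\<gamma> j) z))) \<partial>hyp_measure))" if "\<bar>s\<bar> = 1" for s
  proof -
    have fin': "(\<integral>\<^sup>+z. ennreal (s * (indicator std_domain z * u (moebius (\<gamma> j) z))) \<partial>hyp_measure) < \<infinity>" if j: "j \<in> {1..r}" for j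
    proof -
      have "(\<integral>\<^sup>+z. ennreal (s * (indicator std_domain z * u (moebius (\<gamma> j) z))) \<partial>hyp_measure) \<le> (\<integral>\<^sup>+z. ennreal \<bar>indicator std_domain z * u (moebius (\<gamma> j) z)\<bar> \<partial>hyp_measure)"
        using \<open>\<bar>s\<bar> = 1\<close> by (intro nn_integral_mono ennreal_leI) (metis abs_ge_self abs_mult mult_1)
      thus ?thesis using fin[OF j] by (simp add: le_less_trans)
    qed
    have "(\<integral>\<^sup>+z. ennreal (s * (indicator D z * u z)) \<partial>hyp_measure) = (\<integral>\<^sup>+z. indicator D z * ennreal (s * u z) \<partial>hyp_measure)"
      by (simp only: mult.left_commute[of s] ind)
    also have "\<dots> = (\<Sum>j\<in>{1..r}. \<integral>\<^sup>+z. indicator std_domain z * ennreal (s * u (moebius (\<gamma> j) z)) \<partial>hyp_measure)"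
      by (rule nn_integral_fundamental_domain[OF D]) (auto simp: inv)
    also have "\<dots> = (\<Sum>j\<in>{1..r}. \<integral>\<^sup>+z. ennreal (s * (indicator std_domain z * u (moebius (\<gamma> j) z))) \<partial>hyp_measure)"
      by (simp only: mult.left_commute[of s] ind)
    finally have "enn2real (\<integral>\<^sup>+z. ennreal (s * (indicator D z * u z)) \<partial>hyp_measure) =
      enn2real (\<Sum>j\<in>{1..r}. \<integral>\<^sup>+z. ennreal (s * (indicator std_domain z * u (moebius (\<gamma> j) z))) \<partial>hyp_measure)" by simp
    also have "\<dots> = (\<Sum>j\<in>{1..r}. enn2real (\<integral>\<^sup>+z. ennreal (s * (indicator std_domain z * u (moebius (\<gamma> j) z))) \<partial>hyp_measure))"
      using fin' by (subst enn2real_sum) (auto simp: less_top)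
    finally show ?thesis .
  qed
  show "(\<integral>z. indicator D z * u z \<partial>hyp_measure) = (\<Sum>j\<in>{1..r}. \<integral>z. indicator std_domain z * u (moebius (\<gamma> j) z) \<partial>hyp_measure)"
    using part[of 1] part[of "-1"] int by (simp add: real_lebesgue_integral_def[OF I] real_lebesgue_integral_def sum_subtractf)
qed

lemma integral_fundamental_domain:
  fixes \<phi> :: "complex \<Rightarrow> complex"
  assumes D: "is_fundamental_domain N D"
    and \<phi> [measurable]: "\<phi> \<in> borel_measurable borel"
    and inv: "\<And>\<beta> z. \<beta> \<in> Gamma0 N \<Longrightarrow> Im z > 0 \<Longrightarrow> \<phi> (moebius \<beta> z) = \<phi> z"
    and int: "\<And>j. j \<in> {1..r} \<Longrightarrow> set_integrable hyp_measure std_domain (\<lambda>z. \<phi> (moebius (\<gamma> j) z))"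
  shows "set_integrable hyp_measure D \<phi>"
    and "(LINT z:D|hyp_measure. \<phi> z) = (\<Sum>j\<in>{1..r}. LINT z:std_domain|hyp_measure. \<phi> (moebius (\<gamma> j) z))"
proof -
  have re: "integrable hyp_measure (\<lambda>z. indicator std_domain z * Re (\<phi> (moebius (\<gamma> j) z)))"
    and im: "integrable hyp_measure (\<lambda>z. indicator std_domain z * Im (\<phi> (moebius (\<gamma> j) z)))" if "j \<in> {1..r}" for j
    using integrable_Re[OF int[OF that, unfolded set_integrable_def]] 
      integrable_Im[OF int[OF that, unfolded set_integrable_def]] by auto
  note R = integral_fundamental_domain_real[OF D _ _ re] and I = integral_fundamental_domain_real[OF D _ _ im]
  have "integrable hyp_measure (\<lambda>z. of_real (indicator D z * Re (\<phi> z)) + \<i> * of_real (indicator D z * Im (\<phi> z)))"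
  proof (intro Bochner_Integration.integrable_add integrable_mult_right integrable_of_real)
    show "integrable hyp_measure (\<lambda>z. indicator D z * Re (\<phi> z))" by (rule R(1)) (auto simp: inv)
    show "integrable hyp_measure (\<lambda>z. indicator D z * Im (\<phi> z))" by (rule I(1)) (auto simp: inv)
  qed
  also have "(\<lambda>z. of_real (indicator D z * Re (\<phi> z)) + \<i> * of_real (indicator D z * Im (\<phi> z))) = (\<lambda>z. indicator D z *\<^sub>R \<phi> z)"
    by (auto simp: complex_eq_iff)
  finally show int': "set_integrable hyp_measure D \<phi>" by (simp add: set_integrable_def)
  have "Re (LINT z:D|hyp_measure. \<phi> z) = Re (\<Sum>j\<in>{1..r}. LINT z:std_domain|hyp_measure. \<phi> (moebius (\<gamma> j) z))"
  proof -
    have "Re (LINT z:D|hyp_measure. \<phi> z) = (\<integral>z. indicator D z * Re (\<phi> z) \<partial>hyp_measure)"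
      using integral_Re[OF int'[unfolded set_integrable_def]] by (simp add: set_lebesgue_integral_def)
    also have "\<dots> = (\<Sum>j\<in>{1..r}. \<integral>z. indicator std_domain z * Re (\<phi> (moebius (\<gamma> j) z)) \<partial>hyp_measure)"
      by (rule R(2)) (auto simp: inv)
    also have "\<dots> = Re (\<Sum>j\<in>{1..r}. LINT z:std_domain|hyp_measure. \<phi> (moebius (\<gamma> j) z))"
      unfolding Re_sum
    proof (intro sum.cong refl)
      fix j assume "j \<in> {1..r}"
      thus "(\<integral>z. indicator std_domain z * Re (\<phi> (moebius (\<gamma> j) z)) \<partial>hyp_measure) = Re (LINT z:std_domain|hyp_measure. \<phi> (moebius (\<gamma> j) z))"
        using integral_Re[OF int[unfolded set_integrable_def]] by (simp add: set_lebesgue_integral_def)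
    qed
    finally show ?thesis .
  qed
  moreover have "Im (LINT z:D|hyp_measure. \<phi> z) = Im (\<Sum>j\<in>{1..r}. LINT z:std_domain|hyp_measure. \<phi> (moebius (\<gamma> j) z))"
  proof -
    have "Im (LINT z:D|hyp_measure. \<phi> z) = (\<integral>z. indicator D z * Im (\<phi> z) \<partial>hyp_measure)"
      using integral_Im[OF int'[unfolded set_integrable_def]] by (simp add: set_lebesgue_integral_def)
    also have "\<dots> = (\<Sum>j\<in>{1..r}. \<integral>z. indicator std_domain z * Im (\<phi> (moebius (\<gamma> j) z)) \<partial>hyp_measure)"
      by (rule I(2)) (auto simp: inv)
    also have "\<dots> = Im (\<Sum>j\<in>{1..r}. LINT z:std_domain|hyp_measure. \<phi> (moebius (\<gamma> j) z))"
      unfolding Im_sum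
    proof (intro sum.cong refl)
      fix j assume "j \<in> {1..r}"
      thus "(\<integral>z. indicator std_domain z * Im (\<phi> (moebius (\<gamma> j) z)) \<partial>hyp_measure) = Im (LINT z:std_domain|hyp_measure. \<phi> (moebius (\<gamma> j) z))"
        using integral_Im[OF int[unfolded set_integrable_def]] by (simp add: set_lebesgue_integral_def)
    qed
    finally show ?thesis .
  qed
  ultimately show "(LINT z:D|hyp_measure. \<phi> z) = (\<Sum>j\<in>{1..r}. LINT z:std_domain|hyp_measure. \<phi> (moebius (\<gamma> j) z))"
    by (simp add: complex_eq_iff)
qed

end

section \<open>Green's formula on the fundamental domain\<close>

text \<open>The lower boundary arc as a graph over the real part, running from \<rho> at -1/2 to
  \<rho> + 1 at 1/2. With the height t above the arc as second coordinate the fundamental domain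
  becomes a half-infinite rectangle.\<close>

definition rim :: "real \<Rightarrow> complex" where "rim x = Complex x (sqrt (1 - x\<^sup>2))"
definition rim' :: "real \<Rightarrow> complex" where "rim' x = Complex 1 (- x / sqrt (1 - x\<^sup>2))"

lemma rim_pos: "\<bar>x\<bar> \<le> 1/2 \<Longrightarrow> 1 - x\<^sup>2 \<ge> (3/4::real)"
  using power_mono[of "\<bar>x\<bar>" "1/2" 2] by (simp add: power2_eq_square)

text \<open>3/4 is a rational stand-in for sqrt 3 / 2, and stays above the height 1/2 from which the
  growth bounds are stated.\<close>

lemma Im_rim_ge:
  assumes "\<bar>x\<bar> \<le> 1/2" shows "sqrt (1 - x\<^sup>2) \<ge> 3/4"
proof -
  have "(3/4::real)\<^sup>2 \<le> 1 - x\<^sup>2" using rim_pos[OF assms] by (simp add: power2_eq_square)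
  thus ?thesis by (rule real_le_rsqrt)
qed

lemma Re_rim [simp]: "Re (rim x) = x" and Im_rim: "Im (rim x) = sqrt (1 - x\<^sup>2)"
  by (auto simp: rim_def)

lemma rim_has_vector_derivative:
  assumes "\<bar>x\<bar> \<le> 1/2"
  shows "(rim has_vector_derivative rim' x) (at x within A)"
proof -
  have "((\<lambda>x. sqrt (1 - x\<^sup>2)) has_real_derivative (- x / sqrt (1 - x\<^sup>2))) (at x within A)"
    using rim_pos[OF assms] by (auto intro!: derivative_eq_intros simp: field_simps)
  thus ?thesis unfolding has_vector_derivative_complex_iff
    by (simp add: rim_def[abs_def] rim'_def)
qed

lemma continuous_on_rim [continuous_intros]:
  "continuous_on A g \<Longrightarrow> continuous_on A (\<lambda>x. rim (g x))"
  unfolding rim_def Complex_eq by (intro continuous_intros)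

lemma continuous_on_rim' [continuous_intros]:
  assumes "continuous_on A g" "\<And>x. x \<in> A \<Longrightarrow> \<bar>g x\<bar> \<le> 1/2"
  shows "continuous_on A (\<lambda>x. rim' (g x))"
proof -
  have "sqrt (1 - (g x)\<^sup>2) \<noteq> 0" if "x \<in> A" for x using Im_rim_ge[OF assms(2)[OF that]] by auto
  thus ?thesis using assms(1) unfolding rim'_def Complex_eq by (intro continuous_intros) auto
qed

lemma rim_shift_upper: "\<bar>x\<bar> \<le> 1/2 \<Longrightarrow> t \<ge> 0 \<Longrightarrow> Im (rim x + \<i> * of_real t) > 0"
  using Im_rim_ge[of x] by (simp add: Im_rim)

text \<open>Green's formula for the region swept out by translating the lower boundary arc of the
  fundamental domain upwards by \<open>T\<close>; \<open>p\<close> and \<open>q\<close> are the two Wirtinger derivatives of \<open>U\<close>.\<close>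

lemma stokes_truncated:
  fixes U p q :: "complex \<Rightarrow> complex"
  assumes U: "\<And>z. Im z > 0 \<Longrightarrow> (U has_derivative (\<lambda>h. p z * h + q z * cnj h)) (at z)"
    and p: "continuous_on upper_halfplane p" and q: "continuous_on upper_halfplane q"
    and T: "T \<ge> 0"
  shows "2 * \<i> * integral {-1/2..1/2} (\<lambda>x. integral {0..T} (\<lambda>t. q (rim x + \<i> * of_real t))) =
     \<i> * integral {0..T} (\<lambda>t. U (rim (1/2) + \<i> * of_real t) - U (rim (-1/2) + \<i> * of_real t))
     + integral {-1/2..1/2} (\<lambda>x. U (rim x) * rim' x)
     - integral {-1/2..1/2} (\<lambda>x. U (rim x + \<i> * of_real T) * rim' x)"
proof -
  define V where "V x t = U (rim x + \<i> * of_real t)" for x t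
  define P where "P x t = p (rim x + \<i> * of_real t)" for x t
  define Q where "Q x t = q (rim x + \<i> * of_real t)" for x t
  define Vx where "Vx x t = P x t * rim' x + Q x t * cnj (rim' x)" for x t
  define Vt where "Vt x t = \<i> * (P x t - Q x t)" for x t
  let ?I = "{-1/2..1/2::real}" and ?J = "{0..T}"
  let ?R = "cbox (-1/2, 0) (1/2, T)"
  have R: "?R = ?I \<times> ?J" by (auto simp: cbox_Pair_eq)
  have up: "rim x + \<i> * of_real t \<in> upper_halfplane" if "x \<in> ?I" "t \<in> ?J" for x t
    using rim_shift_upper[of x t] that by (auto simp: abs_le_iff)
  have contU: "continuous_on upper_halfplane U"
    by (intro continuous_at_imp_continuous_on ballI has_derivative_continuous[OF U]) simp
  have cont2: "continuous_on ?R (\<lambda>z. k (rim (fst z) + \<i> * of_real (snd z)))"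
    if "continuous_on upper_halfplane k" for k :: "complex \<Rightarrow> complex"
    by (rule continuous_on_compose2[OF that]) (use up in \<open>auto simp: R intro!: continuous_intros\<close>)
  have cP: "continuous_on ?R (\<lambda>(x, t). P x t)" and cQ: "continuous_on ?R (\<lambda>(x, t). Q x t)"
    and cV: "continuous_on ?R (\<lambda>(x, t). V x t)"
    using cont2[OF p] cont2[OF q] cont2[OF contU] by (auto simp: P_def Q_def V_def case_prod_beta')
  have carc': "continuous_on ?R (\<lambda>z. rim' (fst z))"
    by (intro continuous_intros) (auto simp: R)
  have cVx: "continuous_on ?R (\<lambda>(x, t). Vx x t)" and cVt: "continuous_on ?R (\<lambda>(x, t). Vt x t)"
    using cP cQ carc' unfolding Vx_def Vt_def case_prod_beta' by (auto intro!: continuous_intros)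
  have slice_t: "continuous_on ?J (k x)" if "continuous_on ?R (\<lambda>(x, t). k x t)" "x \<in> ?I" for k :: "real \<Rightarrow> real \<Rightarrow> complex" and x
  proof -
    have "continuous_on ?J (\<lambda>t. case (x, t) of (x, t) \<Rightarrow> k x t)"
      by (rule continuous_on_compose2[OF that(1), where f = "\<lambda>t. (x, t)"])
         (use that(2) in \<open>auto simp: cbox_Pair_eq intro!: continuous_intros\<close>)
    thus ?thesis by simp
  qed
  have slice_x: "continuous_on ?I (\<lambda>x. k x t)" if "continuous_on ?R (\<lambda>(x, t). k x t)" "t \<in> ?J" for k :: "real \<Rightarrow> real \<Rightarrow> complex" and t
  proof -
    have "continuous_on ?I (\<lambda>x. case (x, t) of (x, t) \<Rightarrow> k x t)"
      by (rule continuous_on_compose2[OF that(1), where f = "\<lambda>x. (x, t)"])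
         (use that(2) in \<open>auto simp: cbox_Pair_eq intro!: continuous_intros\<close>)
    thus ?thesis by simp
  qed
  have dx: "((\<lambda>x. V x t) has_vector_derivative Vx x t) (at x within ?I)" if "x \<in> ?I" "t \<in> ?J" for x t
  proof -
    have "((\<lambda>x. rim x + \<i> * of_real t) has_derivative (\<lambda>h. h *\<^sub>R rim' x)) (at x within ?I)"
      using rim_has_vector_derivative[of x ?I] that unfolding has_vector_derivative_def
      by (auto intro!: derivative_eq_intros simp: abs_le_iff)
    from has_derivative_compose[OF this U[of "rim x + \<i> * of_real t"]] up[OF that]
    show ?thesis unfolding V_def has_vector_derivative_def Vx_def P_def Q_def
      by (simp add: scaleR_conv_of_real algebra_simps)
  qed
  have dt: "((\<lambda>t. V x t) has_vector_derivative Vt x t) (at t within ?J)" if "x \<in> ?I" "t \<in> ?J" for x t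
  proof -
    have "((\<lambda>t. rim x + \<i> * of_real t) has_derivative (\<lambda>h. h *\<^sub>R \<i>)) (at t within ?J)"
      by (auto intro!: derivative_eq_intros simp: scaleR_conv_of_real mult.commute)
    from has_derivative_compose[OF this U[of "rim x + \<i> * of_real t"]] up[OF that]
    show ?thesis unfolding V_def has_vector_derivative_def Vt_def P_def Q_def
      by (simp add: scaleR_conv_of_real algebra_simps)
  qed
  have It: "integral ?J (Vt x) = V x T - V x 0" if "x \<in> ?I" for x
    using T dt that by (intro integral_unique fundamental_theorem_of_calculus) auto
  have Ix: "integral ?I (\<lambda>x. Vx x t) = V (1/2) t - V (-1/2) t" if "t \<in> ?J" for t
    using dx that by (intro integral_unique fundamental_theorem_of_calculus) auto
  \<comment> \<open>Eliminating P from the two partial derivatives leaves i Q times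
    \<open>rim' x\<close> plus its conjugate. The factor is 2 because the arc is a graph, with
    \<open>Re (rim' x) = 1\<close>.\<close>
  have rim'_eq: "2 * \<i> * Q x t = \<i> * Vx x t - rim' x * Vt x t" for x t
    by (simp add: Vx_def Vt_def rim'_def complex_eq_iff algebra_simps)
  have intt: "k x integrable_on ?J" if "continuous_on ?R (\<lambda>(x, t). k x t)" "x \<in> ?I" for k :: "real \<Rightarrow> real \<Rightarrow> complex" and x
    using slice_t[OF that] by (rule integrable_continuous_interval)
  have ci: "(\<lambda>x. integral ?J (k x)) integrable_on ?I" if "continuous_on ?R (\<lambda>(x, t). k x t)" for k :: "real \<Rightarrow> real \<Rightarrow> complex"
    using integral_integrable_2dim[of "-1/2" 0 "1/2" T "\<lambda>(x, t). k x t"] that by (simp add: case_prod_beta')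
  have cVI: "continuous_on ?I (\<lambda>x. rim' x * (V x T - V x 0))"
    using T by (intro continuous_intros slice_x[OF cV]) (auto simp: abs_le_iff)
  have "2 * \<i> * integral ?I (\<lambda>x. integral ?J (Q x)) = integral ?I (\<lambda>x. \<i> * integral ?J (Vx x) - rim' x * integral ?J (Vt x))"
  proof -
    have "2 * \<i> * integral ?I (\<lambda>x. integral ?J (Q x)) = integral ?I (\<lambda>x. integral ?J (\<lambda>t. 2 * \<i> * Q x t))"
      by simp
    also have "\<dots> = integral ?I (\<lambda>x. \<i> * integral ?J (Vx x) - rim' x * integral ?J (Vt x))"
    proof (intro integral_cong)
      fix x assume x: "x \<in> ?I"
      show "integral ?J (\<lambda>t. 2 * \<i> * Q x t) = \<i> * integral ?J (Vx x) - rim' x * integral ?J (Vt x)"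
        unfolding rim'_eq using intt[OF cVx x] intt[OF cVt x]
        by (subst integral_diff) (auto intro!: integrable_on_mult_right)
    qed
    finally show ?thesis .
  qed
  also have "\<dots> = integral ?I (\<lambda>x. \<i> * integral ?J (Vx x) - rim' x * (V x T - V x 0))"
    by (intro integral_cong) (simp add: It)
  also have "\<dots> = \<i> * integral ?I (\<lambda>x. integral ?J (Vx x)) - integral ?I (\<lambda>x. rim' x * (V x T - V x 0))"
    using ci[OF cVx] integrable_continuous_interval[OF cVI]
    by (subst integral_diff) (auto intro!: integrable_on_mult_right)
  \<comment> \<open>The x-derivative is integrated in x first and yields the vertical sides; the
    t-derivative was integrated in t first and yields top and bottom.\<close>
  also have "integral ?I (\<lambda>x. integral ?J (Vx x)) = integral ?J (\<lambda>t. integral ?I (\<lambda>x. Vx x t))"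
    using integral_swap_continuous[of "-1/2" 0 "1/2" T Vx] cVx by (simp add: case_prod_beta')
  also have "\<dots> = integral ?J (\<lambda>t. V (1/2) t - V (-1/2) t)"
    by (intro integral_cong) (rule Ix)
  also have "integral ?I (\<lambda>x. rim' x * (V x T - V x 0)) = integral ?I (\<lambda>x. V x T * rim' x) - integral ?I (\<lambda>x. V x 0 * rim' x)"
  proof -
    have "(\<lambda>x. V x t * rim' x) integrable_on ?I" if "t \<in> ?J" for t
      by (intro integrable_continuous_interval continuous_on_mult slice_x[OF cV that] continuous_intros)
         (auto simp: abs_le_iff)
    from this[of T] this[of 0] T show ?thesis
      by (subst integral_diff[symmetric]) (auto intro!: integral_cong simp: algebra_simps)
  qed
  finally show ?thesis by (simp add: Q_def V_def)
qed

lemma exp_decay_set_integrable: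
  assumes "c > (0::real)"
  shows "set_integrable lborel {a..} (\<lambda>t. exp (- c * t))"
proof -
  have "(\<lambda>t. exp (- c * t)) absolutely_integrable_on {a..}"
    using integrable_on_exp_minus_to_infinity[OF assms, of a]
    by (intro nonnegative_absolutely_integrable_1) auto
  thus ?thesis unfolding set_integrable_def by (subst integrable_completion[symmetric]) auto
qed

text \<open>The majorant for dominated convergence in \<open>stokes\<close>; Fubini separates the
  bounded width from the decaying height.\<close>

lemma strip_decay_integrable:
  assumes "c > (0::real)"
  shows "integrable lborel (\<lambda>z::complex. indicator {a..b} (Re z) * (indicator {d..} (Im z) * exp (- c * Im z)))"
proof -
  let ?h = "\<lambda>z::complex. indicator {a..b} (Re z) * (indicator {d..} (Im z) * exp (- c * Im z))"
  have "(\<integral>\<^sup>+z. ennreal (norm (?h z)) \<partial>lborel) =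
     (\<integral>\<^sup>+y. (\<integral>\<^sup>+x. indicator {a..b} x * ennreal (indicator {d..} y * exp (- c * y)) \<partial>lborel) \<partial>lborel)"
    by (subst nn_integral_lborel_complex) (auto intro!: nn_integral_cong split: split_indicator)
  also have "\<dots> = (\<integral>\<^sup>+y. emeasure lborel {a..b} * ennreal (indicator {d..} y * exp (- c * y)) \<partial>lborel)"
    by (intro nn_integral_cong) (simp add: nn_integral_multc)
  also have "\<dots> = emeasure lborel {a..b} * (\<integral>\<^sup>+y. ennreal (norm (indicator {d..} y * exp (- c * y))) \<partial>lborel)"
    by (simp add: nn_integral_cmult)
  also have "\<dots> < \<infinity>"
  proof -
    have "(\<integral>\<^sup>+y. ennreal (norm (indicator {d..} y * exp (- c * y))) \<partial>lborel) < \<infinity>"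
      using exp_decay_set_integrable[OF assms, of d]
      by (simp add: set_integrable_def integrable_iff_bounded)
    moreover have "emeasure lborel {a..b} < \<infinity>" by (simp add: emeasure_lborel_Icc_eq)
    ultimately show ?thesis by (simp add: ennreal_mult_less_top)
  qed
  finally show ?thesis by (subst integrable_iff_bounded) auto
qed

lemma std_domain_Complex_iff:
  assumes "\<bar>x\<bar> < 1/2" "y > 0"
  shows "Complex x y \<in> std_domain \<longleftrightarrow> y > sqrt (1 - x\<^sup>2)"
proof -
  have "cmod (Complex x y) > 1 \<longleftrightarrow> 1 < x\<^sup>2 + y\<^sup>2" by (simp add: cmod_def)
  also have "\<dots> \<longleftrightarrow> 1 - x\<^sup>2 < y\<^sup>2" by auto
  also have "\<dots> \<longleftrightarrow> sqrt (1 - x\<^sup>2) < y" using assms(2)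
    by (metis real_sqrt_less_iff real_sqrt_unique less_imp_le)
  finally show ?thesis using assms by (simp add: std_domain_def)
qed

lemma std_domain_Im_ge:
  assumes "z \<in> std_domain" shows "Im z \<ge> 1/2"
proof -
  have "\<bar>Re z\<bar> < 1/2" "Im z > 0" using assms by (auto simp: std_domain_def)
  thus ?thesis using std_domain_Complex_iff[of "Re z" "Im z"] Im_rim_ge[of "Re z"] assms by auto
qed

lemma norm_rim'_le: "\<bar>x\<bar> \<le> 1/2 \<Longrightarrow> cmod (rim' x) \<le> 2"
proof -
  assume x: "\<bar>x\<bar> \<le> 1/2"
  have "\<bar>- x / sqrt (1 - x\<^sup>2)\<bar> \<le> 1"
  proof -
    have "\<bar>x\<bar> \<le> sqrt (1 - x\<^sup>2)" using x Im_rim_ge[OF x] by linarith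
    moreover have "sqrt (1 - x\<^sup>2) > 0" using Im_rim_ge[OF x] by linarith
    ultimately show ?thesis by (simp only: abs_divide abs_minus_cancel abs_of_pos divide_le_eq_1_pos)
  qed
  thus "cmod (rim' x) \<le> 2"
    using cmod_le[of "rim' x"] by (simp add: rim'_def)
qed

text \<open>Letting T tend to infinity in \<open>stokes_truncated\<close>: the area integral
  converges by domination and the top edge tends to 0. The sides remain as a limit because they are
  evaluated only after summation over cosets.\<close>

lemma stokes:
  fixes U p q :: "complex \<Rightarrow> complex"
  assumes U: "\<And>z. Im z > 0 \<Longrightarrow> (U has_derivative (\<lambda>h. p z * h + q z * cnj h)) (at z)"
    and p: "continuous_on upper_halfplane p" and q: "continuous_on upper_halfplane q"
    and c: "c > 0"
    and U_le: "\<And>z. \<bar>Re z\<bar> \<le> 1/2 \<Longrightarrow> Im z \<ge> 1/2 \<Longrightarrow> cmod (U z) \<le> C * exp (- c * Im z)"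
    and q_le: "\<And>z. \<bar>Re z\<bar> \<le> 1/2 \<Longrightarrow> Im z \<ge> 1/2 \<Longrightarrow> cmod (q z) \<le> C * exp (- c * Im z)"
  shows "set_integrable lborel std_domain q"
    and "((\<lambda>T. \<i> * integral {0..T} (\<lambda>t. U (rim (1/2) + \<i> * of_real t) - U (rim (-1/2) + \<i> * of_real t))) \<longlongrightarrow>
          2 * \<i> * (LINT z:std_domain|lborel. q z) - integral {-1/2..1/2} (\<lambda>x. U (rim x) * rim' x)) at_top"
proof -
  have upper: "std_domain \<subseteq> upper_halfplane" using std_domain_upper by auto
  have [measurable]: "(\<lambda>z. indicator std_domain z *\<^sub>R q z) \<in> borel_measurable borel"
    by (intro borel_measurable_continuous_on_indicator continuous_on_subset[OF q upper] std_domain_borel)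
  define w where "w z = C * (indicator {-1/2..1/2} (Re z) * (indicator {1/2..} (Im z) * exp (- c * Im z)))" for z
  have w: "integrable lborel w"
    unfolding w_def by (intro integrable_mult_right strip_decay_integrable c)
  have C: "C \<ge> 0"
  proof -
    have "0 \<le> C * exp (- c * Im \<i>)" using order_trans[OF norm_ge_zero U_le[of \<i>]] by simp
    thus ?thesis by (simp add: zero_le_mult_iff)
  qed
  have le_w: "norm (indicator std_domain z *\<^sub>R q z) \<le> w z" for z
  proof (cases "z \<in> std_domain")
    case True
    hence "\<bar>Re z\<bar> < 1/2" "Im z \<ge> 1/2" using std_domain_Im_ge by (auto simp: std_domain_def)
    moreover from this have "-1/2 \<le> Re z" "Re z \<le> 1/2" by linarith+
    ultimately show ?thesis using q_le[of z] True by (simp add: w_def)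
  qed (use C in \<open>simp add: w_def\<close>)
  show int: "set_integrable lborel std_domain q" unfolding set_integrable_def
    by (rule Bochner_Integration.integrable_bound[OF w]) (use le_w in \<open>auto intro: order_trans[OF _ abs_ge_self]\<close>)
  \<comment> \<open>The cut is the arc raised by T, not a horizontal line, so that the truncated
    region is a rectangle in the coordinates (x, t).\<close>
  define B where "B T = {z. Im z < sqrt (1 - (Re z)\<^sup>2) + T}" for T
  have [measurable]: "B T \<in> sets borel" for T unfolding B_def by measurable
  have le_wB: "norm (indicator (B T) z *\<^sub>R indicator std_domain z *\<^sub>R q z) \<le> w z" for T z
  proof -
    have "norm (indicator (B T) z *\<^sub>R indicator std_domain z *\<^sub>R q z) \<le> norm (indicator std_domain z *\<^sub>R q z)"
      by (simp add: indicator_def)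
    also have "\<dots> \<le> w z" by (rule le_w)
    finally show ?thesis .
  qed
  have trunc: "(\<integral>z. indicator (B T) z *\<^sub>R indicator std_domain z *\<^sub>R q z \<partial>lborel) =
      integral {-1/2..1/2} (\<lambda>x. integral {0..T} (\<lambda>t. q (rim x + \<i> * of_real t)))" if T: "T \<ge> 0" for T
  proof -
    define h where "h z = indicator (B T) z *\<^sub>R indicator std_domain z *\<^sub>R q z" for z
    define G where "G x = integral {0..T} (\<lambda>t. q (rim x + \<i> * of_real t))" for x
    have [measurable]: "h \<in> borel_measurable borel" unfolding h_def by measurable
    have "integrable lborel h"
    proof (rule Bochner_Integration.integrable_bound[OF w])
      show "AE z in lborel. norm (h z) \<le> norm (w z)"
      using le_wB by (auto simp: h_def intro!: AE_I2 order_trans[OF _ abs_ge_self] simp del: scaleR_scaleR norm_scaleR)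
    qed simp
    hence hint: "integrable (lborel \<Otimes>\<^sub>M lborel) (\<lambda>(x, y). h (Complex x y))"
      by (subst (asm) lborel_complex, subst (asm) integrable_distr_eq) (auto simp: case_prod_beta')
    have inner: "(\<integral>y. h (Complex x y) \<partial>lborel) = indicator {-1/2<..<1/2} x *\<^sub>R G x" for x
    proof (cases "\<bar>x\<bar> < 1/2")
      case True
      hence x: "\<bar>x\<bar> \<le> 1/2" by simp
      have "(\<integral>y. h (Complex x y) \<partial>lborel) = (\<integral>t. h (Complex x (sqrt (1 - x\<^sup>2) + 1 * t)) \<partial>lborel)"
        by (subst lborel_integral_real_affine[where c = 1 and t = "sqrt (1 - x\<^sup>2)"]) auto
      also have "\<dots> = (LINT t:{0<..<T}|lborel. q (rim x + \<i> * of_real t))"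
        unfolding set_lebesgue_integral_def
      proof (rule Bochner_Integration.integral_cong[OF refl])
        fix t
        have eq: "Complex x (sqrt (1 - x\<^sup>2) + 1 * t) = rim x + \<i> * of_real t"
          by (simp add: rim_def complex_eq_iff)
        have "Complex x (sqrt (1 - x\<^sup>2) + 1 * t) \<in> std_domain \<longleftrightarrow> t > 0"
        proof (cases "sqrt (1 - x\<^sup>2) + 1 * t > 0")
          case True
          thus ?thesis using std_domain_Complex_iff[OF \<open>\<bar>x\<bar> < 1/2\<close> True] by simp
        next
          case False
          thus ?thesis using Im_rim_ge[OF x] by (auto simp: std_domain_def)
        qed
        thus "h (Complex x (sqrt (1 - x\<^sup>2) + 1 * t)) = indicator {0<..<T} t *\<^sub>R q (rim x + \<i> * of_real t)"
          unfolding h_def eq by (auto simp: B_def Im_rim indicator_def)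
      qed
      also have "\<dots> = integral {0<..<T} (\<lambda>t. q (rim x + \<i> * of_real t))"
      proof (rule set_borel_integral_eq_integral)
        have "continuous_on {0..T} (\<lambda>t. q (rim x + \<i> * of_real t))"
          by (rule continuous_on_compose2[OF q]) (use rim_shift_upper[OF x] in \<open>auto intro!: continuous_intros\<close>)
        hence "set_integrable lborel {0..T} (\<lambda>t. q (rim x + \<i> * of_real t))"
          by (rule borel_integrable_atLeastAtMost')
        thus "set_integrable lborel {0<..<T} (\<lambda>t. q (rim x + \<i> * of_real t))"
          by (rule set_integrable_subset) auto
      qed
      also have "\<dots> = G x" unfolding G_def by (simp add: integral_open_interval_real)
      finally show ?thesis using True by (simp add: indicator_def abs_less_iff) linarith
    next
      case False
      hence "h (Complex x y) = 0" for y by (simp add: h_def std_domain_def)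
      moreover have "x \<notin> {-1/2<..<1/2}" using False by auto
      ultimately show ?thesis by simp
    qed
    have "(\<integral>z. h z \<partial>lborel) = (\<integral>p. (case p of (x, y) \<Rightarrow> h (Complex x y)) \<partial>(lborel \<Otimes>\<^sub>M lborel))"
      by (subst lborel_complex, subst integral_distr) (auto simp: case_prod_beta')
    also have "\<dots> = (\<integral>x. \<integral>y. h (Complex x y) \<partial>lborel \<partial>lborel)"
      using lborel_pair.integral_fst'[OF hint] by simp
    also have "\<dots> = (LINT x:{-1/2<..<1/2}|lborel. G x)"
      unfolding inner set_lebesgue_integral_def ..
    also have "\<dots> = integral {-1/2<..<1/2} G"
      using lborel_pair.integrable_fst'[OF hint]
      by (intro set_borel_integral_eq_integral) (simp add: inner set_integrable_def)
    also have "\<dots> = integral {-1/2..1/2} G" by (rule integral_open_interval_real[symmetric])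
    finally show ?thesis unfolding h_def G_def[abs_def] .
  qed
  have lim1: "((\<lambda>T. \<integral>z. indicator (B T) z *\<^sub>R indicator std_domain z *\<^sub>R q z \<partial>lborel) \<longlongrightarrow> (\<integral>z. indicator std_domain z *\<^sub>R q z \<partial>lborel)) at_top"
  proof (rule integral_dominated_convergence_at_top[OF _ _ w])
    show "AE z in lborel. ((\<lambda>T. indicator (B T) z *\<^sub>R indicator std_domain z *\<^sub>R q z) \<longlongrightarrow> indicator std_domain z *\<^sub>R q z) at_top"
    proof (intro AE_I2 tendsto_eventually)
      fix z
      have "eventually (\<lambda>T. T > Im z - sqrt (1 - (Re z)\<^sup>2)) at_top" by (rule eventually_gt_at_top)
      thus "eventually (\<lambda>T. indicator (B T) z *\<^sub>R indicator std_domain z *\<^sub>R q z = indicator std_domain z *\<^sub>R q z) at_top"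
        by eventually_elim (simp add: B_def)
    qed
    show "\<forall>\<^sub>F T in at_top. AE z in lborel. norm (indicator (B T) z *\<^sub>R indicator std_domain z *\<^sub>R q z) \<le> w z"
      by (intro always_eventually allI AE_I2 le_wB)
  qed measurable
  have contU: "continuous_on upper_halfplane U"
    by (intro continuous_at_imp_continuous_on ballI has_derivative_continuous[OF U]) simp
  have lim2: "((\<lambda>T. integral {-1/2..1/2} (\<lambda>x. U (rim x + \<i> * of_real T) * rim' x)) \<longlongrightarrow> 0) at_top"
  proof (rule Lim_null_comparison)
    show "\<forall>\<^sub>F T in at_top. norm (integral {-1/2..1/2} (\<lambda>x. U (rim x + \<i> * of_real T) * rim' x)) \<le> C * exp (- c * T) * 2 * (1/2 - (-1/2))"
      using eventually_ge_at_top[of 0]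
    proof eventually_elim
      case (elim T)
      show ?case
      proof (rule integral_bound)
        show "continuous_on {-1/2..1/2} (\<lambda>x. U (rim x + \<i> * of_real T) * rim' x)"
          using rim_shift_upper elim
          by (intro continuous_intros continuous_on_compose2[OF contU]) (auto simp: abs_le_iff)
        fix x :: real assume "x \<in> {-1/2..1/2}"
        hence x: "\<bar>x\<bar> \<le> 1/2" by (auto simp: abs_le_iff)
        have "cmod (U (rim x + \<i> * of_real T)) \<le> C * exp (- c * Im (rim x + \<i> * of_real T))"
          using x elim Im_rim_ge[OF x] by (intro U_le) (auto simp: Im_rim)
        also have "\<dots> \<le> C * exp (- c * T)"
          using c C Im_rim_ge[OF x] rim_pos[OF x] by (intro mult_left_mono) (auto simp: Im_rim)
        finally have "cmod (U (rim x + \<i> * of_real T)) * cmod (rim' x) \<le> C * exp (- c * T) * 2"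
          using norm_rim'_le[OF x] C by (intro mult_mono) auto
        thus "norm (U (rim x + \<i> * of_real T) * rim' x) \<le> C * exp (- c * T) * 2" by (simp add: norm_mult)
      qed auto
    qed
    have "filterlim (\<lambda>T. - c * T) at_bot at_top"
      using c by (intro filterlim_tendsto_neg_mult_at_bot[OF tendsto_const] filterlim_ident) auto
    hence "((\<lambda>T. exp (- c * T)) \<longlongrightarrow> 0) at_top" by (rule filterlim_compose[OF exp_at_bot])
    hence "((\<lambda>T. C * exp (- c * T) * 2 * (1/2 - (-1/2))) \<longlongrightarrow> C * 0 * 2 * (1/2 - (-1/2))) at_top"
      by (intro tendsto_intros)
    thus "((\<lambda>T. C * exp (- c * T) * 2 * (1/2 - (-1/2))) \<longlongrightarrow> 0) at_top" by simp
  qed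
  have "((\<lambda>T. 2 * \<i> * (\<integral>z. indicator (B T) z *\<^sub>R indicator std_domain z *\<^sub>R q z \<partial>lborel)
      - integral {-1/2..1/2} (\<lambda>x. U (rim x) * rim' x) + integral {-1/2..1/2} (\<lambda>x. U (rim x + \<i> * of_real T) * rim' x)) \<longlongrightarrow>
      2 * \<i> * (\<integral>z. indicator std_domain z *\<^sub>R q z \<partial>lborel) - integral {-1/2..1/2} (\<lambda>x. U (rim x) * rim' x) + 0) at_top"
    by (intro tendsto_intros lim1 lim2)
  moreover have "\<forall>\<^sub>F T in at_top. 2 * \<i> * (\<integral>z. indicator (B T) z *\<^sub>R indicator std_domain z *\<^sub>R q z \<partial>lborel)
      - integral {-1/2..1/2} (\<lambda>x. U (rim x) * rim' x) + integral {-1/2..1/2} (\<lambda>x. U (rim x + \<i> * of_real T) * rim' x) =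
      \<i> * integral {0..T} (\<lambda>t. U (rim (1/2) + \<i> * of_real t) - U (rim (-1/2) + \<i> * of_real t))"
    using eventually_ge_at_top[of 0]
  proof eventually_elim
    case (elim T)
    show ?case using stokes_truncated[OF U p q elim] unfolding trunc[OF elim] by (simp add: algebra_simps)
  qed
  ultimately show "((\<lambda>T. \<i> * integral {0..T} (\<lambda>t. U (rim (1/2) + \<i> * of_real t) - U (rim (-1/2) + \<i> * of_real t))) \<longlongrightarrow>
          2 * \<i> * (LINT z:std_domain|lborel. q z) - integral {-1/2..1/2} (\<lambda>x. U (rim x) * rim' x)) at_top"
    unfolding set_lebesgue_integral_def add_0_right by (rule Lim_transform_eventually)
qed

section \<open>Growth of periodic holomorphic functions\<close>

lemma at_i_inf_iff: "eventually P at_i_inf \<longleftrightarrow> (\<exists>Y. \<forall>z. Im z > Y \<longrightarrow> P z)"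
proof
  assume "eventually P at_i_inf"
  then obtain Q where Q: "eventually Q at_top" "\<And>z. Q (Im z) \<Longrightarrow> P z"
    unfolding eventually_filtercomap by blast
  then obtain Y where "\<And>y. y \<ge> Y \<Longrightarrow> Q y" unfolding eventually_at_top_linorder by blast
  thus "\<exists>Y. \<forall>z. Im z > Y \<longrightarrow> P z" using Q(2) by (meson less_imp_le)
next
  assume "\<exists>Y. \<forall>z. Im z > Y \<longrightarrow> P z"
  then obtain Y where Y: "\<And>z. Im z > Y \<Longrightarrow> P z" by blast
  show "eventually P at_i_inf" unfolding eventually_filtercomap
    by (intro exI[of _ "\<lambda>y. y > Y"] conjI eventually_gt_at_top) (use Y in auto)
qed

text \<open>The q-expansion principle. Periodicity makes f a holomorphic function of q on the
  punctured disc, and boundedness near i infinity makes q = 0 a removable singularity.\<close>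

lemma periodic_factors_through_exp:
  fixes f :: "complex \<Rightarrow> complex" and N :: nat
  assumes hol: "f holomorphic_on upper_halfplane" and N: "N \<ge> 1"
    and per: "\<And>\<tau>. Im \<tau> > 0 \<Longrightarrow> f (\<tau> + of_nat N) = f \<tau>"
    and bdd: "Bfun f at_i_inf"
  obtains G where "G holomorphic_on ball 0 1"
    "\<And>\<tau>. Im \<tau> > 0 \<Longrightarrow> f \<tau> = G (exp (2 * of_real pi * \<i> * \<tau> / of_nat N))"
proof -
  define L where "L w = of_nat N * w / (2 * of_real pi * \<i>)" for w :: complex
  have ImL: "Im (L w) = - (real N * Re w / (2 * pi))" for w
    by (simp add: L_def Im_divide Re_divide power2_eq_square field_simps)
  have ImL_pos: "Im (L w) > 0" if "Re w < 0" for w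
    unfolding ImL using that N by (simp add: divide_neg_pos mult_pos_neg)
  have per_nat: "f (\<tau> + of_nat N * of_nat n) = f \<tau>" if "Im \<tau> > 0" for \<tau> n
  proof (induction n)
    case (Suc n)
    have "f (\<tau> + of_nat N * of_nat (Suc n)) = f ((\<tau> + of_nat N * of_nat n) + of_nat N)"
      by (simp add: algebra_simps)
    also have "\<dots> = f (\<tau> + of_nat N * of_nat n)" using that by (intro per) simp
    finally show ?case using Suc by simp
  qed simp
  have per_int: "f (\<tau> + of_nat N * of_int n) = f \<tau>" if "Im \<tau> > 0" for \<tau> n
  proof (cases "n \<ge> 0")
    case True
    thus ?thesis using per_nat[OF that, of "nat n"] by simp
  next
    case False
    thus ?thesis using per_nat[of "\<tau> + of_nat N * of_int n" "nat (- n)"] that by (simp add: algebra_simps)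
  qed
  \<comment> \<open>The jump of the principal logarithm moves the argument of f by a multiple of N,
    which f does not see.\<close>
  define F where "F q = f (L (Ln q))" for q
  have F_exp: "F (exp w) = f (L w)" if "Re w < 0" for w
  proof -
    have "exp (Ln (exp w)) = exp w" by simp
    then obtain n :: int where n: "Ln (exp w) = w + of_int (2 * n) * of_real pi * \<i>"
      unfolding exp_eq by (auto simp: mult.assoc)
    have "L (Ln (exp w)) = L w + of_nat N * of_int n"
      unfolding n by (simp add: L_def field_simps)
    moreover have "Im (L w) > 0" using that by (rule ImL_pos)
    ultimately show ?thesis unfolding F_def by (simp add: per_int)
  qed
  have F_deriv: "\<exists>f'. (F has_field_derivative f') (at q0)" if "q0 \<in> ball 0 1 - {0}" for q0
  proof -
    have q0: "q0 \<in> ball 0 1" "q0 \<noteq> 0" using that by auto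
    define A where "A = ball 0 1 \<inter> ball q0 (cmod q0)"
    \<comment> \<open>A local logarithm without a cut: on A the quotient q / q0 lies in the right
      half-plane.\<close>
    define w where "w q = Ln (q / q0) + Ln q0" for q
    have A: "open A" "q0 \<in> A" using q0 by (auto simp: A_def)
    have A_Re: "Re (q / q0) > 0" if "q \<in> A" for q
    proof -
      have "cmod (1 - q / q0) < 1"
      proof -
        have "1 - q / q0 = (q0 - q) / q0" using q0 by (simp add: field_simps)
        thus ?thesis using that q0 by (simp add: A_def dist_norm norm_divide)
      qed
      hence "\<bar>Re (1 - q / q0)\<bar> < 1" using abs_Re_le_cmod le_less_trans by blast
      thus ?thesis by simp
    qed
    have exp_w: "exp (w q) = q" if "q \<in> A" for q
    proof -
      have "q \<noteq> 0" using A_Re[OF that] by auto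
      thus ?thesis using q0 by (simp add: w_def exp_add)
    qed
    have Re_w: "Re (w q) < 0" if "q \<in> A" for q
    proof -
      have "exp (Re (w q)) = cmod q" using exp_w[OF that] norm_exp_eq_Re[of "w q"] by simp
      also have "\<dots> < exp 0" using that by (simp add: A_def)
      finally show ?thesis by simp
    qed
    have w_hol: "w holomorphic_on A"
      unfolding w_def using q0 by (intro holomorphic_intros) (auto simp: complex_nonpos_Reals_iff dest: A_Re)
    have "(f \<circ> (\<lambda>q. L (w q))) holomorphic_on A"
    proof (rule holomorphic_on_compose_gen[OF _ hol])
      show "(\<lambda>q. L (w q)) holomorphic_on A" unfolding L_def
        by (intro holomorphic_intros w_hol) auto
      show "(\<lambda>q. L (w q)) ` A \<subseteq> upper_halfplane"
        using ImL_pos[OF Re_w] by auto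
    qed
    hence "F holomorphic_on A"
    proof (rule holomorphic_transform)
      fix q assume "q \<in> A"
      thus "(f \<circ> (\<lambda>q. L (w q))) q = F q" using F_exp[OF Re_w] exp_w by simp
    qed
    thus "\<exists>f'. (F has_field_derivative f') (at q0)"
      using A holomorphic_on_open by blast
  qed
  have F_hol: "F holomorphic_on ball 0 1 - {0}"
    using F_deriv by (subst holomorphic_on_open) (auto simp: open_delete)
  have "\<exists>B. eventually (\<lambda>q. norm (F q) \<le> B) (at 0)"
  proof -
    obtain B where "eventually (\<lambda>\<tau>. norm (f \<tau>) \<le> B) at_i_inf" using bdd unfolding Bfun_def by auto
    then obtain Y where Y: "\<And>\<tau>. Im \<tau> > Y \<Longrightarrow> norm (f \<tau>) \<le> B" unfolding at_i_inf_iff by auto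
    define d where "d = exp (- (2 * pi * Y / real N))"
    have "norm (F q) \<le> B" if "q \<noteq> 0" "cmod q < d" for q
      unfolding F_def
    proof (rule Y)
      have "ln (cmod q) < - (2 * pi * Y / real N)" using that unfolding d_def by (metis ln_less_cancel_iff ln_exp exp_gt_zero zero_less_norm_iff)
      hence "Y < - (real N * ln (cmod q) / (2 * pi))" using N by (simp add: field_simps)
      thus "Y < Im (L (Ln q))" using that by (simp add: ImL)
    qed
    hence "eventually (\<lambda>q. norm (F q) \<le> B) (at 0)"
      unfolding eventually_at by (intro exI[of _ d]) (auto simp: d_def)
    thus ?thesis by blast
  qed
  hence "\<exists>G. G holomorphic_on ball 0 1 \<and> (\<forall>z \<in> ball 0 1 - {0}. G z = F z)"
    by (subst holomorphic_on_extend_bounded[OF F_hol]) auto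
  then obtain G where G: "G holomorphic_on ball 0 1" "\<And>z. z \<in> ball 0 1 - {0} \<Longrightarrow> G z = F z" by blast
  show ?thesis
  proof (rule that[OF G(1)])
    fix \<tau> assume \<tau>: "Im \<tau> > 0"
    define w where "w = 2 * of_real pi * \<i> * \<tau> / of_nat N"
    have "Re w < 0" using \<tau> N by (simp add: w_def Re_divide Im_divide power2_eq_square field_simps)
    moreover have "L w = \<tau>" using N by (simp add: w_def L_def)
    ultimately show "f \<tau> = G (exp (2 * of_real pi * \<i> * \<tau> / of_nat N))"
      using F_exp[of w] G(2)[of "exp w"] by (simp add: w_def)
  qed
qed

text \<open>The strip contains the fundamental domain together with its translate by 1.\<close>

definition strip :: "complex set" where "strip = {z. \<bar>Re z\<bar> \<le> 1 \<and> Im z \<ge> 1/2}"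

definition decays :: "(complex \<Rightarrow> complex) \<Rightarrow> bool" where
  "decays h \<longleftrightarrow> (\<exists>C c. c > 0 \<and> (\<forall>z\<in>strip. cmod (h z) \<le> C * exp (- c * Im z)))"

text \<open>Subexponential growth: wide enough to contain the forms, the powers of z and primitives,
  and narrow enough that a product with a decaying function still decays.\<close>

definition moderate :: "(complex \<Rightarrow> complex) \<Rightarrow> bool" where
  "moderate h \<longleftrightarrow> (\<forall>e>0. \<exists>C. \<forall>z\<in>strip. cmod (h z) \<le> C * exp (e * Im z))"

text \<open>Heights of at least 1/2 correspond to a compact disc of radius less than 1 in q.
  Vanishing at the cusp means G 0 = 0, so a factor q, of size exp (- c y), splits off.\<close>

lemma periodic_bounded:
  fixes f :: "complex \<Rightarrow> complex" and N :: nat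
  assumes "f holomorphic_on upper_halfplane" "N \<ge> 1"
    and "\<And>\<tau>. Im \<tau> > 0 \<Longrightarrow> f (\<tau> + of_nat N) = f \<tau>" "Bfun f at_i_inf"
  shows "\<exists>C. \<forall>\<tau>. Im \<tau> \<ge> 1/2 \<longrightarrow> cmod (f \<tau>) \<le> C"
    and "vanishes_at_i_inf f \<Longrightarrow> \<exists>C c. c > 0 \<and> (\<forall>\<tau>. Im \<tau> \<ge> 1/2 \<longrightarrow> cmod (f \<tau>) \<le> C * exp (- c * Im \<tau>))"
proof -
  obtain G where G: "G holomorphic_on ball 0 1"
    "\<And>\<tau>. Im \<tau> > 0 \<Longrightarrow> f \<tau> = G (exp (2 * of_real pi * \<i> * \<tau> / of_nat N))"
    using periodic_factors_through_exp[OF assms] by blast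
  define q where "q \<tau> = exp (2 * of_real pi * \<i> * \<tau> / of_nat N)" for \<tau>
  define c where "c = 2 * pi / real N"
  have c: "c > 0" using assms(2) by (simp add: c_def)
  have norm_q: "cmod (q \<tau>) = exp (- c * Im \<tau>)" for \<tau>
    by (simp add: q_def norm_exp_eq_Re c_def Re_divide power2_eq_square)
  define R where "R = exp (- c * (1/2))"
  have R: "R < 1" using c by (simp add: R_def)
  have q_R: "q \<tau> \<in> cball 0 R" if "Im \<tau> \<ge> 1/2" for \<tau>
    using that c by (simp add: norm_q R_def)
  have bounded: "\<exists>C. \<forall>z\<in>cball 0 R. cmod (H z) \<le> C" if "H holomorphic_on ball 0 1" for H
  proof -
    have "compact (H ` cball 0 R)"
      using R by (intro compact_continuous_image holomorphic_on_imp_continuous_on[OF holomorphic_on_subset[OF that]]) auto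
    from compact_imp_bounded[OF this] show ?thesis unfolding bounded_iff by auto
  qed
  show "\<exists>C. \<forall>\<tau>. Im \<tau> \<ge> 1/2 \<longrightarrow> cmod (f \<tau>) \<le> C"
  proof -
    obtain C where "\<And>z. z \<in> cball 0 R \<Longrightarrow> cmod (G z) \<le> C" using bounded[OF G(1)] by blast
    thus ?thesis using G(2) q_R unfolding q_def by (intro exI[of _ C]) auto
  qed
  assume van: "vanishes_at_i_inf f"
  have G0: "G 0 = 0"
  proof -
    have y: "filterlim (\<lambda>y. \<i> * of_real y) at_i_inf at_top"
      unfolding filterlim_filtercomap_iff by (simp add: o_def filterlim_ident)
    have "((\<lambda>y. exp (- c * y)) \<longlongrightarrow> 0) at_top"
    proof (rule filterlim_compose[OF exp_at_bot])
      show "filterlim (\<lambda>y. - c * y) at_bot at_top"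
        using c by (intro filterlim_tendsto_neg_mult_at_bot[OF tendsto_const] filterlim_ident) auto
    qed
    hence "((\<lambda>y. q (\<i> * of_real y)) \<longlongrightarrow> 0) at_top"
      by (subst tendsto_norm_zero_iff[symmetric]) (simp add: norm_q)
    moreover have "isCont G 0"
      using holomorphic_on_imp_continuous_on[OF G(1)] by (simp add: continuous_on_eq_continuous_at)
    ultimately have 1: "((\<lambda>y. G (q (\<i> * of_real y))) \<longlongrightarrow> G 0) at_top"
      by (rule isCont_tendsto_compose[rotated])
    have "((\<lambda>y. f (\<i> * of_real y)) \<longlongrightarrow> 0) at_top"
      using filterlim_compose[OF van[unfolded vanishes_at_i_inf_def] y] .
    moreover have "eventually (\<lambda>y. f (\<i> * of_real y) = G (q (\<i> * of_real y))) at_top"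
      using eventually_gt_at_top[of 0] by eventually_elim (simp add: G(2) q_def)
    ultimately have "((\<lambda>y. G (q (\<i> * of_real y))) \<longlongrightarrow> 0) at_top"
      by (rule Lim_transform_eventually)
    with 1 show ?thesis using tendsto_unique by (metis trivial_limit_at_top_linorder)
  qed
  \<comment> \<open>The quotient G z / z with its removable singularity filled in.\<close>
  define H where "H z = (if z = 0 then deriv G 0 else (G z - G 0) / (z - 0))" for z
  have "H holomorphic_on ball 0 1" unfolding H_def
    by (rule pole_lemma[OF G(1)]) auto
  then obtain C where C: "\<And>z. z \<in> cball 0 R \<Longrightarrow> cmod (H z) \<le> C" using bounded by blast
  have "cmod (f \<tau>) \<le> C * exp (- c * Im \<tau>)" if "Im \<tau> \<ge> 1/2" for \<tau>
  proof -
    have "f \<tau> = H (q \<tau>) * q \<tau>" using that G(2)[of \<tau>] by (simp add: H_def G0 q_def)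
    hence "cmod (f \<tau>) = cmod (H (q \<tau>)) * exp (- c * Im \<tau>)" by (simp add: norm_mult norm_q)
    also have "\<dots> \<le> C * exp (- c * Im \<tau>)" by (intro mult_right_mono C q_R that) auto
    finally show ?thesis .
  qed
  thus "\<exists>C c. c > 0 \<and> (\<forall>\<tau>. Im \<tau> \<ge> 1/2 \<longrightarrow> cmod (f \<tau>) \<le> C * exp (- c * Im \<tau>))" using c by blast
qed

section \<open>Calculus of the growth classes\<close>

lemma decaysI:
  "c > 0 \<Longrightarrow> (\<And>z. z \<in> strip \<Longrightarrow> cmod (h z) \<le> C * exp (- c * Im z)) \<Longrightarrow> decays h"
  unfolding decays_def by blast

lemma decaysE:
  assumes "decays h"
  obtains C c where "C \<ge> 0" "c > 0" "\<And>z. z \<in> strip \<Longrightarrow> cmod (h z) \<le> C * exp (- c * Im z)"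
proof -
  obtain C c where *: "c > 0" "\<And>z. z \<in> strip \<Longrightarrow> cmod (h z) \<le> C * exp (- c * Im z)"
    using assms unfolding decays_def by blast
  have "0 \<le> C * exp (- c * Im \<i>)" using order_trans[OF norm_ge_zero *(2)[of \<i>]] by (simp add: strip_def)
  hence "C \<ge> 0" by (simp add: zero_le_mult_iff)
  thus ?thesis using that * by blast
qed

lemma moderateE:
  assumes "moderate h" "e > 0"
  obtains C where "C \<ge> 0" "\<And>z. z \<in> strip \<Longrightarrow> cmod (h z) \<le> C * exp (e * Im z)"
proof -
  obtain C where *: "\<And>z. z \<in> strip \<Longrightarrow> cmod (h z) \<le> C * exp (e * Im z)"
    using assms unfolding moderate_def by blast
  have "0 \<le> C * exp (e * Im \<i>)" using order_trans[OF norm_ge_zero *[of \<i>]] by (simp add: strip_def)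
  hence "C \<ge> 0" by (simp add: zero_le_mult_iff)
  thus ?thesis using that * by blast
qed

lemma decays_mult:
  assumes "decays h" "moderate k" shows "decays (\<lambda>z. h z * k z)"
proof -
  obtain C c where C: "C \<ge> 0" "c > 0" "\<And>z. z \<in> strip \<Longrightarrow> cmod (h z) \<le> C * exp (- c * Im z)"
    using decaysE[OF assms(1)] by blast
  obtain D where D: "D \<ge> 0" "\<And>z. z \<in> strip \<Longrightarrow> cmod (k z) \<le> D * exp (c / 2 * Im z)"
    using moderateE[OF assms(2), of "c / 2"] C(2) by auto
  show ?thesis
  proof (rule decaysI)
    fix z assume z: "z \<in> strip"
    have "cmod (h z * k z) \<le> (C * exp (- c * Im z)) * (D * exp (c / 2 * Im z))"
      unfolding norm_mult using C D z by (intro mult_mono) auto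
    also have "\<dots> = C * D * (exp (- c * Im z) * exp (c / 2 * Im z))" by (simp add: mult_ac)
    also have "exp (- c * Im z) * exp (c / 2 * Im z) = exp (- (c / 2) * Im z)"
      by (subst exp_add[symmetric]) (simp add: field_simps)
    finally show "cmod (h z * k z) \<le> C * D * exp (- (c / 2) * Im z)" .
  qed (use C in simp)
qed

lemma decays_add:
  assumes "decays h" "decays k" shows "decays (\<lambda>z. h z + k z)"
proof -
  obtain C c where C: "C \<ge> 0" "c > 0" "\<And>z. z \<in> strip \<Longrightarrow> cmod (h z) \<le> C * exp (- c * Im z)"
    using decaysE[OF assms(1)] by blast
  obtain D d where D: "D \<ge> 0" "d > 0" "\<And>z. z \<in> strip \<Longrightarrow> cmod (k z) \<le> D * exp (- d * Im z)"
    using decaysE[OF assms(2)] by blast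
  show ?thesis
  proof (rule decaysI[of "min c d"])
    fix z assume z: "z \<in> strip"
    hence pos: "Im z \<ge> 0" by (simp add: strip_def)
    have "cmod (h z + k z) \<le> C * exp (- c * Im z) + D * exp (- d * Im z)"
      using C(3)[OF z] D(3)[OF z] norm_triangle_ineq[of "h z" "k z"] by linarith
    also have "\<dots> \<le> C * exp (- min c d * Im z) + D * exp (- min c d * Im z)"
      using C(1) D(1) pos by (intro add_mono mult_left_mono) (auto intro!: mult_right_mono)
    finally show "cmod (h z + k z) \<le> (C + D) * exp (- min c d * Im z)" by (simp add: algebra_simps)
  qed (use C D in simp)
qed

lemma decays_sum: "finite A \<Longrightarrow> (\<And>n. n \<in> A \<Longrightarrow> decays (h n)) \<Longrightarrow> decays (\<lambda>z. \<Sum>n\<in>A. h n z)"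
proof (induction A rule: finite_induct)
  case empty
  show ?case by (rule decaysI[of 1 _ 0]) auto
next
  case (insert x F)
  thus ?case by (simp add: decays_add)
qed

lemma moderate_mult:
  assumes "moderate h" "moderate k" shows "moderate (\<lambda>z. h z * k z)"
  unfolding moderate_def
proof (intro allI impI)
  fix e :: real assume "e > 0"
  obtain C where C: "C \<ge> 0" "\<And>z. z \<in> strip \<Longrightarrow> cmod (h z) \<le> C * exp (e / 2 * Im z)"
    using moderateE[OF assms(1), of "e / 2"] \<open>e > 0\<close> by auto
  obtain D where D: "D \<ge> 0" "\<And>z. z \<in> strip \<Longrightarrow> cmod (k z) \<le> D * exp (e / 2 * Im z)"
    using moderateE[OF assms(2), of "e / 2"] \<open>e > 0\<close> by auto
  show "\<exists>C. \<forall>z\<in>strip. cmod (h z * k z) \<le> C * exp (e * Im z)"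
  proof (intro exI ballI)
    fix z assume z: "z \<in> strip"
    have "cmod (h z * k z) \<le> (C * exp (e / 2 * Im z)) * (D * exp (e / 2 * Im z))"
      unfolding norm_mult using C D z by (intro mult_mono) auto
    also have "\<dots> = C * D * (exp (e / 2 * Im z) * exp (e / 2 * Im z))" by (simp add: mult_ac)
    also have "exp (e / 2 * Im z) * exp (e / 2 * Im z) = exp (e * Im z)"
      by (subst exp_add[symmetric]) (simp add: field_simps)
    finally show "cmod (h z * k z) \<le> C * D * exp (e * Im z)" .
  qed
qed

lemma moderate_bounded:
  assumes "\<And>z. z \<in> strip \<Longrightarrow> cmod (h z) \<le> C"
  shows "moderate h"
  unfolding moderate_def
proof (intro allI impI exI ballI)
  fix e :: real and z assume e: "e > 0" and z: "z \<in> strip"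
  have "1 \<le> exp (e * Im z)" using e z by (simp add: strip_def)
  hence "max C 0 * 1 \<le> max C 0 * exp (e * Im z)" by (intro mult_left_mono) auto
  thus "cmod (h z) \<le> max C 0 * exp (e * Im z)" using assms[OF z] by simp
qed

lemma moderate_linear_growth:
  assumes "\<And>z. z \<in> strip \<Longrightarrow> cmod (h z) \<le> a + b * Im z" "b \<ge> 0"
  shows "moderate h"
  unfolding moderate_def
proof (intro allI impI exI ballI)
  fix e :: real and z assume e: "e > 0" and z: "z \<in> strip"
  have y: "Im z \<ge> 0" using z by (simp add: strip_def)
  have 1: "1 \<le> exp (e * Im z)" using e y by simp
  have "e * Im z \<le> exp (e * Im z)" using exp_ge_add_one_self[of "e * Im z"] by linarith
  hence 2: "Im z \<le> exp (e * Im z) / e" using e by (simp add: field_simps)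
  have "cmod (h z) \<le> \<bar>a\<bar> * 1 + b * Im z" using assms(1)[OF z] by simp
  also have "\<dots> \<le> \<bar>a\<bar> * exp (e * Im z) + b * (exp (e * Im z) / e)"
    using 1 2 assms(2) by (intro add_mono mult_left_mono) auto
  finally show "cmod (h z) \<le> (\<bar>a\<bar> + b / e) * exp (e * Im z)" by (simp add: algebra_simps)
qed

lemma moderate_const [simp]: "moderate (\<lambda>z. a)"
  by (rule moderate_bounded[of _ "cmod a"]) simp

lemma norm_strip_le: "z \<in> strip \<Longrightarrow> cmod z \<le> 1 + Im z"
  using cmod_le[of z] by (auto simp: strip_def)

lemma moderate_id [simp]: "moderate (\<lambda>z. z)"
  by (rule moderate_linear_growth[of _ 1 1]) (use norm_strip_le in auto)

lemma moderate_cnj [simp]: "moderate (\<lambda>z. cnj (h z)) \<longleftrightarrow> moderate h"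
  by (simp add: moderate_def)

lemma decays_cnj [simp]: "decays (\<lambda>z. cnj (h z)) \<longleftrightarrow> decays h"
  by (simp add: decays_def)

lemma moderate_power [simp]: "moderate h \<Longrightarrow> moderate (\<lambda>z. h z ^ n)"
  by (induction n) (auto intro: moderate_mult)

section \<open>Primitives of functions in the growth classes\<close>

lemma convex_strip: "convex strip"
proof -
  have eq: "strip = {z. Re z \<le> 1} \<inter> {z. Re z \<ge> -1} \<inter> {z. Im z \<ge> 1/2}"
    by (auto simp: strip_def abs_le_iff)
  show ?thesis unfolding eq
    by (intro convex_Int convex_halfspace_Re_le convex_halfspace_Re_ge convex_halfspace_Im_ge)
qed

text \<open>The mean value inequality between i and z, on the part of the strip that contains both.
  Half of the exponent e pays for the derivative, half for the distance.\<close>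

lemma moderate_primitive:
  assumes v: "\<And>z. Im z > 0 \<Longrightarrow> (v has_field_derivative b z) (at z)" and b: "moderate b"
  shows "moderate v"
  unfolding moderate_def
proof (intro allI impI)
  fix e :: real assume e: "e > 0"
  obtain C where C: "C \<ge> 0" "\<And>z. z \<in> strip \<Longrightarrow> cmod (b z) \<le> C * exp (e / 2 * Im z)"
    using moderateE[OF b, of "e / 2"] e by auto
  have "moderate (\<lambda>z. z - \<i>)"
  proof (rule moderate_linear_growth[of _ 2 1])
    fix z assume "z \<in> strip"
    thus "cmod (z - \<i>) \<le> 2 + 1 * Im z"
      using norm_strip_le[of z] norm_triangle_ineq4[of z \<i>] by simp
  qed simp
  then obtain D where D: "D \<ge> 0" "\<And>z. z \<in> strip \<Longrightarrow> cmod (z - \<i>) \<le> D * exp (e / 2 * Im z)"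
    using moderateE[of _ "e / 2"] e by (metis half_gt_zero)
  show "\<exists>C. \<forall>z\<in>strip. cmod (v z) \<le> C * exp (e * Im z)"
  proof (intro exI ballI)
    fix z assume z: "z \<in> strip"
    hence y: "Im z \<ge> 0" by (simp add: strip_def)
    \<comment> \<open>The additional 1 keeps i inside S when z lies below it.\<close>
    define S where "S = strip \<inter> {w. Im w \<le> Im z + 1}"
    have S: "convex S" unfolding S_def by (intro convex_Int convex_strip convex_halfspace_Im_le)
    have "cmod (v z - v \<i>) \<le> (C * exp (e / 2 * (Im z + 1))) * cmod (z - \<i>)"
    proof (rule field_differentiable_bound[OF S])
      fix w assume w: "w \<in> S"
      hence "Im w > 0" by (simp add: S_def strip_def)
      from v[OF this] show "(v has_field_derivative b w) (at w within S)"
        by (rule has_field_derivative_at_within)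
      have "cmod (b w) \<le> C * exp (e / 2 * Im w)" using w by (intro C) (simp add: S_def)
      also have "\<dots> \<le> C * exp (e / 2 * (Im z + 1))"
        using w e C(1) by (intro mult_left_mono) (auto simp: S_def)
      finally show "cmod (b w) \<le> C * exp (e / 2 * (Im z + 1))" .
    qed (use z y in \<open>auto simp: S_def strip_def\<close>)
    also have "\<dots> \<le> (C * exp (e / 2 * (Im z + 1))) * (D * exp (e / 2 * Im z))"
      using C(1) D(2)[OF z] by (intro mult_left_mono) auto
    also have "\<dots> = C * D * exp (e / 2) * (exp (e / 2 * Im z) * exp (e / 2 * Im z))"
      by (simp add: exp_add distrib_left)
    also have "exp (e / 2 * Im z) * exp (e / 2 * Im z) = exp (e * Im z)"
      by (subst exp_add[symmetric]) (simp add: field_simps)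
    finally have 1: "cmod (v z - v \<i>) \<le> C * D * exp (e / 2) * exp (e * Im z)" .
    have "1 \<le> exp (e * Im z)" using e y by simp
    hence 2: "cmod (v \<i>) * 1 \<le> cmod (v \<i>) * exp (e * Im z)" by (intro mult_left_mono) auto
    have "cmod (v z) \<le> cmod (v z - v \<i>) + cmod (v \<i>)" using norm_triangle_ineq[of "v z - v \<i>" "v \<i>"] by simp
    thus "cmod (v z) \<le> (C * D * exp (e / 2) + cmod (v \<i>)) * exp (e * Im z)"
      using 1 2 by (simp add: algebra_simps)
  qed
qed

text \<open>Along a vertical ray the increments are dominated by the tail of an exponential
  integral, so a limit exists. It does not depend on the ray, since horizontal differences at height
  y also decay.\<close>

lemma decays_primitive:
  assumes v: "\<And>z. Im z > 0 \<Longrightarrow> (v has_field_derivative b z) (at z)" and b: "decays b"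
  obtains L where "decays (\<lambda>z. v z - L)"
proof -
  obtain C c where C: "C \<ge> 0" "c > 0" "\<And>z. z \<in> strip \<Longrightarrow> cmod (b z) \<le> C * exp (- c * Im z)"
    using decaysE[OF b] by blast
  have vert: "cmod (v (Complex x Y) - v (Complex x y)) \<le> C / c * exp (- c * y)"
    if "\<bar>x\<bar> \<le> 1" "y \<ge> 1/2" "y \<le> Y" for x y Y
  proof (cases "y = Y")
    case False
    \<comment> \<open>The primitive of the majorant C exp (- c t).\<close>
    define \<phi> where "\<phi> t = - C / c * exp (- c * t)" for t
    have "norm (v (Complex x Y) - v (Complex x y)) \<le> \<phi> Y - \<phi> y"
    proof (rule differentiable_bound_general[of y Y "\<lambda>t. v (Complex x t)" \<phi>
          "\<lambda>t. \<i> * b (Complex x t)" "\<lambda>t. C * exp (- c * t)"])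
      have D: "((\<lambda>t. v (Complex x t)) has_vector_derivative \<i> * b (Complex x t)) (at t)" if "t > 0" for t
      proof -
        have "(Complex x has_vector_derivative \<i>) (at t)"
          unfolding has_vector_derivative_complex_iff by (auto intro!: derivative_eq_intros)
        from field_vector_diff_chain_at[OF this v[of "Complex x t"]] that show ?thesis by (simp add: o_def)
      qed
      show "continuous_on {y..Y} (\<lambda>t. v (Complex x t))"
        using that by (intro continuous_at_imp_continuous_on ballI has_vector_derivative_continuous[OF D]) auto
      show "continuous_on {y..Y} \<phi>" unfolding \<phi>_def by (intro continuous_intros)
      fix t assume t: "y < t" "t < Y"
      show "((\<lambda>t. v (Complex x t)) has_vector_derivative \<i> * b (Complex x t)) (at t)" using t that by (intro D) auto
      show "(\<phi> has_vector_derivative C * exp (- c * t)) (at t)"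
        unfolding \<phi>_def has_real_derivative_iff_has_vector_derivative[symmetric]
        using C(2) by (auto intro!: derivative_eq_intros)
      show "norm (\<i> * b (Complex x t)) \<le> C * exp (- c * t)"
        using C(3)[of "Complex x t"] t that by (simp add: norm_mult strip_def)
    qed (use that False in auto)
    also have "\<dots> \<le> C / c * exp (- c * y)" using C by (simp add: \<phi>_def)
    finally show ?thesis .
  qed (use C in simp)
  have horiz: "cmod (v (Complex x y) - v (Complex 0 y)) \<le> C * exp (- c * y)" if "\<bar>x\<bar> \<le> 1" "y \<ge> 1/2" for x y
  proof -
    define S where "S = strip \<inter> {w. Im w \<ge> y}"
    have "cmod (v (Complex x y) - v (Complex 0 y)) \<le> (C * exp (- c * y)) * cmod (Complex x y - Complex 0 y)"
    proof (rule field_differentiable_bound)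
      show "convex S" unfolding S_def by (intro convex_Int convex_strip convex_halfspace_Im_ge)
      fix w assume w: "w \<in> S"
      hence "Im w > 0" by (simp add: S_def strip_def)
      from v[OF this] show "(v has_field_derivative b w) (at w within S)"
        by (rule has_field_derivative_at_within)
      have "cmod (b w) \<le> C * exp (- c * Im w)" using w by (intro C) (simp add: S_def)
      also have "\<dots> \<le> C * exp (- c * y)" using w C by (intro mult_left_mono) (auto simp: S_def)
      finally show "cmod (b w) \<le> C * exp (- c * y)" .
    qed (use that in \<open>auto simp: S_def strip_def\<close>)
    also have "\<dots> \<le> (C * exp (- c * y)) * 1"
      using that C(1) by (intro mult_left_mono) (auto simp: complex_diff cmod_def)
    finally show ?thesis by simp
  qed
  have lim0: "((\<lambda>y. K * exp (- c * y)) \<longlongrightarrow> 0) at_top" for K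
  proof -
    have "filterlim (\<lambda>y. - c * y) at_bot at_top"
      using C by (intro filterlim_tendsto_neg_mult_at_bot[OF tendsto_const] filterlim_ident) auto
    hence "((\<lambda>y. exp (- c * y)) \<longlongrightarrow> 0) at_top" by (rule filterlim_compose[OF exp_at_bot])
    from tendsto_mult_right_zero[OF this] show ?thesis .
  qed
  define X where "X n = v (Complex 0 (real (Suc n)))" for n
  have "Cauchy X"
  proof (rule metric_CauchyI)
    fix e :: real assume "e > 0"
    have "eventually (\<lambda>y. C / c * exp (- c * y) < e) at_top"
      using order_tendstoD(2)[OF lim0 \<open>e > 0\<close>] .
    then obtain M where M: "\<And>y. y \<ge> M \<Longrightarrow> C / c * exp (- c * y) < e" unfolding eventually_at_top_linorder by blast
    obtain n0 where n0: "real n0 \<ge> M" using real_arch_simple by blast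
    have *: "dist (X m) (X n) < e" if "n0 \<le> m" "m \<le> n" for m n
    proof -
      have "dist (X m) (X n) \<le> C / c * exp (- c * real (Suc m))"
        using vert[of 0 "real (Suc m)" "real (Suc n)"] that by (simp add: X_def dist_norm norm_minus_commute)
      also have "\<dots> < e" using that n0 by (intro M) auto
      finally show ?thesis .
    qed
    show "\<exists>M. \<forall>m\<ge>M. \<forall>n\<ge>M. dist (X m) (X n) < e"
      using * by (intro exI[of _ n0]) (metis dist_commute nle_le)
  qed
  then obtain L where L: "X \<longlonglongrightarrow> L" using Cauchy_convergent_iff convergent_def by metis
  have "decays (\<lambda>z. v z - L)"
  proof (rule decaysI[OF C(2)])
    fix z assume z: "z \<in> strip"
    define Kz where "Kz = C / c * exp (- c * Im z)"
    have "cmod (v z - L) \<le> Kz"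
    proof (rule tendsto_le[OF sequentially_bot])
      show "(\<lambda>n. cmod (v z - X n)) \<longlonglongrightarrow> cmod (v z - L)" by (intro tendsto_intros L)
      have "(\<lambda>n. Kz + C * exp (- c * real (Suc n))) \<longlonglongrightarrow> Kz + 0"
        by (intro tendsto_intros filterlim_compose[OF lim0] filterlim_compose[OF filterlim_real_sequentially] filterlim_Suc)
      thus "(\<lambda>n. Kz + C * exp (- c * real (Suc n))) \<longlonglongrightarrow> Kz" by simp
      show "\<forall>\<^sub>F n in sequentially. cmod (v z - X n) \<le> Kz + C * exp (- c * real (Suc n))"
        using eventually_ge_at_top[of "nat \<lceil>Im z\<rceil>"]
      proof eventually_elim
        case (elim n)
        hence n: "Im z \<le> real (Suc n)" by linarith
        \<comment> \<open>The corner of the path from z straight up and then across to the imaginary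
          axis.\<close>
        let ?Z = "Complex (Re z) (real (Suc n))"
        have "cmod (v z - X n) \<le> cmod (v ?Z - v z) + cmod (v ?Z - X n)"
          using norm_triangle_ineq4[of "v ?Z - X n" "v ?Z - v z"] by (simp add: norm_minus_commute)
        also have "\<dots> \<le> Kz + C * exp (- c * real (Suc n))"
          unfolding X_def Kz_def using vert[of "Re z" "Im z" "real (Suc n)"] horiz[of "Re z" "real (Suc n)"] z n
          by (intro add_mono) (auto simp: strip_def)
        finally show ?case .
      qed
    qed
    thus "cmod (v z - L) \<le> C / c * exp (- c * Im z)" by (simp add: Kz_def)
  qed
  thus ?thesis using that by blast
qed

lemma decays_imp_limit:
  assumes "decays (\<lambda>z. v z - L)" "\<bar>x\<bar> \<le> 1"
  shows "((\<lambda>y. v (Complex x y)) \<longlongrightarrow> L) at_top"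
proof -
  obtain C c where C: "C \<ge> 0" "c > 0" "\<And>z. z \<in> strip \<Longrightarrow> cmod (v z - L) \<le> C * exp (- c * Im z)"
    using decaysE[OF assms(1)] by blast
  have "filterlim (\<lambda>y. - c * y) at_bot at_top"
    using C by (intro filterlim_tendsto_neg_mult_at_bot[OF tendsto_const] filterlim_ident) auto
  hence "((\<lambda>y. exp (- c * y)) \<longlongrightarrow> 0) at_top" by (rule filterlim_compose[OF exp_at_bot])
  from tendsto_mult_right_zero[OF this] have "((\<lambda>y. C * exp (- c * y)) \<longlongrightarrow> 0) at_top" .
  moreover have "eventually (\<lambda>y. cmod (v (Complex x y) - L) \<le> C * exp (- c * y)) at_top"
    using eventually_ge_at_top[of "1/2"]
  proof eventually_elim
    case (elim y)
    thus ?case using C(3)[of "Complex x y"] assms(2) by (simp add: strip_def)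
  qed
  ultimately have "((\<lambda>y. v (Complex x y) - L) \<longlongrightarrow> 0) at_top"
    by (rule Lim_null_comparison[rotated])
  thus ?thesis by (simp add: LIM_zero_iff)
qed

text \<open>The base point \<open>\<i>\<close> is chosen because \<open>S\<close> fixes it.\<close>

definition prim :: "(complex \<Rightarrow> complex) \<Rightarrow> complex \<Rightarrow> complex" where
  "prim h z = contour_integral (linepath \<i> z) h"

lemma prim_i [simp]: "prim h \<i> = 0" by (simp add: prim_def)

lemma has_field_derivative_prim:
  assumes "h holomorphic_on upper_halfplane" "Im z > 0"
  shows "(prim h has_field_derivative h z) (at z)"
proof -
  obtain p where p: "\<And>x. x \<in> upper_halfplane \<Longrightarrow> (p has_field_derivative h x) (at x within upper_halfplane)"
    using holomorphic_convex_primitive'[OF convex_upper_halfplane open_upper_halfplane assms(1)] by blast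
  have eq: "p w - p \<i> = prim h w" if "w \<in> upper_halfplane" for w
  proof -
    have "path_image (linepath \<i> w) \<subseteq> upper_halfplane"
      using that by (simp add: closed_segment_subset)
    from contour_integral_primitive[OF p valid_path_linepath this] show ?thesis
      by (simp add: prim_def contour_integral_unique)
  qed
  have "((\<lambda>w. p w - p \<i>) has_field_derivative h z) (at z)"
    using p[of z] assms(2) by (auto intro!: derivative_eq_intros simp: at_within_open[OF _ open_upper_halfplane])
  thus ?thesis
    by (rule has_field_derivative_transform_within_open[OF _ open_upper_halfplane]) (use assms eq in auto)
qed

section \<open>Transformation of the double integrals\<close>

text \<open>The tool for all transformation laws below: both sides have the same derivative in an
  endpoint and agree at one point. It replaces changes of variable along paths.\<close>

lemma holomorphic_unique_primitive:
  assumes "\<And>z. Im z > 0 \<Longrightarrow> (u has_field_derivative h z) (at z)"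
    and "\<And>z. Im z > 0 \<Longrightarrow> (v has_field_derivative h z) (at z)"
    and "Im z0 > 0" "u z0 = v z0" "Im z > 0"
  shows "u z = v z"
proof -
  have "((\<lambda>z. u z - v z) has_field_derivative 0) (at x within upper_halfplane)" if "x \<in> upper_halfplane" for x
  proof -
    have "Im x > 0" using that by simp
    from DERIV_diff[OF assms(1)[OF this] assms(2)[OF this]] show ?thesis
      by (simp add: has_field_derivative_at_within)
  qed
  from has_field_derivative_zero_constant[OF convex_upper_halfplane this]
  obtain c where c: "\<And>x. x \<in> upper_halfplane \<Longrightarrow> u x - v x = c" by blast
  have "u z0 - v z0 = c" "u z - v z = c" using assms(3,5) by (auto intro!: c)
  thus ?thesis using assms(4) by simp
qed

text \<open>The exponent k - 2 of the kernel gets a name of its own, which avoids truncated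
  subtraction.\<close>

locale weight =
  fixes k m :: nat
  assumes k_eq: "k = m + 2"
begin

definition sbinom :: "nat \<Rightarrow> complex" where "sbinom n = (-1) ^ n * of_nat (m choose n)"

lemma binomial_diff: "(x - y) ^ m = (\<Sum>n\<le>m. sbinom n * x ^ (m - n) * y ^ n)" for x y :: complex
proof -
  have "(x - y) ^ m = (- y + x) ^ m" by simp
  also have "\<dots> = (\<Sum>n\<le>m. of_nat (m choose n) * (- y) ^ n * x ^ (m - n))" by (rule binomial_ring)
  also have "\<dots> = (\<Sum>n\<le>m. sbinom n * x ^ (m - n) * y ^ n)"
  proof (intro sum.cong refl)
    fix n
    have "(- y) ^ n = (-1) ^ n * y ^ n" by (rule power_minus)
    thus "of_nat (m choose n) * (- y) ^ n * x ^ (m - n) = sbinom n * x ^ (m - n) * y ^ n"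
      by (simp add: sbinom_def mult_ac)
  qed
  finally show ?thesis .
qed

definition comoment :: "(complex \<Rightarrow> complex) \<Rightarrow> nat \<Rightarrow> complex \<Rightarrow> complex" where
  "comoment f n \<tau> = \<tau> ^ (m - n) * f \<tau>"
definition moment :: "(complex \<Rightarrow> complex) \<Rightarrow> nat \<Rightarrow> complex \<Rightarrow> complex" where
  "moment g n \<tau> = \<tau> ^ n * g \<tau>"

text \<open>\<open>inner_integral g C D \<tau>\<close> is the inner integral of \<open>G(A,B;C,D)\<close> at the point \<open>\<tau>\<close>,
  without the factor \<open>f \<tau>\<close>.\<close>

definition inner_integral :: "(complex \<Rightarrow> complex) \<Rightarrow> complex \<Rightarrow> complex \<Rightarrow> complex \<Rightarrow> complex" where
  "inner_integral g C D \<tau> = (\<Sum>n\<le>m. sbinom n * \<tau> ^ (m - n) * cnj (prim (moment g n) D - prim (moment g n) C))"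

text \<open>The value of G(A,B;C,D) for endpoints inside the upper half-plane, after the binomial
  expansion; no path enters.\<close>

definition double_integral :: "(complex \<Rightarrow> complex) \<Rightarrow> (complex \<Rightarrow> complex) \<Rightarrow> complex \<Rightarrow> complex \<Rightarrow> complex \<Rightarrow> complex \<Rightarrow> complex" where
  "double_integral f g A B C D = (\<Sum>n\<le>m. sbinom n * (prim (comoment f n) B - prim (comoment f n) A) * cnj (prim (moment g n) D - prim (moment g n) C))"

lemma holomorphic_comoment: "f holomorphic_on upper_halfplane \<Longrightarrow> comoment f n holomorphic_on upper_halfplane"
  unfolding comoment_def[abs_def] by (intro holomorphic_intros)
lemma holomorphic_moment: "f holomorphic_on upper_halfplane \<Longrightarrow> moment f n holomorphic_on upper_halfplane"
  unfolding moment_def[abs_def] by (intro holomorphic_intros)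

lemmas prim_comoment = has_field_derivative_prim[OF holomorphic_comoment]
lemmas prim_moment = has_field_derivative_prim[OF holomorphic_moment]

lemma cnj_sbinom [simp]: "cnj (sbinom n) = sbinom n" by (simp add: sbinom_def)

lemma cnj_inner_integral: "cnj (inner_integral g C D \<tau>) = (\<Sum>n\<le>m. sbinom n * cnj \<tau> ^ (m - n) * (prim (moment g n) D - prim (moment g n) C))"
  by (simp add: inner_integral_def)

text \<open>The inner integral is antiholomorphic in its endpoint D, so its conjugate is
  differentiated. The outer variable then appears as \<open>cnj \<tau>\<close>, in the lower
  half-plane.\<close>

lemma cnj_inner_integral_derivative:
  assumes "g holomorphic_on upper_halfplane" "Im D > 0"
  shows "((\<lambda>D. cnj (inner_integral g C D \<tau>)) has_field_derivative g D * (cnj \<tau> - D) ^ m) (at D)"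
proof -
  have "((\<lambda>D. cnj (inner_integral g C D \<tau>)) has_field_derivative (\<Sum>n\<le>m. sbinom n * cnj \<tau> ^ (m - n) * moment g n D)) (at D)"
    unfolding cnj_inner_integral by (auto intro!: derivative_eq_intros prim_moment[OF assms] sum.cong)
  also have "(\<Sum>n\<le>m. sbinom n * cnj \<tau> ^ (m - n) * moment g n D) = g D * (cnj \<tau> - D) ^ m"
    unfolding binomial_diff sum_distrib_left by (simp add: moment_def mult_ac)
  finally show ?thesis .
qed

lemma double_integral_derivative:
  assumes "f holomorphic_on upper_halfplane" "Im B > 0"
  shows "((\<lambda>B. double_integral f g A B C D) has_field_derivative f B * inner_integral g C D B) (at B)"
proof -
  have "((\<lambda>B. double_integral f g A B C D) has_field_derivative (\<Sum>n\<le>m. sbinom n * comoment f n B * cnj (prim (moment g n) D - prim (moment g n) C))) (at B)"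
    unfolding double_integral_def by (auto intro!: derivative_eq_intros prim_comoment[OF assms] sum.cong)
  also have "(\<Sum>n\<le>m. sbinom n * comoment f n B * cnj (prim (moment g n) D - prim (moment g n) C)) = f B * inner_integral g C D B"
    unfolding inner_integral_def sum_distrib_left by (simp add: comoment_def mult_ac)
  finally show ?thesis .
qed

lemma inner_integral_refl [simp]: "inner_integral g C C \<tau> = 0" by (simp add: inner_integral_def)
lemma double_integral_refl [simp]: "double_integral f g A A C D = 0" by (simp add: double_integral_def)

lemma inner_integral_add: "inner_integral g C D \<tau> + inner_integral g D E \<tau> = inner_integral g C E \<tau>"
  unfolding inner_integral_def sum.distrib[symmetric] distrib_left[symmetric] complex_cnj_add[symmetric] by simp

lemma moebius_cnj: "moebius \<alpha> (cnj \<tau>) = cnj (moebius \<alpha> \<tau>)"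
  by (simp add: moebius_def)
lemma autfac_cnj: "autfac \<alpha> (cnj \<tau>) = cnj (autfac \<alpha> \<tau>)"
  by (simp add: autfac_def)

text \<open>In the variable s the weight k of g, the weight -m of the kernel and the -2 of the
  derivative add up to 0; only the factor of the kernel in \<tau> survives. Both sides vanish at D =
  C.\<close>

lemma inner_integral_transform:
  assumes g: "g holomorphic_on upper_halfplane" "g1 holomorphic_on upper_halfplane" and \<alpha>: "\<alpha> \<in> SL"
    and eq: "\<And>s. Im s > 0 \<Longrightarrow> slash k g \<alpha> s = w * g1 s"
    and pos: "Im C > 0" "Im D > 0" "Im \<tau> > 0"
  shows "inner_integral g (moebius \<alpha> C) (moebius \<alpha> D) (moebius \<alpha> \<tau>) = cnj w * inner_integral g1 C D \<tau> / autfac \<alpha> \<tau> ^ m"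
proof -
  have j\<tau>: "autfac \<alpha> (cnj \<tau>) \<noteq> 0" using \<alpha> pos by (simp add: autfac_cnj)
  define u where "u D = cnj (inner_integral g (moebius \<alpha> C) (moebius \<alpha> D) (moebius \<alpha> \<tau>))" for D
  define v where "v D = w * cnj (inner_integral g1 C D \<tau>) / autfac \<alpha> (cnj \<tau>) ^ m" for D
  define h where "h s = w * g1 s * (cnj \<tau> - s) ^ m / autfac \<alpha> (cnj \<tau>) ^ m" for s
  have "u D = v D"
  proof (rule holomorphic_unique_primitive[of u h v C D])
    fix s :: complex assume s: "Im s > 0"
    have js: "autfac \<alpha> s \<noteq> 0" using \<alpha> s by simp
    have ms: "Im (moebius \<alpha> s) > 0" using \<alpha> s by simp
    have "(u has_field_derivative (g (moebius \<alpha> s) * (cnj (moebius \<alpha> \<tau>) - moebius \<alpha> s) ^ m) * (1 / autfac \<alpha> s ^ 2)) (at s)"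
      unfolding u_def by (rule DERIV_chain2[OF cnj_inner_integral_derivative[OF g(1) ms] has_field_derivative_moebius[OF \<alpha> js]])
    also have "cnj (moebius \<alpha> \<tau>) - moebius \<alpha> s = (cnj \<tau> - s) / (autfac \<alpha> (cnj \<tau>) * autfac \<alpha> s)"
      using moebius_diff[OF \<alpha> j\<tau> js] by (simp add: moebius_cnj)
    also have "(g (moebius \<alpha> s) * ((cnj \<tau> - s) / (autfac \<alpha> (cnj \<tau>) * autfac \<alpha> s)) ^ m) * (1 / autfac \<alpha> s ^ 2) = h s"
    proof -
      have "g (moebius \<alpha> s) / autfac \<alpha> s ^ k = w * g1 s" using eq[OF s] by (simp add: slash_alt)
      hence "g (moebius \<alpha> s) = w * g1 s * autfac \<alpha> s ^ (m + 2)" using js by (simp add: k_eq field_simps)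
      thus ?thesis using js j\<tau> by (simp add: h_def power_divide power_mult_distrib power_add power2_eq_square)
    qed
    finally show "(u has_field_derivative h s) (at s)" .
    have "(v has_field_derivative w * (g1 s * (cnj \<tau> - s) ^ m) / autfac \<alpha> (cnj \<tau>) ^ m) (at s)"
      unfolding v_def by (intro DERIV_cdivide DERIV_cmult cnj_inner_integral_derivative g s)
    thus "(v has_field_derivative h s) (at s)" by (simp add: h_def mult_ac)
  qed (use pos in \<open>auto simp: u_def v_def\<close>)
  hence "cnj (u D) = cnj (v D)" by simp
  thus ?thesis unfolding u_def v_def by (simp add: autfac_cnj)
qed

text \<open>The outer weights k from f, -m from the inner integral and -2 from the derivative
  cancel, and the multipliers combine to w times its conjugate, which is 1.\<close>

lemma double_integral_transform:
  assumes f: "f holomorphic_on upper_halfplane" "f1 holomorphic_on upper_halfplane"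
    and g: "g holomorphic_on upper_halfplane" "g1 holomorphic_on upper_halfplane" and \<alpha>: "\<alpha> \<in> SL"
    and eqf: "\<And>s. Im s > 0 \<Longrightarrow> slash k f \<alpha> s = w * f1 s"
    and eqg: "\<And>s. Im s > 0 \<Longrightarrow> slash k g \<alpha> s = w * g1 s"
    and w: "cmod w = 1"
    and pos: "Im A > 0" "Im B > 0" "Im C > 0" "Im D > 0"
  shows "double_integral f g (moebius \<alpha> A) (moebius \<alpha> B) (moebius \<alpha> C) (moebius \<alpha> D) = double_integral f1 g1 A B C D"
proof -
  define u where "u B = double_integral f g (moebius \<alpha> A) (moebius \<alpha> B) (moebius \<alpha> C) (moebius \<alpha> D)" for B
  define v where "v B = double_integral f1 g1 A B C D" for B
  have ww: "w * cnj w = 1" using w by (simp add: complex_norm_square[symmetric])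
  have "u B = v B"
  proof (rule holomorphic_unique_primitive[of u "\<lambda>s. f1 s * inner_integral g1 C D s" v A B])
    fix s :: complex assume s: "Im s > 0"
    have js: "autfac \<alpha> s \<noteq> 0" using \<alpha> s by simp
    have ms: "Im (moebius \<alpha> s) > 0" using \<alpha> s by simp
    have "(u has_field_derivative (f (moebius \<alpha> s) * inner_integral g (moebius \<alpha> C) (moebius \<alpha> D) (moebius \<alpha> s)) * (1 / autfac \<alpha> s ^ 2)) (at s)"
      unfolding u_def by (rule DERIV_chain2[OF double_integral_derivative[OF f(1) ms] has_field_derivative_moebius[OF \<alpha> js]])
    also have "(f (moebius \<alpha> s) * inner_integral g (moebius \<alpha> C) (moebius \<alpha> D) (moebius \<alpha> s)) * (1 / autfac \<alpha> s ^ 2) = f1 s * inner_integral g1 C D s"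
    proof -
      have "f (moebius \<alpha> s) / autfac \<alpha> s ^ k = w * f1 s" using eqf[OF s] by (simp add: slash_alt)
      hence "f (moebius \<alpha> s) = w * f1 s * autfac \<alpha> s ^ (m + 2)" using js by (simp add: k_eq field_simps)
      note feq = this
      have WT: "inner_integral g (moebius \<alpha> C) (moebius \<alpha> D) (moebius \<alpha> s) = cnj w * inner_integral g1 C D s / autfac \<alpha> s ^ m"
        by (rule inner_integral_transform[OF g \<alpha> eqg pos(3,4) s])
      have "(f (moebius \<alpha> s) * inner_integral g (moebius \<alpha> C) (moebius \<alpha> D) (moebius \<alpha> s)) * (1 / autfac \<alpha> s ^ 2) =
         (w * cnj w) * (f1 s * inner_integral g1 C D s)"
        unfolding feq WT using js by (simp add: power_add power2_eq_square)
      thus ?thesis unfolding ww by simp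
    qed
    finally show "(u has_field_derivative f1 s * inner_integral g1 C D s) (at s)" .
    show "(v has_field_derivative f1 s * inner_integral g1 C D s) (at s)"
      unfolding v_def by (rule double_integral_derivative[OF f(2) s])
  qed (use pos in \<open>auto simp: u_def v_def\<close>)
  thus ?thesis by (simp add: u_def v_def)
qed

text \<open>The integrand has weight 2, so it becomes invariant together with d\<tau>. This
  pointwise form also covers inner endpoints that move with \<tau>, as in Green's formula.\<close>

lemma integrand_transform:
  assumes g: "g holomorphic_on upper_halfplane" "g1 holomorphic_on upper_halfplane" and \<alpha>: "\<alpha> \<in> SL"
    and eqf: "slash k f \<alpha> \<tau> = w * f1 \<tau>"
    and eqg: "\<And>s. Im s > 0 \<Longrightarrow> slash k g \<alpha> s = w * g1 s"
    and w: "cmod w = 1"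
    and pos: "Im C > 0" "Im D > 0" "Im \<tau> > 0"
  shows "f (moebius \<alpha> \<tau>) * inner_integral g (moebius \<alpha> C) (moebius \<alpha> D) (moebius \<alpha> \<tau>) = autfac \<alpha> \<tau> ^ 2 * (f1 \<tau> * inner_integral g1 C D \<tau>)"
proof -
  have js: "autfac \<alpha> \<tau> \<noteq> 0" using \<alpha> pos by simp
  have ww: "w * cnj w = 1" using w by (simp add: complex_norm_square[symmetric])
  have "f (moebius \<alpha> \<tau>) / autfac \<alpha> \<tau> ^ k = w * f1 \<tau>" using eqf by (simp add: slash_alt)
  hence "f (moebius \<alpha> \<tau>) = w * f1 \<tau> * autfac \<alpha> \<tau> ^ (m + 2)" using js by (simp add: k_eq field_simps)
  note feq = this
  have WT: "inner_integral g (moebius \<alpha> C) (moebius \<alpha> D) (moebius \<alpha> \<tau>) = cnj w * inner_integral g1 C D \<tau> / autfac \<alpha> \<tau> ^ m"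
    by (rule inner_integral_transform[OF g \<alpha> eqg pos])
  have "f (moebius \<alpha> \<tau>) * inner_integral g (moebius \<alpha> C) (moebius \<alpha> D) (moebius \<alpha> \<tau>) =
     (w * cnj w) * (autfac \<alpha> \<tau> ^ 2 * (f1 \<tau> * inner_integral g1 C D \<tau>))"
    unfolding feq WT using js by (simp add: power_add power2_eq_square)
  thus ?thesis unfolding ww by simp
qed

end

section \<open>Integrals along geodesics\<close>

lemma line_integral_sum:
  assumes "finite I" "\<And>n. n \<in> I \<Longrightarrow> line_integrable A B (h n)"
  shows "line_integrable A B (\<lambda>z. \<Sum>n\<in>I. c n * h n z)"
    and "line_integral A B (\<lambda>z. \<Sum>n\<in>I. c n * h n z) = (\<Sum>n\<in>I. c n * line_integral A B (h n))"
proof -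
  obtain s e p where g: "geodesic A B = (s, e, p)" by (cases "geodesic A B") auto
  have h: "interval_lebesgue_integrable lborel s e (\<lambda>t. h n (p t) * vector_derivative p (at t))" if "n \<in> I" for n
    using assms(2)[OF that] by (simp add: line_integrable_def g)
  have "interval_lebesgue_integrable lborel s e (\<lambda>t. \<Sum>n\<in>I. c n * (h n (p t) * vector_derivative p (at t))) \<and>
     (LBINT t=s..e. (\<Sum>n\<in>I. c n * (h n (p t) * vector_derivative p (at t)))) =
     (\<Sum>n\<in>I. c n * (LBINT t=s..e. h n (p t) * vector_derivative p (at t)))"
    using assms(1) h
  proof (induction I rule: finite_induct)
    case empty
    show ?case by (simp add: interval_lebesgue_integrable_def interval_lebesgue_integral_def set_integrable_def set_lebesgue_integral_def)
  next
    case (insert x F)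
    hence "interval_lebesgue_integrable lborel s e (\<lambda>t. c x * (h x (p t) * vector_derivative p (at t)))" by simp
    from interval_lebesgue_integral_add[OF this] insert show ?case by simp
  qed
  moreover have "(\<Sum>n\<in>I. c n * h n (p t)) * vector_derivative p (at t) =
      (\<Sum>n\<in>I. c n * (h n (p t) * vector_derivative p (at t)))" for t
    by (simp only: sum_distrib_right mult.assoc)
  ultimately show "line_integrable A B (\<lambda>z. \<Sum>n\<in>I. c n * h n z)"
    and "line_integral A B (\<lambda>z. \<Sum>n\<in>I. c n * h n z) = (\<Sum>n\<in>I. c n * line_integral A B (h n))"
    by (simp_all only: line_integrable_def line_integral_def g prod.case)
qed

lemma line_integral_cnj_eq:
  "line_integral_cnj A B h = cnj (line_integral A B (\<lambda>z. cnj (h z)))"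
  "line_integrable_cnj A B h \<longleftrightarrow> line_integrable A B (\<lambda>z. cnj (h z))"
proof -
  obtain s e p where g: "geodesic A B = (s, e, p)" by (cases "geodesic A B") auto
  have eq: "indicator X t *\<^sub>R (h (p t) * cnj (vector_derivative p (at t))) =
       cnj (indicator X t *\<^sub>R (cnj (h (p t)) * vector_derivative p (at t)))" for X t
    by simp
  show "line_integral_cnj A B h = cnj (line_integral A B (\<lambda>z. cnj (h z)))"
    unfolding line_integral_cnj_def line_integral_def g interval_lebesgue_integral_def set_lebesgue_integral_def
      prod.case
    by (cases "s \<le> e") (simp_all only: eq Bochner_Integration.integral_cnj if_True if_False complex_cnj_minus)
  show "line_integrable_cnj A B h \<longleftrightarrow> line_integrable A B (\<lambda>z. cnj (h z))"
    unfolding line_integrable_cnj_def line_integrable_def g interval_lebesgue_integrable_def set_integrable_def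
      prod.case eq complex_integrable_cnj ..
qed

context weight begin

text \<open>Expanding the kernel separates the variables, so convergence of the single integrals
  gives both the convergence and the value of the iterated one.\<close>

lemma G_integral_bilinear:
  assumes f: "\<And>n. n \<le> m \<Longrightarrow> line_integrable A B (comoment f n)"
    and g: "\<And>n. n \<le> m \<Longrightarrow> line_integrable C D (moment g n)"
  shows "G_convergent k f g A B C D"
    and "G_integral k f g A B C D = (\<Sum>n\<le>m. sbinom n * line_integral A B (comoment f n) * cnj (line_integral C D (moment g n)))"
proof -
  have km: "k - 2 = m" by (simp add: k_eq)
  have eq: "cnj (f \<tau> * cnj (g s) * (\<tau> - cnj s) ^ m) = (\<Sum>n\<le>m. cnj (f \<tau> * sbinom n * \<tau> ^ (m - n)) * moment g n s)" for \<tau> s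
    unfolding binomial_diff sum_distrib_left cnj_sum by (intro sum.cong) (auto simp: moment_def mult_ac)
  note L = line_integral_sum[of "{..m}" C D "moment g", OF finite_atMost g]
  have inner: "line_integrable_cnj C D (\<lambda>s. f \<tau> * cnj (g s) * (\<tau> - cnj s) ^ m)" for \<tau>
    unfolding line_integral_cnj_eq eq by (rule L(1)) auto
  have inner_eq: "line_integral_cnj C D (\<lambda>s. f \<tau> * cnj (g s) * (\<tau> - cnj s) ^ m) =
      (\<Sum>n\<le>m. (sbinom n * cnj (line_integral C D (moment g n))) * comoment f n \<tau>)" for \<tau>
  proof -
    have "line_integral_cnj C D (\<lambda>s. f \<tau> * cnj (g s) * (\<tau> - cnj s) ^ m) =
        cnj (\<Sum>n\<le>m. cnj (f \<tau> * sbinom n * \<tau> ^ (m - n)) * line_integral C D (moment g n))"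
      unfolding line_integral_cnj_eq eq by (subst L(2)) auto
    also have "\<dots> = (\<Sum>n\<le>m. (sbinom n * cnj (line_integral C D (moment g n))) * comoment f n \<tau>)"
      unfolding cnj_sum by (intro sum.cong) (auto simp: comoment_def mult_ac)
    finally show ?thesis .
  qed
  note R = line_integral_sum[of "{..m}" A B "comoment f", OF finite_atMost f]
  show "G_convergent k f g A B C D"
    unfolding G_convergent_def km inner_eq using inner by (auto intro: R(1))
  show "G_integral k f g A B C D = (\<Sum>n\<le>m. sbinom n * line_integral A B (comoment f n) * cnj (line_integral C D (moment g n)))"
    unfolding G_integral_def km inner_eq by (subst R(2)) (auto simp: mult_ac)
qed

end

text \<open>The real centre is equidistant from a and b, and both arguments lie strictly between 0
  and pi, so the arc joins the two points inside the upper half-plane. The fundamental theorem then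
  applies in either orientation.\<close>

lemma line_integral_arc:
  assumes v: "\<And>z. Im z > 0 \<Longrightarrow> (v has_field_derivative h z) (at z)"
    and h: "h holomorphic_on upper_halfplane"
    and ab: "Im a > 0" "Im b > 0" "Re a \<noteq> Re b"
  shows "line_integrable (Pt a) (Pt b) h" "line_integral (Pt a) (Pt b) h = v b - v a"
proof -
  define x where "x = ((cmod a)\<^sup>2 - (cmod b)\<^sup>2) / (2 * (Re a - Re b))"
  define R where "R = cmod (a - of_real x)"
  define p where "p t = of_real x + of_real R * cis t" for t
  let ?s = "Arg (a - of_real x)" and ?e = "Arg (b - of_real x)"
  have g: "geodesic (Pt a) (Pt b) = (ereal ?s, ereal ?e, p)"
    using ab by (auto simp: x_def p_def R_def Let_def)
  have Rb: "cmod (b - of_real x) = R"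
  proof -
    have "2 * x * (Re a - Re b) = (cmod a)\<^sup>2 - (cmod b)\<^sup>2" 
    proof -
      have "2 * (X / (2 * d)) * d = X" if "d \<noteq> 0" for X d :: real using that by simp
      from this[of "Re a - Re b"] ab(3) show ?thesis unfolding x_def by (simp only: right_minus_eq not_False_eq_True)
    qed
    hence "(cmod (b - of_real x))\<^sup>2 = R\<^sup>2"
      unfolding R_def cmod_power2 by (simp add: power2_eq_square algebra_simps)
    thus ?thesis by (simp add: R_def)
  qed
  have R: "R > 0" using ab(1) by (auto simp: R_def complex_eq_iff)
  have ends: "p ?s = a" "p ?e = b"
    using rcis_cmod_Arg[of "a - of_real x"] rcis_cmod_Arg[of "b - of_real x"]
    by (auto simp: p_def rcis_def Rb R_def)
  have arg: "0 < ?s" "?s < pi" "0 < ?e" "?e < pi"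
    using Arg_lt_pi[of "a - of_real x"] Arg_lt_pi[of "b - of_real x"] ab by auto
  have up: "Im (p t) > 0" if "min ?s ?e \<le> t" "t \<le> max ?s ?e" for t
  proof -
    have "0 < t" "t < pi" using that arg by linarith+
    thus ?thesis using R by (simp add: p_def sin_gt_zero)
  qed
  define p' where "p' t = of_real R * (\<i> * cis t)" for t
  have p': "(p has_vector_derivative p' t) (at t within A)" for t A
    unfolding p_def[abs_def] p'_def has_vector_derivative_complex_iff
    by (auto intro!: derivative_eq_intros)
  hence vd: "vector_derivative p (at t) = p' t" for t by (rule vector_derivative_at)
  let ?I = "{min ?s ?e..max ?s ?e}"
  have cont: "continuous_on ?I (\<lambda>t. h (p t) * p' t)"
  proof (intro continuous_on_mult continuous_on_compose2[OF holomorphic_on_imp_continuous_on[OF h]])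
    show "continuous_on ?I p" by (rule continuous_on_vector_derivative[OF p'])
    show "continuous_on ?I p'" unfolding p'_def[abs_def] cis_conv_exp by (intro continuous_intros)
    show "p ` ?I \<subseteq> upper_halfplane" using up by auto
  qed
  have "(LBINT t=?s..?e. h (p t) * p' t) = v (p ?e) - v (p ?s)"
  proof (rule interval_integral_FTC_finite[OF cont])
    fix t assume "min ?s ?e \<le> t" "t \<le> max ?s ?e"
    from field_vector_diff_chain_within[OF p' has_field_derivative_at_within[OF v[OF up[OF this]]], of ?I]
    show "((\<lambda>t. v (p t)) has_vector_derivative h (p t) * p' t) (at t within ?I)"
      by (simp add: o_def mult.commute)
  qed
  thus "line_integral (Pt a) (Pt b) h = v b - v a"
    unfolding line_integral_def g by (simp add: vd ends)
  have "interval_lebesgue_integrable lborel (ereal ?s) (ereal ?e) (\<lambda>t. h (p t) * p' t)"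
  proof (cases "?s \<le> ?e")
    case True
    thus ?thesis using cont by (intro interval_integrable_continuous_on) (auto simp: min_def max_def)
  next
    case False
    hence "interval_lebesgue_integrable lborel (ereal ?e) (ereal ?s) (\<lambda>t. h (p t) * p' t)"
      using cont by (intro interval_integrable_continuous_on) (auto simp: min_def max_def)
    thus ?thesis by (subst interval_integrable_endpoints_reverse)
  qed
  thus "line_integrable (Pt a) (Pt b) h"
    unfolding line_integrable_def g by (simp add: vd)
qed

lemma vector_derivative_vertical [simp]: "vector_derivative (Complex x) (at t) = \<i>"
  by (rule vector_derivative_at) (auto simp: has_vector_derivative_complex_iff intro!: derivative_eq_intros)

lemma vertical_has_vector_derivative:
  assumes "\<And>z. Im z > 0 \<Longrightarrow> (v has_field_derivative h z) (at z)" "t > 0"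
  shows "((\<lambda>t. v (Complex x t)) has_vector_derivative h (Complex x t) * \<i>) (at t)"
proof -
  have "(Complex x has_vector_derivative \<i>) (at t)"
    unfolding has_vector_derivative_complex_iff by (auto intro!: derivative_eq_intros)
  from field_vector_diff_chain_at[OF this assms(1)[of "Complex x t"]] assms(2)
  show ?thesis by (simp add: o_def mult.commute)
qed

lemma vertical_continuous_on:
  assumes "h holomorphic_on upper_halfplane" "A \<subseteq> {0<..}"
  shows "continuous_on A (\<lambda>t. h (Complex x t) * \<i>)"
proof (intro continuous_on_mult continuous_on_compose2[OF holomorphic_on_imp_continuous_on[OF assms(1)]])
  show "continuous_on A (Complex x)" unfolding Complex_eq by (intro continuous_intros)
qed (use assms(2) in auto)

lemma vertical_set_integrable:
  assumes h: "h holomorphic_on upper_halfplane" and d: "decays h" and x: "\<bar>x\<bar> \<le> 1" and y: "y \<ge> 1/2"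
  shows "set_integrable lborel {y<..} (\<lambda>t. h (Complex x t) * \<i>)"
proof -
  obtain C c where C: "C \<ge> 0" "c > 0" "\<And>z. z \<in> strip \<Longrightarrow> cmod (h z) \<le> C * exp (- c * Im z)"
    using decaysE[OF d] by blast
  have "set_integrable lborel {y<..} (\<lambda>t. C * exp (- c * t))"
  proof (rule set_integrable_subset)
    show "set_integrable lborel {y..} (\<lambda>t. C * exp (- c * t))"
      by (intro set_integrable_mult_right exp_decay_set_integrable C)
  qed auto
  thus ?thesis unfolding set_integrable_def
  proof (rule Bochner_Integration.integrable_bound)
    show "(\<lambda>t. indicator {y<..} t *\<^sub>R (h (Complex x t) * \<i>)) \<in> borel_measurable lborel"
    proof -
      have "(\<lambda>t. indicator {y<..} t *\<^sub>R (h (Complex x t) * \<i>)) \<in> borel_measurable borel"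
        using y by (intro borel_measurable_continuous_on_indicator vertical_continuous_on[OF h]) auto
      thus ?thesis by simp
    qed
    show "AE t in lborel. norm (indicator {y<..} t *\<^sub>R (h (Complex x t) * \<i>)) \<le> norm (indicator {y<..} t *\<^sub>R (C * exp (- c * t)))"
    proof (rule AE_I2)
      fix t
      show "norm (indicator {y<..} t *\<^sub>R (h (Complex x t) * \<i>)) \<le> norm (indicator {y<..} t *\<^sub>R (C * exp (- c * t)))"
        using C(3)[of "Complex x t"] C(1) x y by (auto simp: indicator_def norm_mult strip_def)
    qed
  qed
qed

lemma line_integral_to_I_Inf:
  assumes v: "\<And>z. Im z > 0 \<Longrightarrow> (v has_field_derivative h z) (at z)"
    and h: "h holomorphic_on upper_halfplane" "decays h"
    and L: "((\<lambda>y. v (Complex (Re a) y)) \<longlongrightarrow> L) at_top"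
    and a: "\<bar>Re a\<bar> \<le> 1" "Im a \<ge> 1/2"
  shows "line_integrable (Pt a) I_Inf h" "line_integral (Pt a) I_Inf h = L - v a"
proof -
  have int: "set_integrable lborel {Im a<..} (\<lambda>t. h (Complex (Re a) t) * \<i>)"
    by (rule vertical_set_integrable[OF h a])
  thus "line_integrable (Pt a) I_Inf h"
    unfolding line_integrable_def by (simp add: interval_lebesgue_integrable_def)
  have "(LBINT t=ereal (Im a)..\<infinity>. h (Complex (Re a) t) * \<i>) = L - v (Complex (Re a) (Im a))"
  proof (rule interval_integral_FTC_integrable[where F = "\<lambda>t. v (Complex (Re a) t)"])
    fix t assume "ereal (Im a) < ereal t"
    hence t: "t > 0" using a by simp
    show "((\<lambda>t. v (Complex (Re a) t)) has_vector_derivative h (Complex (Re a) t) * \<i>) (at t)"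
      by (rule vertical_has_vector_derivative[OF v t])
    have "continuous_on {0<..} (\<lambda>t. h (Complex (Re a) t) * \<i>)" by (rule vertical_continuous_on[OF h(1)]) auto
    thus "isCont (\<lambda>t. h (Complex (Re a) t) * \<i>) t" using t by (simp add: continuous_on_eq_continuous_at)
  next
    have "isCont (\<lambda>t. v (Complex (Re a) t)) (Im a)"
      by (rule has_vector_derivative_continuous[OF vertical_has_vector_derivative[OF v]]) (use a in auto)
    hence "((\<lambda>t. v (Complex (Re a) t)) \<longlongrightarrow> v (Complex (Re a) (Im a))) (at_right (Im a))"
      using continuous_within_subset[of _ UNIV] by (auto simp: continuous_within isCont_def intro: tendsto_within_subset)
    thus "(((\<lambda>t. v (Complex (Re a) t)) \<circ> real_of_ereal) \<longlongrightarrow> v (Complex (Re a) (Im a))) (at_right (ereal (Im a)))"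
      by (simp add: ereal_tendsto_simps)
  qed (use int L in \<open>simp_all add: ereal_tendsto_simps\<close>)
  thus "line_integral (Pt a) I_Inf h = L - v a" by (simp add: line_integral_def)
qed

text \<open>Integrability is split at height 1: bounded below it, exponentially decaying above. At
  the endpoint 0, outside the domain of v, a one-sided limit takes the place of a value.\<close>

lemma line_integral_I_Inf_0:
  assumes v: "\<And>z. Im z > 0 \<Longrightarrow> (v has_field_derivative h z) (at z)"
    and h: "h holomorphic_on upper_halfplane" "decays h"
    and K: "\<And>t. t > 0 \<Longrightarrow> t \<le> 1 \<Longrightarrow> cmod (h (Complex 0 t)) \<le> K"
    and L: "((\<lambda>y. v (Complex 0 y)) \<longlongrightarrow> L) at_top"
    and L0: "((\<lambda>y. v (Complex 0 y)) \<longlongrightarrow> L0) (at_right 0)"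
  shows "line_integrable I_Inf (Pt 0) h" "line_integral I_Inf (Pt 0) h = L0 - L"
proof -
  have int: "set_integrable lborel {0<..} (\<lambda>t. h (Complex 0 t) * \<i>)"
  proof -
    have "set_integrable lborel {0<..1} (\<lambda>t. h (Complex 0 t) * \<i>)"
    proof -
      have "set_integrable lborel {0<..1::real} (\<lambda>t. K)" by (simp add: set_integrable_def)
      thus ?thesis unfolding set_integrable_def
      proof (rule Bochner_Integration.integrable_bound)
        show "(\<lambda>t. indicator {0<..1} t *\<^sub>R (h (Complex 0 t) * \<i>)) \<in> borel_measurable lborel"
        proof -
          have "(\<lambda>t. indicator {0<..1} t *\<^sub>R (h (Complex 0 t) * \<i>)) \<in> borel_measurable borel"
            by (intro borel_measurable_continuous_on_indicator vertical_continuous_on[OF h(1)]) auto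
          thus ?thesis by simp
        qed
        show "AE t in lborel. norm (indicator {0<..1} t *\<^sub>R (h (Complex 0 t) * \<i>)) \<le> norm (indicator {0<..1} t *\<^sub>R K)"
        proof (rule AE_I2)
          fix t :: real
          show "norm (indicator {0<..1} t *\<^sub>R (h (Complex 0 t) * \<i>)) \<le> norm (indicator {0<..1} t *\<^sub>R K)"
            using K[of t] by (auto simp: indicator_def norm_mult)
        qed
      qed
    qed
    moreover have "set_integrable lborel {1<..} (\<lambda>t. h (Complex 0 t) * \<i>)"
      by (rule vertical_set_integrable[OF h]) auto
    ultimately have "set_integrable lborel ({0<..1} \<union> {1<..}) (\<lambda>t. h (Complex 0 t) * \<i>)"
      by (rule set_integrable_Un) auto
    also have "{0<..1} \<union> {1<..} = ({0<..} :: real set)" by auto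
    finally show ?thesis .
  qed
  have "interval_lebesgue_integrable lborel 0 \<infinity> (\<lambda>t. h (Complex 0 t) * \<i>)"
    using int by (simp add: interval_lebesgue_integrable_def zero_ereal_def)
  thus "line_integrable I_Inf (Pt 0) h"
    unfolding line_integrable_def
    by (simp add: interval_integrable_endpoints_reverse[of \<infinity>] zero_ereal_def)
  have "(LBINT t=ereal 0..\<infinity>. h (Complex 0 t) * \<i>) = L - L0"
  proof (rule interval_integral_FTC_integrable[where F = "\<lambda>t. v (Complex 0 t)"])
    fix t assume "ereal 0 < ereal t"
    hence t: "t > 0" by simp
    show "((\<lambda>t. v (Complex 0 t)) has_vector_derivative h (Complex 0 t) * \<i>) (at t)"
      by (rule vertical_has_vector_derivative[OF v t])
    have "continuous_on {0<..} (\<lambda>t. h (Complex 0 t) * \<i>)" by (rule vertical_continuous_on[OF h(1)]) auto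
    thus "isCont (\<lambda>t. h (Complex 0 t) * \<i>) t" using t by (simp add: continuous_on_eq_continuous_at)
  qed (use int L L0 in \<open>simp_all add: ereal_tendsto_simps del: ereal_eq_0\<close>)
  hence "(LBINT t=\<infinity>..ereal 0. h (Complex 0 t) * \<i>) = - (L - L0)"
    using interval_integral_endpoints_reverse by metis
  thus "line_integral I_Inf (Pt 0) h = L0 - L"
    by (simp add: line_integral_def)
qed

section \<open>Green's formula for a pair of forms\<close>

text \<open>The integral from i to i infinity. For decaying h the imaginary axis may be replaced by
  any vertical line in the strip, see \<open>prim_tendsto\<close>.\<close>

definition lim_prim :: "(complex \<Rightarrow> complex) \<Rightarrow> complex" where
  "lim_prim h = Lim at_top (\<lambda>y. prim h (Complex 0 y))"

lemma decays_prim: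
  assumes "h holomorphic_on upper_halfplane" "decays h"
  shows "decays (\<lambda>z. prim h z - lim_prim h)"
proof -
  obtain L where L: "decays (\<lambda>z. prim h z - L)"
    using decays_primitive[OF has_field_derivative_prim[OF assms(1)] assms(2)] by blast
  have "((\<lambda>y. prim h (Complex 0 y)) \<longlongrightarrow> L) at_top" by (rule decays_imp_limit[OF L]) simp
  hence "lim_prim h = L" unfolding lim_prim_def by (intro tendsto_Lim) auto
  thus ?thesis using L by simp
qed

lemma prim_tendsto:
  assumes "h holomorphic_on upper_halfplane" "decays h" "\<bar>x\<bar> \<le> 1"
  shows "((\<lambda>y. prim h (Complex x y)) \<longlongrightarrow> lim_prim h) at_top"
  by (rule decays_imp_limit[OF decays_prim]) fact+

lemma moderate_prim: "h holomorphic_on upper_halfplane \<Longrightarrow> moderate h \<Longrightarrow> moderate (prim h)"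
  using moderate_primitive[OF has_field_derivative_prim] by blast

text \<open>The two coefficients are the Wirtinger derivatives: the first factor only contributes to
  h, the conjugated one only to \<open>cnj h\<close>.\<close>

lemma has_derivative_mult_cnj:
  assumes "(u has_field_derivative u') (at z)" "(v has_field_derivative v') (at z)"
  shows "((\<lambda>z. u z * cnj (v z)) has_derivative (\<lambda>h. (u' * cnj (v z)) * h + (u z * cnj v') * cnj h)) (at z)"
proof -
  have "(u has_derivative (*) u') (at z)" using assms(1) by (simp add: has_field_derivative_def)
  moreover have "((\<lambda>z. cnj (v z)) has_derivative (\<lambda>h. cnj (v' * h))) (at z)"
    by (rule bounded_linear.has_derivative[OF bounded_linear_cnj assms(2)[unfolded has_field_derivative_def]])
  ultimately show ?thesis
    by (rule has_derivative_eq_rhs[OF has_derivative_mult]) (auto simp: algebra_simps)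
qed

lemma Im_rim_pos: "\<bar>x\<bar> \<le> 1/2 \<Longrightarrow> Im (rim x) > 0"
  using Im_rim_ge[of x] unfolding Im_rim by linarith

lemma integral_reflect_half: "integral {-1/2..1/2} (\<lambda>x. h (- x)) = integral {-1/2..1/2} h" for h :: "real \<Rightarrow> complex"
  using Henstock_Kurzweil_Integration.integral_reflect_real[of "1/2" "-1/2" h] by simp

context weight begin

text \<open>The form times its inner integral from a base point to z, where the base point is
  encoded by the values \<open>L n\<close> of the primitives there:
  \<open>L = (\<lambda>_. 0)\<close> is the base point i, and the limits of the primitives give i
  infinity.\<close>

definition green_form :: "(complex \<Rightarrow> complex) \<Rightarrow> (complex \<Rightarrow> complex) \<Rightarrow> (nat \<Rightarrow> complex) \<Rightarrow> complex \<Rightarrow> complex" where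
  "green_form f g L z = (\<Sum>n\<le>m. (sbinom n * comoment f n z) * cnj (prim (moment g n) z - L n))"

definition arc_integral :: "(complex \<Rightarrow> complex) \<Rightarrow> (complex \<Rightarrow> complex) \<Rightarrow> (nat \<Rightarrow> complex) \<Rightarrow> complex" where
  "arc_integral f g L = integral {-1/2..1/2} (\<lambda>x. green_form f g L (rim x) * rim' x)"

definition domain_integral :: "(complex \<Rightarrow> complex) \<Rightarrow> (complex \<Rightarrow> complex) \<Rightarrow> complex" where
  "domain_integral f g = 2 * \<i> * (LINT z:std_domain|lborel. f z * cnj (g z) * (z - cnj z) ^ m)"

definition side :: "(complex \<Rightarrow> complex) \<Rightarrow> (complex \<Rightarrow> complex) \<Rightarrow> (nat \<Rightarrow> complex) \<Rightarrow> real \<Rightarrow> complex" where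
  "side f g L t = green_form f g L (rim (1/2) + \<i> * of_real t) - green_form f g L (rim (-1/2) + \<i> * of_real t)"

lemma green_form_inner_integral: "green_form f g (\<lambda>n. prim (moment g n) C) z = f z * inner_integral g C z z"
  unfolding green_form_def inner_integral_def comoment_def sum_distrib_left by (intro sum.cong) (auto simp: mult_ac)

lemma continuous_on_green_form:
  assumes "f holomorphic_on upper_halfplane" "g holomorphic_on upper_halfplane"
  shows "continuous_on upper_halfplane (green_form f g L)"
proof -
  have "continuous_on upper_halfplane (prim (moment g n))" for n
    by (intro continuous_at_imp_continuous_on ballI DERIV_isCont[OF prim_moment[OF assms(2)]]) simp
  moreover have "continuous_on upper_halfplane (comoment f n)" for n
    by (intro holomorphic_on_imp_continuous_on holomorphic_comoment assms)
  ultimately show ?thesis unfolding green_form_def by (intro continuous_intros)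
qed

text \<open>The derivative in the conjugate variable kills the constants \<open>L n\<close> and, by
  the binomial formula, reassembles the kernel at s = z.\<close>

lemma stokes_forms:
  assumes f: "f holomorphic_on upper_halfplane" and g: "g holomorphic_on upper_halfplane"
    and U: "decays (green_form f g L)" and fg: "decays (\<lambda>z. f z * cnj (g z) * (z - cnj z) ^ m)"
  shows "set_integrable lborel std_domain (\<lambda>z. f z * cnj (g z) * (z - cnj z) ^ m)"
    and "((\<lambda>T. \<i> * integral {0..T} (side f g L)) \<longlongrightarrow> domain_integral f g - arc_integral f g L) at_top"
proof -
  define u where "u n z = sbinom n * comoment f n z" for n z
  define v where "v n z = prim (moment g n) z - L n" for n z
  define p where "p z = (\<Sum>n\<le>m. deriv (u n) z * cnj (v n z))" for z
  define q where "q z = f z * cnj (g z) * (z - cnj z) ^ m" for z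
  have uh: "u n holomorphic_on upper_halfplane" for n
    unfolding u_def[abs_def] by (intro holomorphic_intros holomorphic_comoment f)
  have u': "(u n has_field_derivative deriv (u n) z) (at z)" if "Im z > 0" for n z
    using that by (intro holomorphic_derivI[OF uh open_upper_halfplane]) simp
  have v': "(v n has_field_derivative moment g n z) (at z)" if "Im z > 0" for n z
    unfolding v_def[abs_def] using prim_moment[OF g that] by (auto intro!: derivative_eq_intros)
  have qeq: "(\<Sum>n\<le>m. u n z * cnj (moment g n z)) = q z" for z
    unfolding q_def u_def binomial_diff sum_distrib_left
    by (intro sum.cong) (auto simp: comoment_def moment_def mult_ac)
  have der: "(green_form f g L has_derivative (\<lambda>h. p z * h + q z * cnj h)) (at z)" if "Im z > 0" for z
  proof -
    have "((\<lambda>z. \<Sum>n\<le>m. u n z * cnj (v n z)) has_derivative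
        (\<lambda>h. \<Sum>n\<le>m. (deriv (u n) z * cnj (v n z)) * h + (u n z * cnj (moment g n z)) * cnj h)) (at z)"
      by (intro has_derivative_sum has_derivative_mult_cnj u' v' that)
    thus ?thesis
      unfolding sum.distrib sum_distrib_right[symmetric] qeq p_def[symmetric]
      by (simp add: green_form_def[abs_def] u_def v_def)
  qed
  have cu: "continuous_on upper_halfplane (deriv (u n))" for n
    by (intro holomorphic_on_imp_continuous_on holomorphic_deriv uh) simp
  have cv: "continuous_on upper_halfplane (v n)" for n
    by (intro continuous_at_imp_continuous_on ballI DERIV_isCont[OF v']) simp
  have p: "continuous_on upper_halfplane p" unfolding p_def by (intro continuous_intros cu cv)
  have q: "continuous_on upper_halfplane q" unfolding q_def
    by (intro continuous_intros holomorphic_on_imp_continuous_on f g)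
  obtain C c where C: "C \<ge> 0" "c > 0" "\<And>z. z \<in> strip \<Longrightarrow> cmod (green_form f g L z) \<le> C * exp (- c * Im z)"
    using decaysE[OF U] by blast
  obtain D d where D: "D \<ge> 0" "d > 0" "\<And>z. z \<in> strip \<Longrightarrow> cmod (q z) \<le> D * exp (- d * Im z)"
    using decaysE[OF fg] unfolding q_def by blast
  \<comment> \<open>\<open>stokes\<close> takes one constant and one rate for both bounds, hence the
    larger constant and the smaller rate.\<close>
  have weaken: "x \<le> max C D * exp (- min c d * Im z)" if "x \<le> C' * exp (- c' * Im z)" "C' \<le> max C D" "C' \<ge> 0" "c' \<ge> min c d" "Im z \<ge> 1/2" for x C' c' z
  proof -
    have "min c d * Im z \<le> c' * Im z" using that by (intro mult_right_mono) auto
    hence "C' * exp (- c' * Im z) \<le> max C D * exp (- min c d * Im z)"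
      using that by (intro mult_mono) auto
    thus ?thesis using that(1) by linarith
  qed
  have Ub: "cmod (green_form f g L z) \<le> max C D * exp (- min c d * Im z)"
    and qb: "cmod (q z) \<le> max C D * exp (- min c d * Im z)" if "\<bar>Re z\<bar> \<le> 1/2" "Im z \<ge> 1/2" for z
  proof -
    have "z \<in> strip" using that by (simp add: strip_def)
    thus "cmod (green_form f g L z) \<le> max C D * exp (- min c d * Im z)" "cmod (q z) \<le> max C D * exp (- min c d * Im z)"
      using that C(1,2) D(1,2) weaken[OF C(3)[of z]] weaken[OF D(3)[of z]] by auto
  qed
  have cd: "min c d > 0" using C D by simp
  note S = stokes[OF der p q cd Ub qb]
  show "set_integrable lborel std_domain (\<lambda>z. f z * cnj (g z) * (z - cnj z) ^ m)"
    using S(1) by (simp add: q_def[abs_def])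
  show "((\<lambda>T. \<i> * integral {0..T} (side f g L)) \<longlongrightarrow> domain_integral f g - arc_integral f g L) at_top"
    using S(2) by (simp add: q_def[abs_def] domain_integral_def arc_integral_def side_def[abs_def])
qed

section \<open>Decay of the boundary integrands\<close>

lemma moderate_comoment: "moderate f \<Longrightarrow> moderate (comoment f n)"
  unfolding comoment_def[abs_def] by (intro moderate_mult moderate_power moderate_id)
lemma moderate_moment: "moderate f \<Longrightarrow> moderate (moment f n)"
  unfolding moment_def[abs_def] by (intro moderate_mult moderate_power moderate_id)
lemma decays_comoment: "decays f \<Longrightarrow> decays (comoment f n)"
  unfolding comoment_def[abs_def] by (subst mult.commute) (intro decays_mult moderate_power moderate_id)
lemma decays_moment: "decays f \<Longrightarrow> decays (moment f n)"
  unfolding moment_def[abs_def] by (subst mult.commute) (intro decays_mult moderate_power moderate_id)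

lemma moderate_diff_const: "moderate h \<Longrightarrow> moderate (\<lambda>z. h z - a)"
  unfolding moderate_def
proof (intro allI impI)
  fix e :: real assume h: "\<forall>e>0. \<exists>C. \<forall>z\<in>strip. cmod (h z) \<le> C * exp (e * Im z)" and e: "e > 0"
  then obtain C where C: "\<And>z. z \<in> strip \<Longrightarrow> cmod (h z) \<le> C * exp (e * Im z)" by blast
  show "\<exists>C. \<forall>z\<in>strip. cmod (h z - a) \<le> C * exp (e * Im z)"
  proof (intro exI ballI)
    fix z assume z: "z \<in> strip"
    have "1 \<le> exp (e * Im z)" using e z by (simp add: strip_def)
    hence "cmod a * 1 \<le> cmod a * exp (e * Im z)" by (intro mult_left_mono) auto
    thus "cmod (h z - a) \<le> (C + cmod a) * exp (e * Im z)"
      using C[OF z] norm_triangle_ineq4[of "h z" a] by (simp add: algebra_simps)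
  qed
qed

lemma moderate_diff_cnj: "moderate (\<lambda>z. (z - cnj z) ^ m)"
proof (intro moderate_power moderate_linear_growth[of _ 0 2])
  fix z assume "z \<in> strip"
  thus "cmod (z - cnj z) \<le> 0 + 2 * Im z" by (simp add: complex_diff_cnj norm_mult strip_def)
qed simp

lemma decays_green_form_left:
  assumes "g holomorphic_on upper_halfplane" "decays f" "moderate g"
  shows "decays (green_form f g L)"
  unfolding green_form_def[abs_def]
proof (intro decays_sum finite_atMost)
  fix n
  have "decays (\<lambda>z. comoment f n z * (sbinom n * cnj (prim (moment g n) z - L n)))"
  proof (intro decays_mult decays_comoment moderate_mult moderate_const assms(2))
    have "moderate (\<lambda>z. prim (moment g n) z - L n)"
      by (intro moderate_diff_const moderate_prim holomorphic_moment moderate_moment assms)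
    thus "moderate (\<lambda>z. cnj (prim (moment g n) z - L n))" by (simp only: moderate_cnj)
  qed
  thus "decays (\<lambda>z. (sbinom n * comoment f n z) * cnj (prim (moment g n) z - L n))" by (simp add: mult_ac)
qed

text \<open>With f only moderate the decay must come from the primitives, and it does so only once
  their limits are subtracted. This forces the base point i infinity outside
  \<open>E\<close>.\<close>

lemma decays_green_form_right:
  assumes "g holomorphic_on upper_halfplane" "moderate f" "decays g"
  shows "decays (green_form f g (\<lambda>n. lim_prim (moment g n)))"
  unfolding green_form_def[abs_def]
proof (intro decays_sum finite_atMost)
  fix n
  have "decays (\<lambda>z. cnj (prim (moment g n) z - lim_prim (moment g n)) * (sbinom n * comoment f n z))"
  proof (intro decays_mult moderate_comoment moderate_mult moderate_const assms(2))
    have "decays (\<lambda>z. prim (moment g n) z - lim_prim (moment g n))"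
      by (intro decays_prim holomorphic_moment decays_moment assms)
    thus "decays (\<lambda>z. cnj (prim (moment g n) z - lim_prim (moment g n)))" by (simp only: decays_cnj)
  qed
  thus "decays (\<lambda>z. (sbinom n * comoment f n z) * cnj (prim (moment g n) z - lim_prim (moment g n)))" by (simp add: mult_ac)
qed

lemma decays_fg:
  assumes "decays f \<and> moderate g \<or> moderate f \<and> decays g"
  shows "decays (\<lambda>z. f z * cnj (g z) * (z - cnj z) ^ m)"
proof (rule decays_mult[OF _ moderate_diff_cnj])
  from assms show "decays (\<lambda>z. f z * cnj (g z))"
  proof
    assume "decays f \<and> moderate g"
    thus ?thesis by (intro decays_mult) auto
  next
    assume "moderate f \<and> decays g"
    hence "decays (\<lambda>z. cnj (g z) * f z)" by (intro decays_mult) auto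
    thus ?thesis by (simp add: mult.commute)
  qed
qed

text \<open>On the unit circle \<open>z \<mapsto> -1/z\<close> is the reflection \<open>x \<mapsto> -x\<close>, which reverses the arc.\<close>

lemma rim_reflect:
  assumes "\<bar>x\<bar> \<le> 1/2"
  shows "rim (- x) = - (1 / rim x)" "rim' (- x) = - rim' x / (rim x)\<^sup>2"
proof -
  have pos: "1 - x\<^sup>2 > 0" using rim_pos[OF assms] by linarith
  have nz: "rim x \<noteq> 0" using pos by (auto simp: rim_def complex_eq_iff)
  have "rim (- x) * rim x = -1" using pos by (simp add: rim_def complex_eq_iff power2_eq_square[symmetric])
  thus "rim (- x) = - (1 / rim x)" using nz by (simp add: field_simps)
  have s: "sqrt (1 - x\<^sup>2) > 0" using pos by simp
  have ss: "sqrt (1 - x\<^sup>2) * sqrt (1 - x\<^sup>2) = 1 - x\<^sup>2" using pos by simp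
  have "rim' (- x) * (rim x)\<^sup>2 = - rim' x"
  proof -
    \<comment> \<open>The tangent of the unit circle is perpendicular to the radius; the scalar
      normalises its real part to 1.\<close>
    have r: "rim' y = - \<i> * rim y / of_real (sqrt (1 - y\<^sup>2))" if "1 - y\<^sup>2 > 0" for y
      using that by (simp add: rim'_def rim_def complex_eq_iff)
    have "rim' (- x) * (rim x)\<^sup>2 = - \<i> * (rim (- x) * rim x) * rim x / of_real (sqrt (1 - x\<^sup>2))"
      using r[of "-x"] pos by (simp add: power2_eq_square)
    also have "\<dots> = - rim' x" using r[OF pos] \<open>rim (- x) * rim x = -1\<close> by simp
    finally show ?thesis .
  qed
  thus "rim' (- x) = - rim' x / (rim x)\<^sup>2" using nz by (simp add: field_simps)
qed

text \<open>The weight 2 factor \<open>(rim x)\<^sup>2\<close> cancels against the derivative of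
  -1/z, and the reversed orientation leaves the sign.\<close>

lemma arc_integral_S:
  assumes g: "g holomorphic_on upper_halfplane" "g1 holomorphic_on upper_halfplane"
    and eqf: "\<And>s. Im s > 0 \<Longrightarrow> slash k f S_mat s = w * f1 s"
    and eqg: "\<And>s. Im s > 0 \<Longrightarrow> slash k g S_mat s = w * g1 s"
    and w: "cmod w = 1"
  shows "arc_integral f g (\<lambda>_. 0) = - arc_integral f1 g1 (\<lambda>_. 0)"
proof -
  have "green_form f g (\<lambda>_. 0) (rim (- x)) * rim' (- x) = - (green_form f1 g1 (\<lambda>_. 0) (rim x) * rim' x)" if "x \<in> {-1/2..1/2}" for x
  proof -
    have x: "\<bar>x\<bar> \<le> 1/2" using that by (auto simp: abs_le_iff)
    have up: "Im (rim x) > 0" by (rule Im_rim_pos[OF x])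
    hence nz: "rim x \<noteq> 0" by auto
    have U0: "green_form f g (\<lambda>_. 0) z = f z * inner_integral g \<i> z z" for f g z
      using green_form_inner_integral[of f g \<i> z] by simp
    have "f (moebius S_mat (rim x)) * inner_integral g (moebius S_mat \<i>) (moebius S_mat (rim x)) (moebius S_mat (rim x)) =
        autfac S_mat (rim x) ^ 2 * (f1 (rim x) * inner_integral g1 \<i> (rim x) (rim x))"
      by (rule integrand_transform[OF g SL_S _ eqg w]) (use up eqf in auto)
    hence "green_form f g (\<lambda>_. 0) (rim (- x)) = (rim x)\<^sup>2 * green_form f1 g1 (\<lambda>_. 0) (rim x)"
      by (simp add: U0 rim_reflect(1)[OF x])
    thus ?thesis using nz by (simp add: rim_reflect(2)[OF x])
  qed
  hence "integral {-1/2..1/2} (\<lambda>x. green_form f g (\<lambda>_. 0) (rim (- x)) * rim' (- x)) =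
      integral {-1/2..1/2} (\<lambda>x. - (green_form f1 g1 (\<lambda>_. 0) (rim x) * rim' x))"
    by (rule integral_cong)
  also have "integral {-1/2..1/2} (\<lambda>x. green_form f g (\<lambda>_. 0) (rim (- x)) * rim' (- x)) = arc_integral f g (\<lambda>_. 0)"
    unfolding arc_integral_def by (rule integral_reflect_half)
  finally show ?thesis by (simp add: arc_integral_def)
qed

lemma continuous_on_rim_comp:
  assumes "continuous_on upper_halfplane h"
  shows "continuous_on {-1/2..1/2} (\<lambda>x. h (rim x) * rim' x)"
proof (intro continuous_on_mult continuous_on_compose2[OF assms])
  show "rim ` {-1/2..1/2} \<subseteq> upper_halfplane"
    using rim_shift_upper[of _ 0] by (auto simp: abs_le_iff)
qed (auto intro!: continuous_intros simp: abs_le_iff)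

text \<open>Changing the constants alters the integrand by constant multiples of the
  \<open>comoment f n\<close>, which integrate to differences of primitives. For L the limits at i
  infinity the correction is G(\<rho>+1,\<rho>;i,i\<infinity>).\<close>

lemma arc_integral_shift:
  assumes f: "f holomorphic_on upper_halfplane" and g: "g holomorphic_on upper_halfplane"
  shows "arc_integral f g L = arc_integral f g (\<lambda>_. 0) + (\<Sum>n\<le>m. sbinom n * (prim (comoment f n) (rim (-1/2)) - prim (comoment f n) (rim (1/2))) * cnj (L n))"
proof -
  have I: "integral {-1/2..1/2} (\<lambda>x. comoment f n (rim x) * rim' x) = prim (comoment f n) (rim (1/2)) - prim (comoment f n) (rim (-1/2))" for n
  proof (rule integral_unique, rule fundamental_theorem_of_calculus)
    fix x :: real assume "x \<in> {-1/2..1/2}"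
    hence x: "\<bar>x\<bar> \<le> 1/2" by (auto simp: abs_le_iff)
    have up: "Im (rim x) > 0" by (rule Im_rim_pos[OF x])
    from field_vector_diff_chain_within[OF rim_has_vector_derivative[OF x, of "{-1/2..1/2}"] has_field_derivative_at_within[OF prim_comoment[OF f up]]]
    show "((\<lambda>x. prim (comoment f n) (rim x)) has_vector_derivative comoment f n (rim x) * rim' x) (at x within {-1/2..1/2})"
      by (simp add: o_def mult.commute)
  qed simp
  have int: "(\<lambda>x. comoment f n (rim x) * rim' x) integrable_on {-1/2..1/2}" for n
    by (intro integrable_continuous_interval continuous_on_rim_comp holomorphic_on_imp_continuous_on holomorphic_comoment f)
  have intU: "(\<lambda>x. green_form f g (\<lambda>_. 0) (rim x) * rim' x) integrable_on {-1/2..1/2}"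
    by (intro integrable_continuous_interval continuous_on_rim_comp continuous_on_green_form f g)
  have eq: "green_form f g L (rim x) * rim' x = green_form f g (\<lambda>_. 0) (rim x) * rim' x -
      (\<Sum>n\<le>m. (sbinom n * cnj (L n)) * (comoment f n (rim x) * rim' x))" for x
    unfolding green_form_def sum_distrib_right sum_subtractf[symmetric]
    by (intro sum.cong) (auto simp: algebra_simps)
  have "arc_integral f g L = arc_integral f g (\<lambda>_. 0) - integral {-1/2..1/2} (\<lambda>x. \<Sum>n\<le>m. (sbinom n * cnj (L n)) * (comoment f n (rim x) * rim' x))"
    unfolding arc_integral_def eq by (intro integral_diff intU integrable_sum integrable_on_mult_right int finite_atMost)
  also have "integral {-1/2..1/2} (\<lambda>x. \<Sum>n\<le>m. (sbinom n * cnj (L n)) * (comoment f n (rim x) * rim' x)) =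
      (\<Sum>n\<le>m. (sbinom n * cnj (L n)) * (prim (comoment f n) (rim (1/2)) - prim (comoment f n) (rim (-1/2))))"
  proof -
    have "integral {-1/2..1/2} (\<lambda>x. \<Sum>n\<le>m. (sbinom n * cnj (L n)) * (comoment f n (rim x) * rim' x)) =
      (\<Sum>n\<le>m. integral {-1/2..1/2} (\<lambda>x. (sbinom n * cnj (L n)) * (comoment f n (rim x) * rim' x)))"
      by (intro integral_sum finite_atMost integrable_on_mult_right int)
    thus ?thesis by (simp only: integral_mult_right I)
  qed
  finally show ?thesis unfolding diff_conv_add_uminus[of "arc_integral f g (\<lambda>_. 0)"] sum_negf[symmetric]
    by (simp add: algebra_simps)
qed

end

section \<open>Summation over cosets\<close>

lemma vanishes_iff: "vanishes_at_i_inf h \<longleftrightarrow> (\<forall>e>0. \<exists>Y. \<forall>z. Im z > Y \<longrightarrow> cmod (h z) < e)"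
  by (simp add: vanishes_at_i_inf_def tendsto_iff at_i_inf_iff)

lemma bij_betw_complement:
  assumes "finite A" "E \<subseteq> A" "inj_on s A" "s ` A \<subseteq> A" "s ` E \<subseteq> E"
  shows "bij_betw s (A - E) (A - E)"
proof -
  have inj: "inj_on s E" by (rule inj_on_subset[OF assms(3,2)])
  have 1: "s ` A = A" by (rule endo_inj_surj[OF assms(1,4,3)])
  have 2: "s ` E = E" by (rule endo_inj_surj[OF finite_subset[OF assms(2,1)] assms(5) inj])
  have "s ` (A - E) = s ` A - s ` E" using assms by (intro inj_on_image_set_diff[of s A]) auto
  thus ?thesis using 1 2 assms(3) by (auto simp: bij_betw_def intro: inj_on_subset)
qed

locale haberland = coset_reps N r \<gamma> + weight k m for N r :: nat and \<gamma> :: "nat \<Rightarrow> int^2^2" and k m :: nat +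
  fixes chi :: "int \<Rightarrow> complex" and f g :: "complex \<Rightarrow> complex"
  assumes N_pos: "N \<ge> 1" and chi: "dirichlet_character N chi"
    and fM: "f \<in> modular_forms k N chi" and gM: "g \<in> modular_forms k N chi"
    and van: "\<forall>\<alpha>\<in>carrier SL2Z. vanishes_at_cusp k f \<alpha> \<or> vanishes_at_cusp k g \<alpha>"
begin

definition f_at :: "nat \<Rightarrow> complex \<Rightarrow> complex" where "f_at j = slash k f (\<gamma> j)"
definition g_at :: "nat \<Rightarrow> complex \<Rightarrow> complex" where "g_at j = slash k g (\<gamma> j)"
definition E :: "nat set" where "E = {j \<in> {1..r}. vanishes_at_i_inf (f_at j)}"
text \<open>Right multiplication as a permutation of the cosets; disjointness makes the chosen index
  unique, see \<open>act_eq\<close>.\<close>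

definition act :: "int^2^2 \<Rightarrow> nat \<Rightarrow> nat" where
  "act \<alpha> j = (SOME i. i \<in> {1..r} \<and> \<gamma> j ** \<alpha> \<in> coset i)"

lemma E_subset: "E \<subseteq> {1..r}" by (auto simp: E_def)

lemma act:
  assumes "j \<in> {1..r}" "\<alpha> \<in> SL"
  shows "act \<alpha> j \<in> {1..r}" "\<gamma> j ** \<alpha> \<in> coset (act \<alpha> j)"
proof -
  have "\<exists>i. i \<in> {1..r} \<and> \<gamma> j ** \<alpha> \<in> coset i"
    using ex_coset[of "\<gamma> j ** \<alpha>"] assms by auto
  from someI_ex[OF this] show "act \<alpha> j \<in> {1..r}" "\<gamma> j ** \<alpha> \<in> coset (act \<alpha> j)"
    unfolding act_def by auto
qed

lemma act_eq: "j \<in> {1..r} \<Longrightarrow> \<alpha> \<in> SL \<Longrightarrow> i \<in> {1..r} \<Longrightarrow> \<gamma> j ** \<alpha> \<in> coset i \<Longrightarrow> act \<alpha> j = i"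
  using act coset_unique by blast

lemma inj_act:
  assumes \<alpha>: "\<alpha> \<in> SL" shows "inj_on (act \<alpha>) {1..r}"
proof (rule inj_onI)
  fix i j assume i: "i \<in> {1..r}" and j: "j \<in> {1..r}" and eq: "act \<alpha> i = act \<alpha> j"
  obtain \<beta> where \<beta>: "\<beta> \<in> Gamma0 N" "\<gamma> i ** \<alpha> = \<beta> ** \<gamma> (act \<alpha> i)" using act[OF i \<alpha>] by (auto elim: cosetE)
  obtain \<beta>' where \<beta>': "\<beta>' \<in> Gamma0 N" "\<gamma> j ** \<alpha> = \<beta>' ** \<gamma> (act \<alpha> i)" using act[OF j \<alpha>] eq by (auto elim: cosetE)
  have "\<gamma> (act \<alpha> i) = adj2 \<beta>' ** (\<gamma> j ** \<alpha>)"
    using \<beta>' Gamma0_SL by (simp add: matrix_mul_assoc matrix_mul_lid)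
  hence "\<gamma> i ** \<alpha> = (\<beta> ** adj2 \<beta>') ** \<gamma> j ** \<alpha>" using \<beta> by (simp add: matrix_mul_assoc)
  hence "(\<gamma> i ** \<alpha>) ** adj2 \<alpha> = ((\<beta> ** adj2 \<beta>') ** \<gamma> j ** \<alpha>) ** adj2 \<alpha>" by simp
  hence "\<gamma> i = (\<beta> ** adj2 \<beta>') ** \<gamma> j"
    using \<alpha> by (simp add: matrix_mul_assoc[symmetric] matrix_mul_rid)
  hence "\<gamma> i \<in> coset j" using \<beta> \<beta>' by (auto simp: r_coset_def)
  moreover have "\<gamma> i \<in> coset i" using i by (simp add: coset_iff)
  ultimately show "i = j" using coset_unique i j by blast
qed

lemma sum_act:
  assumes "\<alpha> \<in> SL" shows "(\<Sum>j\<in>{1..r}. h (act \<alpha> j)) = (\<Sum>j\<in>{1..r}. h j :: complex)"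
proof -
  have "act \<alpha> ` {1..r} = {1..r}" using inj_act[OF assms] act(1)[OF _ assms] by (intro endo_inj_surj) auto
  hence "bij_betw (act \<alpha>) {1..r} {1..r}" using inj_act[OF assms] by (simp add: bij_betw_def)
  thus ?thesis by (rule sum.reindex_bij_betw)
qed

lemma chi_norm: "\<beta> \<in> Gamma0 N \<Longrightarrow> cmod (chi (\<beta>$2$2)) = 1"
proof (rule dirichlet_character_norm[OF chi N_pos])
  assume \<beta>: "\<beta> \<in> Gamma0 N"
  hence d: "\<beta>$1$1 * \<beta>$2$2 - \<beta>$1$2 * \<beta>$2$1 = 1" "int N dvd \<beta>$2$1"
    using SL_det by (auto simp: Gamma0_def)
  show "coprime (\<beta>$2$2) (int N)"
  proof (rule coprimeI)
    fix e assume "e dvd \<beta>$2$2" "e dvd int N"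
    hence "e dvd \<beta>$1$1 * \<beta>$2$2 - \<beta>$1$2 * \<beta>$2$1" using d(2) by (meson dvd_diff dvd_mult dvd_trans)
    thus "is_unit e" using d(1) by simp
  qed
qed

lemma slash_Gamma0:
  assumes h: "h \<in> modular_forms k N chi" and \<beta>: "\<beta> \<in> Gamma0 N" and \<alpha>: "\<alpha> \<in> SL" and \<tau>: "Im \<tau> > 0"
  shows "slash k h (\<beta> ** \<alpha>) \<tau> = chi (\<beta>$2$2) * slash k h \<alpha> \<tau>"
proof -
  have "slash k h (\<beta> ** \<alpha>) \<tau> = slash k h \<beta> (moebius \<alpha> \<tau>) / autfac \<alpha> \<tau> ^ k"
    using slash_mult[OF \<alpha> \<tau>, of k h \<beta>] by (simp add: slash_alt[of k "slash k h \<beta>"])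
  also have "slash k h \<beta> (moebius \<alpha> \<tau>) = chi (\<beta>$2$2) * h (moebius \<alpha> \<tau>)"
    using h \<beta> \<alpha> \<tau> by (simp add: modular_forms_def)
  finally show ?thesis by (simp add: slash_alt)
qed

text \<open>The multiplier is the value of the character at an element of \<open>Gamma0 N\<close>
  that depends on j and \<alpha> but not on the form, so f and g share it.\<close>

lemma twist:
  assumes "j \<in> {1..r}" "\<alpha> \<in> SL"
  obtains w where "cmod w = 1"
    "\<And>s. Im s > 0 \<Longrightarrow> slash k (f_at j) \<alpha> s = w * f_at (act \<alpha> j) s"
    "\<And>s. Im s > 0 \<Longrightarrow> slash k (g_at j) \<alpha> s = w * g_at (act \<alpha> j) s"
proof -
  obtain \<beta> where \<beta>: "\<beta> \<in> Gamma0 N" "\<gamma> j ** \<alpha> = \<beta> ** \<gamma> (act \<alpha> j)"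
    using act[OF assms] by (auto elim: cosetE)
  have "slash k (slash k h (\<gamma> j)) \<alpha> s = chi (\<beta>$2$2) * slash k h (\<gamma> (act \<alpha> j)) s"
    if "h \<in> modular_forms k N chi" "Im s > 0" for h s
  proof -
    have "slash k (slash k h (\<gamma> j)) \<alpha> s = slash k h (\<gamma> j ** \<alpha>) s" using slash_mult assms that by simp
    also have "\<dots> = chi (\<beta>$2$2) * slash k h (\<gamma> (act \<alpha> j)) s"
      unfolding \<beta>(2) using act(1)[OF assms] that \<beta> by (intro slash_Gamma0) auto
    finally show ?thesis .
  qed
  thus ?thesis using that[of "chi (\<beta>$2$2)"] chi_norm[OF \<beta>(1)] fM gM by (simp add: f_at_def g_at_def)
qed

lemma hol: assumes "j \<in> {1..r}"
  shows hol_f_at: "f_at j holomorphic_on upper_halfplane" and hol_g_at: "g_at j holomorphic_on upper_halfplane"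
  using assms fM gM unfolding f_at_def g_at_def by (auto intro!: holomorphic_slash simp: modular_forms_def)

text \<open>The conjugate of the translation by N by \<delta> lies in \<open>Gamma0 N\<close> and
  has lower right entry congruent to 1, so the character is trivial on it. Thus the period N serves
  all cusps.\<close>

lemma slash_periodic:
  assumes h: "h \<in> modular_forms k N chi" and \<gamma>: "\<delta> \<in> SL" and \<tau>: "Im \<tau> > 0"
  shows "slash k h \<delta> (\<tau> + of_nat N) = slash k h \<delta> \<tau>"
proof -
  define \<beta> where "\<beta> = (\<delta> ** T_mat (int N)) ** adj2 \<delta>"
  have eq: "\<beta> ** \<delta> = \<delta> ** T_mat (int N)" using \<gamma> by (simp add: \<beta>_def matrix_mul_assoc[symmetric] matrix_mul_rid)
  have det: "\<delta>$1$1 * \<delta>$2$2 - \<delta>$1$2 * \<delta>$2$1 = 1" using SL_det[OF \<gamma>] .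
  have "\<beta>$2$1 = - (int N * \<delta>$2$1 * \<delta>$2$1)" by (simp add: \<beta>_def T_mat_def adj2_def algebra_simps)
  moreover have "\<beta> \<in> SL" using \<gamma> by (simp add: \<beta>_def)
  ultimately have \<beta>: "\<beta> \<in> Gamma0 N" by (simp add: Gamma0_def)
  have "\<beta>$2$2 = (\<delta>$1$1 * \<delta>$2$2 - \<delta>$1$2 * \<delta>$2$1) + int N * (\<delta>$2$1 * \<delta>$1$1)"
    by (simp add: \<beta>_def T_mat_def adj2_def algebra_simps)
  hence "[1 = \<beta>$2$2] (mod int N)" unfolding det cong_iff_lin by blast
  hence chi1: "chi (\<beta>$2$2) = 1"
    using dirichlet_character_cong[OF chi] dirichlet_character_one[OF chi] by metis
  have "slash k h \<delta> (\<tau> + of_nat N) = slash k (slash k h \<delta>) (T_mat (int N)) \<tau>"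
    by (simp add: slash_alt[of k "slash k h \<delta>"])
  also have "\<dots> = slash k h (\<beta> ** \<delta>) \<tau>" unfolding eq using slash_mult[of "T_mat (int N)" \<tau>] \<tau> by simp
  also have "\<dots> = slash k h \<delta> \<tau>" using slash_Gamma0[OF h \<beta> \<gamma> \<tau>] chi1 by simp
  finally show ?thesis .
qed

lemma growth:
  assumes h: "h \<in> modular_forms k N chi" and \<delta>: "\<delta> \<in> SL"
  shows "moderate (slash k h \<delta>)" "vanishes_at_i_inf (slash k h \<delta>) \<Longrightarrow> decays (slash k h \<delta>)"
proof -
  have hol: "slash k h \<delta> holomorphic_on upper_halfplane" and bdd: "Bfun (slash k h \<delta>) at_i_inf"
    using h \<delta> by (auto simp: modular_forms_def intro: holomorphic_slash)
  note per = slash_periodic[OF h \<delta>]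
  show "moderate (slash k h \<delta>)"
  proof -
    have "\<exists>C. \<forall>\<tau>. Im \<tau> \<ge> 1/2 \<longrightarrow> cmod (slash k h \<delta> \<tau>) \<le> C"
      by (rule periodic_bounded(1)[OF hol N_pos _ bdd]) (rule per)
    then obtain C where "\<And>\<tau>. Im \<tau> \<ge> 1/2 \<Longrightarrow> cmod (slash k h \<delta> \<tau>) \<le> C" by blast
    thus ?thesis by (intro moderate_bounded[of _ C]) (auto simp: strip_def)
  qed
  assume v: "vanishes_at_i_inf (slash k h \<delta>)"
  have "\<exists>C c. c > 0 \<and> (\<forall>\<tau>. Im \<tau> \<ge> 1/2 \<longrightarrow> cmod (slash k h \<delta> \<tau>) \<le> C * exp (- c * Im \<tau>))"
    by (rule periodic_bounded(2)[OF hol N_pos _ bdd v]) (rule per)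
  then obtain C c where "c > 0" "\<And>\<tau>. Im \<tau> \<ge> 1/2 \<Longrightarrow> cmod (slash k h \<delta> \<tau>) \<le> C * exp (- c * Im \<tau>)" by blast
  thus "decays (slash k h \<delta>)" by (intro decaysI[of c _ C]) (auto simp: strip_def)
qed

lemma moderate_f_at: "j \<in> {1..r} \<Longrightarrow> moderate (f_at j)" and moderate_g_at: "j \<in> {1..r} \<Longrightarrow> moderate (g_at j)"
  unfolding f_at_def g_at_def using growth(1) fM gM by auto
lemma decays_f_at: "j \<in> E \<Longrightarrow> decays (f_at j)"
  unfolding f_at_def E_def using growth(2) fM by auto
lemma decays_g_at: "j \<in> {1..r} - E \<Longrightarrow> decays (g_at j)"
  using van growth(2)[OF gM] unfolding f_at_def g_at_def E_def vanishes_at_cusp_def by auto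

section \<open>The effect of translation by 1\<close>

lemma slash_T: "slash k h (T_mat 1) s = h (s + 1)"
  by (simp add: slash_alt)

text \<open>Neither the shift, which keeps imaginary parts, nor the factor w of modulus 1 affects
  vanishing at i infinity.\<close>

lemma act_T_E: "act (T_mat 1) ` E \<subseteq> E"
proof safe
  fix j assume jE: "j \<in> E"
  hence j: "j \<in> {1..r}" using E_subset by blast
  obtain w where w: "cmod w = 1" "\<And>s. Im s > 0 \<Longrightarrow> slash k (f_at j) (T_mat 1) s = w * f_at (act (T_mat 1) j) s"
    using twist[OF j SL_T] by metis
  have norm: "cmod (f_at (act (T_mat 1) j) s) = cmod (f_at j (s + 1))" if "Im s > 0" for s
    using arg_cong[OF w(2)[OF that], of cmod] w(1) by (simp add: slash_T norm_mult)
  have "vanishes_at_i_inf (f_at (act (T_mat 1) j))"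
    unfolding vanishes_iff
  proof (intro allI impI)
    fix e :: real assume "e > 0"
    then obtain Y where Y: "\<And>z. Im z > Y \<Longrightarrow> cmod (f_at j z) < e" using jE unfolding E_def vanishes_iff by blast
    have "cmod (f_at (act (T_mat 1) j) z) < e" if "Im z > max Y 0" for z
      using that norm[of z] Y[of "z + 1"] by simp
    thus "\<exists>Y. \<forall>z. Im z > Y \<longrightarrow> cmod (f_at (act (T_mat 1) j) z) < e" by blast
  qed
  thus "act (T_mat 1) j \<in> E" using act(1)[OF j SL_T] by (simp add: E_def)
qed

lemma sum_act_T_E: "(\<Sum>j\<in>E. h (act (T_mat 1) j)) = (\<Sum>j\<in>E. h j :: complex)"
proof -
  have inj: "inj_on (act (T_mat 1)) E" using inj_act[OF SL_T] E_subset inj_on_subset by blast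
  have "finite E" using E_subset finite_subset by blast
  hence "act (T_mat 1) ` E = E" using act_T_E inj by (rule endo_inj_surj)
  with inj have "bij_betw (act (T_mat 1)) E E" by (simp add: bij_betw_def)
  thus ?thesis by (rule sum.reindex_bij_betw)
qed

lemma bij_act_T_nonE: "bij_betw (act (T_mat 1)) ({1..r} - E) ({1..r} - E)"
  using E_subset inj_act[OF SL_T] act(1)[OF _ SL_T] act_T_E by (intro bij_betw_complement) auto

lemma sum_act_T_nonE: "(\<Sum>j\<in>{1..r} - E. h (act (T_mat 1) j)) = (\<Sum>j\<in>{1..r} - E. h j :: complex)"
  using bij_act_T_nonE by (rule sum.reindex_bij_betw)

lemma rim_half: "rim (1/2) = rim (-1/2) + 1"
  by (simp add: rim_def complex_eq_iff)

lemma rim_up: "t \<ge> 0 \<Longrightarrow> Im (rim (1/2) + \<i> * of_real t) > 0" "t \<ge> 0 \<Longrightarrow> Im (rim (-1/2) + \<i> * of_real t) > 0"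
  using rim_shift_upper[of "1/2" t] rim_shift_upper[of "-1/2" t] by auto

text \<open>On the right side the inner path from i to z + 1 is broken at i + 1. The second piece is
  the translate of the left side for another index of \<open>E\<close> and cancels in the
  sum.\<close>

lemma sum_side_E:
  assumes "t \<ge> 0"
  shows "(\<Sum>j\<in>E. side (f_at j) (g_at j) (\<lambda>_. 0) t) =
     (\<Sum>j\<in>E. f_at j (rim (1/2) + \<i> * of_real t) * inner_integral (g_at j) \<i> (\<i> + 1) (rim (1/2) + \<i> * of_real t))"
proof -
  define z where "z = rim (-1/2) + \<i> * of_real t"
  have z: "Im z > 0" using rim_up(2)[OF assms] by (simp add: z_def)
  have z1: "rim (1/2) + \<i> * of_real t = z + 1" by (simp add: z_def rim_half)
  have U0: "green_form f g (\<lambda>_. 0) z = f z * inner_integral g \<i> z z" for f g z using green_form_inner_integral[of f g \<i> z] by simp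
  have "green_form (f_at j) (g_at j) (\<lambda>_. 0) (z + 1) =
     f_at j (z + 1) * inner_integral (g_at j) \<i> (\<i> + 1) (z + 1) + green_form (f_at (act (T_mat 1) j)) (g_at (act (T_mat 1) j)) (\<lambda>_. 0) z" if "j \<in> E" for j
  proof -
    have j: "j \<in> {1..r}" using that E_subset by blast
    let ?i = "act (T_mat 1) j"
    have i: "?i \<in> {1..r}" by (rule act(1)[OF j SL_T])
    obtain w where w: "cmod w = 1"
      "\<And>s. Im s > 0 \<Longrightarrow> slash k (f_at j) (T_mat 1) s = w * f_at ?i s"
      "\<And>s. Im s > 0 \<Longrightarrow> slash k (g_at j) (T_mat 1) s = w * g_at ?i s"
      using twist[OF j SL_T] by metis
    have "f_at j (moebius (T_mat 1) z) * inner_integral (g_at j) (moebius (T_mat 1) \<i>) (moebius (T_mat 1) z) (moebius (T_mat 1) z)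
       = autfac (T_mat 1) z ^ 2 * (f_at ?i z * inner_integral (g_at ?i) \<i> z z)"
      by (rule integrand_transform[OF hol_g_at[OF j] hol_g_at[OF i] SL_T _ w(3) w(1)]) (use z w(2) in auto)
    hence 1: "f_at j (z + 1) * inner_integral (g_at j) (\<i> + 1) (z + 1) (z + 1) = green_form (f_at ?i) (g_at ?i) (\<lambda>_. 0) z"
      by (simp add: U0)
    have "green_form (f_at j) (g_at j) (\<lambda>_. 0) (z + 1) = f_at j (z + 1) * (inner_integral (g_at j) \<i> (\<i> + 1) (z + 1) + inner_integral (g_at j) (\<i> + 1) (z + 1) (z + 1))"
      by (simp add: U0 inner_integral_add)
    thus ?thesis using 1 by (simp add: distrib_left)
  qed
  hence "(\<Sum>j\<in>E. green_form (f_at j) (g_at j) (\<lambda>_. 0) (z + 1)) =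
     (\<Sum>j\<in>E. f_at j (z + 1) * inner_integral (g_at j) \<i> (\<i> + 1) (z + 1)) + (\<Sum>j\<in>E. green_form (f_at (act (T_mat 1) j)) (g_at (act (T_mat 1) j)) (\<lambda>_. 0) z)"
    by (simp add: sum.distrib)
  also have "(\<Sum>j\<in>E. green_form (f_at (act (T_mat 1) j)) (g_at (act (T_mat 1) j)) (\<lambda>_. 0) z) = (\<Sum>j\<in>E. green_form (f_at j) (g_at j) (\<lambda>_. 0) z)"
    by (rule sum_act_T_E)
  finally show ?thesis unfolding side_def z1 sum_subtractf by (simp add: z_def)
qed

definition moment_limit :: "nat \<Rightarrow> nat \<Rightarrow> complex" where "moment_limit j n = lim_prim (moment (g_at j) n)"
definition comoment_limit :: "nat \<Rightarrow> nat \<Rightarrow> complex" where "comoment_limit j n = lim_prim (comoment (f_at j) n)"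

lemma moment_limit_tendsto: "j \<in> {1..r} - E \<Longrightarrow> \<bar>x\<bar> \<le> 1 \<Longrightarrow> ((\<lambda>y. prim (moment (g_at j) n) (Complex x y)) \<longlongrightarrow> moment_limit j n) at_top"
  unfolding moment_limit_def by (intro prim_tendsto holomorphic_moment hol_g_at decays_moment decays_g_at) auto
lemma comoment_limit_tendsto: "j \<in> E \<Longrightarrow> \<bar>x\<bar> \<le> 1 \<Longrightarrow> ((\<lambda>y. prim (comoment (f_at j) n) (Complex x y)) \<longlongrightarrow> comoment_limit j n) at_top"
  unfolding comoment_limit_def by (intro prim_tendsto holomorphic_comoment hol_f_at decays_comoment decays_f_at) (use E_subset in auto)

lemma green_form_tendsto:
  assumes "j \<in> {1..r} - E" "\<bar>x\<bar> \<le> 1"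
  shows "((\<lambda>y. f_at j z * inner_integral (g_at j) (Complex x y) z z) \<longlongrightarrow> green_form (f_at j) (g_at j) (moment_limit j) z) at_top"
  unfolding green_form_inner_integral[symmetric] unfolding green_form_def
  by (intro tendsto_intros moment_limit_tendsto assms)

text \<open>For finite base points translation relates 1 + i y to i y. Both tend to i infinity, so
  in the limit right and left sides agree up to a permutation of the indices.\<close>

lemma side_nonE:
  assumes "t \<ge> 0"
  shows "(\<Sum>j\<in>{1..r} - E. side (f_at j) (g_at j) (moment_limit j) t) = 0"
proof -
  define z where "z = rim (-1/2) + \<i> * of_real t"
  have z: "Im z > 0" using rim_up(2)[OF assms] by (simp add: z_def)
  have z1: "rim (1/2) + \<i> * of_real t = z + 1" by (simp add: z_def rim_half)
  have "green_form (f_at j) (g_at j) (moment_limit j) (z + 1) = green_form (f_at (act (T_mat 1) j)) (g_at (act (T_mat 1) j)) (moment_limit (act (T_mat 1) j)) z"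
    if jE: "j \<in> {1..r} - E" for j
  proof -
    have j: "j \<in> {1..r}" using that by blast
    let ?i = "act (T_mat 1) j"
    have i: "?i \<in> {1..r} - E"
      using bij_betw_apply[OF bij_act_T_nonE jE] .
    obtain w where w: "cmod w = 1"
      "\<And>s. Im s > 0 \<Longrightarrow> slash k (f_at j) (T_mat 1) s = w * f_at ?i s"
      "\<And>s. Im s > 0 \<Longrightarrow> slash k (g_at j) (T_mat 1) s = w * g_at ?i s"
      using twist[OF j SL_T] by metis
    have eq: "f_at j (z + 1) * inner_integral (g_at j) (Complex 1 y) (z + 1) (z + 1) = f_at ?i z * inner_integral (g_at ?i) (Complex 0 y) z z" if y: "y > 0" for y
    proof -
      have "f_at j (moebius (T_mat 1) z) * inner_integral (g_at j) (moebius (T_mat 1) (Complex 0 y)) (moebius (T_mat 1) z) (moebius (T_mat 1) z)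
         = autfac (T_mat 1) z ^ 2 * (f_at ?i z * inner_integral (g_at ?i) (Complex 0 y) z z)"
        by (rule integrand_transform[OF hol_g_at[OF j] _ SL_T _ w(3) w(1)]) (use z w(2) y i hol_g_at in auto)
      moreover have "Complex 0 y + 1 = Complex 1 y" by (simp add: complex_eq_iff)
      ultimately show ?thesis by simp
    qed
    have lim1: "((\<lambda>y. f_at j (z + 1) * inner_integral (g_at j) (Complex 1 y) (z + 1) (z + 1)) \<longlongrightarrow> green_form (f_at j) (g_at j) (moment_limit j) (z + 1)) at_top"
      by (rule green_form_tendsto[OF jE]) simp
    have lim2: "((\<lambda>y. f_at j (z + 1) * inner_integral (g_at j) (Complex 1 y) (z + 1) (z + 1)) \<longlongrightarrow> green_form (f_at ?i) (g_at ?i) (moment_limit ?i) z) at_top"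
    proof (rule Lim_transform_eventually)
      show "((\<lambda>y. f_at ?i z * inner_integral (g_at ?i) (Complex 0 y) z z) \<longlongrightarrow> green_form (f_at ?i) (g_at ?i) (moment_limit ?i) z) at_top"
        by (rule green_form_tendsto[OF i]) simp
      show "\<forall>\<^sub>F y in at_top. f_at ?i z * inner_integral (g_at ?i) (Complex 0 y) z z = f_at j (z + 1) * inner_integral (g_at j) (Complex 1 y) (z + 1) (z + 1)"
        using eventually_gt_at_top[of 0] by eventually_elim (simp add: eq)
    qed
    show ?thesis by (rule tendsto_unique[OF trivial_limit_at_top_linorder lim1 lim2])
  qed
  hence "(\<Sum>j\<in>{1..r} - E. green_form (f_at j) (g_at j) (moment_limit j) (z + 1)) =
      (\<Sum>j\<in>{1..r} - E. green_form (f_at (act (T_mat 1) j)) (g_at (act (T_mat 1) j)) (moment_limit (act (T_mat 1) j)) z)" by simp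
  also have "\<dots> = (\<Sum>j\<in>{1..r} - E. green_form (f_at j) (g_at j) (moment_limit j) z)" by (rule sum_act_T_nonE)
  finally show ?thesis unfolding side_def z1 sum_subtractf by (simp add: z_def)
qed

text \<open>The values of \<open>G\<^sub>j(\<rho>+1,i\<infinity>;i,i+1)\<close> and of \<open>G\<^sub>j(A,B;i,i\<infinity>)\<close>.\<close>

definition G_value_E :: "nat \<Rightarrow> complex" where
  "G_value_E j = (\<Sum>n\<le>m. sbinom n * (comoment_limit j n - prim (comoment (f_at j) n) (rim (1/2))) * cnj (prim (moment (g_at j) n) (\<i> + 1) - prim (moment (g_at j) n) \<i>))"
definition G_value_nonE :: "nat \<Rightarrow> complex \<Rightarrow> complex \<Rightarrow> complex" where
  "G_value_nonE j A B = (\<Sum>n\<le>m. sbinom n * (prim (comoment (f_at j) n) B - prim (comoment (f_at j) n) A) * cnj (moment_limit j n))"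

lemma vertical_pos: "t \<in> {0..T} \<Longrightarrow> Im (rim (1/2) + \<i> * of_real t) > 0"
  using rim_up by auto

lemma continuous_on_side:
  assumes "j \<in> {1..r}" shows "continuous_on {0..T} (side (f_at j) (g_at j) L)"
  unfolding side_def[abs_def]
  by (intro continuous_intros continuous_on_compose2[OF continuous_on_green_form[OF hol_f_at[OF assms] hol_g_at[OF assms]]])
     (use rim_up in auto)

text \<open>The limit of the summed sides is computed twice, by Green's formula and by integrating
  \<open>sum_side_E\<close>.\<close>

lemma sum_domain_integral_E: "(\<Sum>j\<in>E. domain_integral (f_at j) (g_at j)) = (\<Sum>j\<in>E. G_value_E j + arc_integral (f_at j) (g_at j) (\<lambda>_. 0))"
proof -
  have finE: "finite E" using E_subset finite_subset by blast
  have lim1: "((\<lambda>T. \<Sum>j\<in>E. \<i> * integral {0..T} (side (f_at j) (g_at j) (\<lambda>_. 0))) \<longlongrightarrow>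
     (\<Sum>j\<in>E. domain_integral (f_at j) (g_at j) - arc_integral (f_at j) (g_at j) (\<lambda>_. 0))) at_top"
  proof (rule tendsto_sum)
    fix j assume jE: "j \<in> E"
    hence j: "j \<in> {1..r}" using E_subset by blast
    show "((\<lambda>T. \<i> * integral {0..T} (side (f_at j) (g_at j) (\<lambda>_. 0))) \<longlongrightarrow> domain_integral (f_at j) (g_at j) - arc_integral (f_at j) (g_at j) (\<lambda>_. 0)) at_top"
      by (intro stokes_forms hol_f_at hol_g_at j decays_green_form_left decays_fg decays_f_at moderate_g_at jE disjI1 conjI)
  qed
  have lim2: "((\<lambda>T. \<Sum>j\<in>E. \<i> * integral {0..T} (side (f_at j) (g_at j) (\<lambda>_. 0))) \<longlongrightarrow> (\<Sum>j\<in>E. G_value_E j)) at_top"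
  proof (rule Lim_transform_eventually)
    have shift: "rim (1/2) + \<i> * of_real T = Complex (1/2) (sqrt 3 / 2 + T)" for T
      by (simp add: rim_def complex_eq_iff real_sqrt_divide power2_eq_square)
    show "((\<lambda>T. \<Sum>j\<in>E. double_integral (f_at j) (g_at j) (rim (1/2)) (rim (1/2) + \<i> * of_real T) \<i> (\<i> + 1)) \<longlongrightarrow> (\<Sum>j\<in>E. G_value_E j)) at_top"
      unfolding double_integral_def G_value_E_def shift
    proof (intro tendsto_intros)
      fix j n assume "j \<in> E"
      show "((\<lambda>T. prim (comoment (f_at j) n) (Complex (1/2) (sqrt 3 / 2 + T))) \<longlongrightarrow> comoment_limit j n) at_top"
        by (rule filterlim_compose[OF comoment_limit_tendsto[OF \<open>j \<in> E\<close>]])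
           (auto intro!: filterlim_tendsto_add_at_top[OF tendsto_const filterlim_ident])
    qed
    show "\<forall>\<^sub>F T in at_top. (\<Sum>j\<in>E. double_integral (f_at j) (g_at j) (rim (1/2)) (rim (1/2) + \<i> * of_real T) \<i> (\<i> + 1)) =
       (\<Sum>j\<in>E. \<i> * integral {0..T} (side (f_at j) (g_at j) (\<lambda>_. 0)))"
      using eventually_ge_at_top[of 0]
    proof eventually_elim
      case (elim T)
      have int: "side (f_at j) (g_at j) (\<lambda>_. 0) integrable_on {0..T}" if "j \<in> E" for j
        using that E_subset by (intro integrable_continuous_interval continuous_on_side) auto
      have "(\<Sum>j\<in>E. \<i> * integral {0..T} (side (f_at j) (g_at j) (\<lambda>_. 0))) = integral {0..T} (\<lambda>t. \<i> * (\<Sum>j\<in>E. side (f_at j) (g_at j) (\<lambda>_. 0) t))"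
        using int by (simp add: integral_sum[OF finE] sum_distrib_left)
      also have "\<dots> = integral {0..T} (\<lambda>t. \<i> * (\<Sum>j\<in>E. f_at j (rim (1/2) + \<i> * of_real t) * inner_integral (g_at j) \<i> (\<i> + 1) (rim (1/2) + \<i> * of_real t)))"
        by (intro integral_cong) (simp only: sum_side_E atLeastAtMost_iff)
      \<comment> \<open>The integrand is the derivative of the double integral whose outer endpoint
        climbs from \<rho> + 1; at height 0 this double integral vanishes.\<close>
      also have "\<dots> = (\<Sum>j\<in>E. double_integral (f_at j) (g_at j) (rim (1/2)) (rim (1/2) + \<i> * of_real T) \<i> (\<i> + 1)) -
          (\<Sum>j\<in>E. double_integral (f_at j) (g_at j) (rim (1/2)) (rim (1/2) + \<i> * of_real 0) \<i> (\<i> + 1))"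
      proof (rule integral_unique, rule fundamental_theorem_of_calculus)
        fix t assume t: "t \<in> {0..T}"
        have d: "((\<lambda>t. rim (1/2) + \<i> * of_real t) has_vector_derivative \<i>) (at t within {0..T})"
          by (auto intro!: derivative_eq_intros simp: has_vector_derivative_def scaleR_conv_of_real mult.commute)
        have "((\<lambda>t. double_integral (f_at j) (g_at j) (rim (1/2)) (rim (1/2) + \<i> * of_real t) \<i> (\<i> + 1)) has_vector_derivative
           \<i> * (f_at j (rim (1/2) + \<i> * of_real t) * inner_integral (g_at j) \<i> (\<i> + 1) (rim (1/2) + \<i> * of_real t))) (at t within {0..T})"
          if "j \<in> E" for j
        proof -
          have "j \<in> {1..r}" using that E_subset by blast
          from field_vector_diff_chain_within[OF d has_field_derivative_at_within[OF double_integral_derivative[OF hol_f_at[OF this] vertical_pos[OF t]]]]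
          show ?thesis by (simp add: o_def)
        qed
        thus "((\<lambda>t. \<Sum>j\<in>E. double_integral (f_at j) (g_at j) (rim (1/2)) (rim (1/2) + \<i> * of_real t) \<i> (\<i> + 1)) has_vector_derivative
           \<i> * (\<Sum>j\<in>E. f_at j (rim (1/2) + \<i> * of_real t) * inner_integral (g_at j) \<i> (\<i> + 1) (rim (1/2) + \<i> * of_real t))) (at t within {0..T})"
          unfolding sum_distrib_left by (rule has_vector_derivative_sum)
      qed (use elim in simp)
      finally show ?case by simp
    qed
  qed
  have "(\<Sum>j\<in>E. domain_integral (f_at j) (g_at j) - arc_integral (f_at j) (g_at j) (\<lambda>_. 0)) = (\<Sum>j\<in>E. G_value_E j)"
    by (rule tendsto_unique[OF trivial_limit_at_top_linorder lim1 lim2])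
  thus ?thesis by (simp add: sum.distrib sum_subtractf algebra_simps)
qed

text \<open>The sides contribute nothing, so everything comes from the arc;
  \<open>arc_integral_shift\<close> separates it into a value of G and the part with base point
  i.\<close>

lemma sum_domain_integral_nonE: "(\<Sum>j\<in>{1..r} - E. domain_integral (f_at j) (g_at j)) =
    (\<Sum>j\<in>{1..r} - E. G_value_nonE j (rim (1/2)) (rim (-1/2)) + arc_integral (f_at j) (g_at j) (\<lambda>_. 0))"
proof -
  have lim1: "((\<lambda>T. \<Sum>j\<in>{1..r} - E. \<i> * integral {0..T} (side (f_at j) (g_at j) (moment_limit j))) \<longlongrightarrow>
     (\<Sum>j\<in>{1..r} - E. domain_integral (f_at j) (g_at j) - arc_integral (f_at j) (g_at j) (moment_limit j))) at_top"
  proof (rule tendsto_sum)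
    fix j assume jE: "j \<in> {1..r} - E"
    hence j: "j \<in> {1..r}" by blast
    have "decays (green_form (f_at j) (g_at j) (moment_limit j))"
      using decays_green_form_right[OF hol_g_at[OF j] moderate_f_at[OF j] decays_g_at[OF jE]] by (simp add: moment_limit_def[abs_def])
    thus "((\<lambda>T. \<i> * integral {0..T} (side (f_at j) (g_at j) (moment_limit j))) \<longlongrightarrow> domain_integral (f_at j) (g_at j) - arc_integral (f_at j) (g_at j) (moment_limit j)) at_top"
      by (intro stokes_forms hol_f_at hol_g_at j decays_fg decays_g_at moderate_f_at jE disjI2 conjI)
  qed
  have lim2: "((\<lambda>T. \<Sum>j\<in>{1..r} - E. \<i> * integral {0..T} (side (f_at j) (g_at j) (moment_limit j))) \<longlongrightarrow> 0) at_top"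
  proof (rule tendsto_eventually)
    show "\<forall>\<^sub>F T in at_top. (\<Sum>j\<in>{1..r} - E. \<i> * integral {0..T} (side (f_at j) (g_at j) (moment_limit j))) = 0"
      using eventually_ge_at_top[of 0]
    proof eventually_elim
      case (elim T)
      have int: "side (f_at j) (g_at j) (moment_limit j) integrable_on {0..T}" if "j \<in> {1..r} - E" for j
        using that by (intro integrable_continuous_interval continuous_on_side) auto
      have "(\<Sum>j\<in>{1..r} - E. \<i> * integral {0..T} (side (f_at j) (g_at j) (moment_limit j))) =
          \<i> * integral {0..T} (\<lambda>t. \<Sum>j\<in>{1..r} - E. side (f_at j) (g_at j) (moment_limit j) t)"
        using int by (subst integral_sum) (auto simp: sum_distrib_left)
      also have "integral {0..T} (\<lambda>t. \<Sum>j\<in>{1..r} - E. side (f_at j) (g_at j) (moment_limit j) t) = integral {0..T} (\<lambda>t. 0)"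
        by (intro integral_cong) (simp only: side_nonE atLeastAtMost_iff)
      finally show ?case by simp
    qed
  qed
  have "(\<Sum>j\<in>{1..r} - E. domain_integral (f_at j) (g_at j) - arc_integral (f_at j) (g_at j) (moment_limit j)) = 0"
    by (rule tendsto_unique[OF trivial_limit_at_top_linorder lim1 lim2])
  moreover have "arc_integral (f_at j) (g_at j) (moment_limit j) = arc_integral (f_at j) (g_at j) (\<lambda>_. 0) + G_value_nonE j (rim (1/2)) (rim (-1/2))" if "j \<in> {1..r} - E" for j
    using that unfolding G_value_nonE_def by (intro arc_integral_shift hol_f_at hol_g_at) auto
  ultimately show ?thesis by (simp add: sum.distrib sum_subtractf algebra_simps)
qed

lemma sum_arc_integral: "(\<Sum>j\<in>{1..r}. arc_integral (f_at j) (g_at j) (\<lambda>_. 0)) = 0"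
proof -
  have "arc_integral (f_at j) (g_at j) (\<lambda>_. 0) = - arc_integral (f_at (act S_mat j)) (g_at (act S_mat j)) (\<lambda>_. 0)" if j: "j \<in> {1..r}" for j
  proof -
    obtain w where w: "cmod w = 1"
      "\<And>s. Im s > 0 \<Longrightarrow> slash k (f_at j) S_mat s = w * f_at (act S_mat j) s"
      "\<And>s. Im s > 0 \<Longrightarrow> slash k (g_at j) S_mat s = w * g_at (act S_mat j) s"
      using twist[OF j SL_S] by metis
    show ?thesis by (rule arc_integral_S[OF hol_g_at[OF j] hol_g_at[OF act(1)[OF j SL_S]] w(2,3,1)])
  qed
  hence "(\<Sum>j\<in>{1..r}. arc_integral (f_at j) (g_at j) (\<lambda>_. 0)) = (\<Sum>j\<in>{1..r}. - arc_integral (f_at (act S_mat j)) (g_at (act S_mat j)) (\<lambda>_. 0))"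
    by (intro sum.cong) auto
  also have "\<dots> = - (\<Sum>j\<in>{1..r}. arc_integral (f_at j) (g_at j) (\<lambda>_. 0))"
    unfolding sum_negf by (simp only: sum_act[OF SL_S, of "\<lambda>j. arc_integral (f_at j) (g_at j) (\<lambda>_. 0)"])
  finally show ?thesis by simp
qed

lemma sum_domain_integral: "(\<Sum>j\<in>{1..r}. domain_integral (f_at j) (g_at j)) = (\<Sum>j\<in>E. G_value_E j) + (\<Sum>j\<in>{1..r} - E. G_value_nonE j (rim (1/2)) (rim (-1/2)))"
proof -
  have split: "(\<Sum>j\<in>{1..r}. h j) = (\<Sum>j\<in>E. h j) + (\<Sum>j\<in>{1..r} - E. h j)" for h :: "nat \<Rightarrow> complex"
    using sum.subset_diff[OF E_subset, of h] by simp
  show ?thesis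
    using sum_arc_integral unfolding split sum_domain_integral_E sum_domain_integral_nonE sum.distrib by (simp add: algebra_simps add_eq_0_iff)
qed

end

section \<open>Evaluation of the double integrals\<close>

text \<open>The k-th powers of the automorphy factor and its conjugate are absorbed by the imaginary
  part, which scales by the inverse square of its norm.\<close>

lemma slash_invariant:
  assumes "\<alpha> \<in> SL" "Im z > 0"
  shows "f (moebius \<alpha> z) * cnj (g (moebius \<alpha> z)) * of_real (Im (moebius \<alpha> z) ^ k) =
    slash k f \<alpha> z * cnj (slash k g \<alpha> z) * of_real (Im z ^ k)"
proof -
  have j: "autfac \<alpha> z \<noteq> 0" using assms by simp
  have "of_real (Im (moebius \<alpha> z)) = of_real (Im z) / (autfac \<alpha> z * cnj (autfac \<alpha> z))"
    unfolding Im_moebius[OF assms(1)] complex_norm_square[symmetric] by simp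
  thus ?thesis using j by (simp add: slash_alt power_divide power_mult_distrib)
qed

context haberland begin

lemma integrable_form:
  assumes j: "j \<in> {1..r}"
  shows "set_integrable lborel std_domain (\<lambda>z. f_at j z * cnj (g_at j z) * (z - cnj z) ^ m)"
proof (cases "j \<in> E")
  case True
  show ?thesis
    by (rule stokes_forms(1)[OF hol_f_at[OF j] hol_g_at[OF j] decays_green_form_left[OF hol_g_at[OF j] decays_f_at[OF True] moderate_g_at[OF j]]])
       (intro decays_fg decays_f_at moderate_g_at True j disjI1 conjI)
next
  case False
  hence jE: "j \<in> {1..r} - E" using j by blast
  show ?thesis
    by (rule stokes_forms(1)[OF hol_f_at[OF j] hol_g_at[OF j] decays_green_form_right[OF hol_g_at[OF j] moderate_f_at[OF j] decays_g_at[OF jE]]])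
       (intro decays_fg decays_g_at moderate_f_at jE j disjI2 conjI)
qed

lemma petersson_eq:
  assumes r: "r = index_Gamma0 N"
  shows "petersson_convergent N k f g"
    and "of_nat r * (2 * \<i>) ^ (k - 1) * petersson N k f g = (\<Sum>j\<in>{1..r}. domain_integral (f_at j) (g_at j))"
proof -
  define D where "D = fundamental_domain N"
  have D: "is_fundamental_domain N D" unfolding D_def by (rule is_fundamental_domain_fundamental_domain)
  have D_upper: "D \<subseteq> upper_halfplane" and [measurable]: "D \<in> sets borel"
    using D by (auto simp: is_fundamental_domain_def)
  \<comment> \<open>The forms are arbitrary off the upper half-plane; the cut-off makes the
    integrand Borel measurable on the whole plane.\<close>
  define \<phi> where "\<phi> z = indicator upper_halfplane z *\<^sub>R (f z * cnj (g z) * of_real (Im z ^ k))" for z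
  have "continuous_on upper_halfplane f" "continuous_on upper_halfplane g"
    using fM gM by (auto simp: modular_forms_def holomorphic_on_imp_continuous_on)
  hence \<phi> [measurable]: "\<phi> \<in> borel_measurable borel" unfolding \<phi>_def[abs_def]
    by (intro borel_measurable_continuous_on_indicator continuous_intros upper_halfplane_borel)
  have \<phi>_slash: "\<phi> (moebius \<alpha> z) = slash k f \<alpha> z * cnj (slash k g \<alpha> z) * of_real (Im z ^ k)"
    if "\<alpha> \<in> SL" "Im z > 0" for \<alpha> z
    using slash_invariant[OF that, of f g k] that unfolding \<phi>_def by simp
  have inv: "\<phi> (moebius \<beta> z) = \<phi> z" if "\<beta> \<in> Gamma0 N" "Im z > 0" for \<beta> z
  proof -
    have s: "slash k f \<beta> z = chi (\<beta>$2$2) * f z" "slash k g \<beta> z = chi (\<beta>$2$2) * g z"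
      using fM gM that by (auto simp: modular_forms_def)
    have "chi (\<beta>$2$2) * cnj (chi (\<beta>$2$2)) = 1"
      using chi_norm[OF that(1)] by (simp add: complex_norm_square[symmetric])
    moreover have "\<phi> (moebius \<beta> z) = (chi (\<beta>$2$2) * cnj (chi (\<beta>$2$2))) * (f z * cnj (g z) * of_real (Im z ^ k))"
      using \<phi>_slash[of \<beta> z] that Gamma0_SL by (simp add: s mult_ac)
    ultimately show ?thesis using that by (simp add: \<phi>_def)
  qed
  define h where "h j z = f_at j z * cnj (g_at j z) * (z - cnj z) ^ m" for j z
  \<comment> \<open>The invariant measure lowers the exponent of y to m = k - 2, and z - cnj z = 2 i
    y.\<close>
  have y: "of_real (Im z ^ k) * of_real (1 / (Im z)\<^sup>2) = (z - cnj z) ^ m / (2 * \<i>) ^ m" if "Im z > 0" for z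
  proof -
    have "z - cnj z = (2 * \<i>) * of_real (Im z)" by (simp add: complex_diff_cnj mult_ac)
    hence "(z - cnj z) ^ m = (2 * \<i>) ^ m * of_real (Im z) ^ m" by (simp only: power_mult_distrib)
    moreover have "of_real (Im z ^ k) * of_real (1 / (Im z)\<^sup>2) = (of_real (Im z) ^ m :: complex)"
      using that by (simp add: k_eq power_add power2_eq_square)
    ultimately show ?thesis by simp
  qed
  have cong: "\<phi> (moebius (\<gamma> j) z) * of_real (1 / (Im z)\<^sup>2) = h j z / (2 * \<i>) ^ m" if "j \<in> {1..r}" "z \<in> std_domain" for j z
  proof -
    have z: "Im z > 0" using that std_domain_upper by blast
    have "\<phi> (moebius (\<gamma> j) z) * of_real (1 / (Im z)\<^sup>2) =
        f_at j z * cnj (g_at j z) * (of_real (Im z ^ k) * of_real (1 / (Im z)\<^sup>2))"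
      unfolding \<phi>_slash[OF \<gamma>_SL[OF that(1)] z] f_at_def g_at_def by (simp only: mult.assoc)
    thus ?thesis unfolding y[OF z] h_def by simp
  qed
  have std_domain_sub: "std_domain \<subseteq> upper_halfplane" using std_domain_upper by auto
  have int: "set_integrable hyp_measure std_domain (\<lambda>z. \<phi> (moebius (\<gamma> j) z))" if j: "j \<in> {1..r}" for j
  proof (subst set_integral_hyp_measure(1)[OF std_domain_borel _ std_domain_sub])
    have "set_integrable lborel std_domain (\<lambda>z. h j z / (2 * \<i>) ^ m)"
      using integrable_form[OF j] unfolding h_def by (intro set_integrable_divide) simp
    also have "set_integrable lborel std_domain (\<lambda>z. h j z / (2 * \<i>) ^ m) \<longleftrightarrow>
        set_integrable lborel std_domain (\<lambda>z. \<phi> (moebius (\<gamma> j) z) * of_real (1 / (Im z)\<^sup>2))"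
      using cong[OF j] by (intro set_integrable_cong) auto
    finally show "set_integrable lborel std_domain (\<lambda>z. \<phi> (moebius (\<gamma> j) z) * of_real (1 / (Im z)\<^sup>2))" .
  qed measurable
  note FD = integral_fundamental_domain[OF D \<phi> inv int]
  have pi: "\<phi> z * of_real (1 / (Im z)\<^sup>2) = petersson_integrand k f g z" if "z \<in> D" for z
    using that D_upper by (auto simp: \<phi>_def petersson_integrand_def)
  have "set_integrable lborel D (\<lambda>z. \<phi> z * of_real (1 / (Im z)\<^sup>2))"
    using FD(1) by (subst set_integral_hyp_measure(1)[symmetric]) (auto simp: D_upper)
  also have "set_integrable lborel D (\<lambda>z. \<phi> z * of_real (1 / (Im z)\<^sup>2)) \<longleftrightarrow> petersson_convergent N k f g"
    unfolding petersson_convergent_def D_def[symmetric] using pi by (intro set_integrable_cong) auto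
  finally show "petersson_convergent N k f g" .
  have "(LINT z:D|lborel. petersson_integrand k f g z) = (LINT z:D|lborel. \<phi> z * of_real (1 / (Im z)\<^sup>2))"
    using pi by (intro set_lebesgue_integral_cong) auto
  also have "\<dots> = (LINT z:D|hyp_measure. \<phi> z)"
    by (rule set_integral_hyp_measure(2)[symmetric]) (auto simp: D_upper)
  also have "\<dots> = (\<Sum>j\<in>{1..r}. LINT z:std_domain|hyp_measure. \<phi> (moebius (\<gamma> j) z))" by (rule FD(2))
  also have "\<dots> = (\<Sum>j\<in>{1..r}. (LINT z:std_domain|lborel. h j z) / (2 * \<i>) ^ m)"
  proof (rule sum.cong[OF refl])
    fix j assume j: "j \<in> {1..r}"
    have "(LINT z:std_domain|hyp_measure. \<phi> (moebius (\<gamma> j) z)) = (LINT z:std_domain|lborel. \<phi> (moebius (\<gamma> j) z) * of_real (1 / (Im z)\<^sup>2))"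
      by (rule set_integral_hyp_measure(2)[OF std_domain_borel _ std_domain_sub]) measurable
    also have "\<dots> = (LINT z:std_domain|lborel. h j z / (2 * \<i>) ^ m)"
      using cong[OF j] by (intro set_lebesgue_integral_cong) auto
    finally show "(LINT z:std_domain|hyp_measure. \<phi> (moebius (\<gamma> j) z)) = (LINT z:std_domain|lborel. h j z) / (2 * \<i>) ^ m" by simp
  qed
  \<comment> \<open>The factor 2 i inside \<open>domain_integral\<close> raises the exponent to m +
    1 = k - 1.\<close>
  also have "\<dots> = (\<Sum>j\<in>{1..r}. domain_integral (f_at j) (g_at j)) / (2 * \<i>) ^ (m + 1)"
    unfolding sum_divide_distrib by (intro sum.cong) (auto simp: domain_integral_def h_def[abs_def])
  finally have "(LINT z:D|lborel. petersson_integrand k f g z) = (\<Sum>j\<in>{1..r}. domain_integral (f_at j) (g_at j)) / (2 * \<i>) ^ (m + 1)" .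
  thus "of_nat r * (2 * \<i>) ^ (k - 1) * petersson N k f g = (\<Sum>j\<in>{1..r}. domain_integral (f_at j) (g_at j))"
    using r_pos unfolding petersson_def r[symmetric] D_def[symmetric] by (simp add: k_eq)
qed

lemma act_S_act_S: "j \<in> {1..r} \<Longrightarrow> act S_mat (act S_mat j) = j"
proof -
  assume j: "j \<in> {1..r}"
  let ?i = "act S_mat j"
  have i: "?i \<in> {1..r}" by (rule act(1)[OF j SL_S])
  obtain \<beta> where \<beta>: "\<beta> \<in> Gamma0 N" "\<gamma> j ** S_mat = \<beta> ** \<gamma> ?i" using act(2)[OF j SL_S] by (auto elim: cosetE)
  \<comment> \<open>S squares to minus the identity, which lies in \<open>Gamma0 N\<close>; hence S
    acts on the cosets as an involution.\<close>
  have SS: "S_mat ** S_mat = - mat 1" by (intro mat2_eqI) (auto simp: S_mat_eq)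
  have "\<gamma> ?i = adj2 \<beta> ** (\<gamma> j ** S_mat)"
    using \<beta> Gamma0_SL by (simp add: matrix_mul_assoc matrix_mul_lid)
  hence "\<gamma> ?i ** S_mat = adj2 \<beta> ** (\<gamma> j ** (S_mat ** S_mat))" by (simp add: matrix_mul_assoc)
  also have "\<dots> = (- adj2 \<beta>) ** \<gamma> j" unfolding SS by (simp add: mult_uminus_mat2 matrix_mul_rid)
  finally have "\<gamma> ?i ** S_mat \<in> coset j" using \<beta> by (auto simp: r_coset_def)
  thus ?thesis using act_eq[OF i SL_S j] by simp
qed

text \<open>The index set of the third sum: S is an involution on the indices, so lying outside S(E)
  means being mapped outside \<open>E\<close>. In this form M is visibly stable under S.\<close>

definition M :: "nat set" where "M = {j \<in> {1..r}. j \<notin> E \<and> act S_mat j \<notin> E}"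

lemma M_act: "j \<in> M \<Longrightarrow> act S_mat j \<in> M"
  using act(1)[OF _ SL_S] act_S_act_S by (auto simp: M_def)

lemma sum_M: "(\<Sum>j\<in>M. h (act S_mat j)) = (\<Sum>j\<in>M. h j :: complex)"
proof -
  have "act S_mat (act S_mat j) = j" if "j \<in> M" for j using that by (intro act_S_act_S) (auto simp: M_def)
  hence "bij_betw (act S_mat) M M" using M_act by (intro bij_betwI[where g = "act S_mat"]) auto
  thus ?thesis by (rule sum.reindex_bij_betw)
qed

definition moment_limit_0 :: "nat \<Rightarrow> nat \<Rightarrow> complex" where
  "moment_limit_0 j n = Lim (at_right 0) (\<lambda>t. prim (moment (g_at j) n) (Complex 0 t))"

text \<open>Substituting -1/D into the n-th moment produces D^(k-n) = D^(m-n) D^2, so n is exchanged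
  with m - n and the D^2 cancels with the derivative. The primitives match without an additive
  constant because i is fixed.\<close>

lemma moment_inversion:
  assumes j: "j \<in> {1..r}" and n: "n \<le> m"
  obtains w where "cmod w = 1"
    "\<And>D. Im D > 0 \<Longrightarrow> moment (g_at j) n (- (1 / D)) = w * (-1) ^ n * (D ^ 2 * moment (g_at (act S_mat j)) (m - n) D)"
    "\<And>D. Im D > 0 \<Longrightarrow> prim (moment (g_at j) n) (- (1 / D)) = w * (-1) ^ n * prim (moment (g_at (act S_mat j)) (m - n)) D"
proof -
  let ?i = "act S_mat j"
  have i: "?i \<in> {1..r}" by (rule act(1)[OF j SL_S])
  obtain w where w: "cmod w = 1" "\<And>s. Im s > 0 \<Longrightarrow> slash k (g_at j) S_mat s = w * g_at ?i s"
    using twist[OF j SL_S] by metis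
  have b: "moment (g_at j) n (- (1 / D)) = w * (-1) ^ n * (D ^ 2 * moment (g_at ?i) (m - n) D)" if D: "Im D > 0" for D
  proof -
    have nz: "D \<noteq> 0" using D by auto
    have "g_at j (- (1 / D)) = D ^ k * (w * g_at ?i D)"
      using w(2)[OF D] nz by (simp add: slash_alt field_simps)
    hence "moment (g_at j) n (- (1 / D)) = (-1) ^ n * (1 / D ^ n) * (D ^ k * (w * g_at ?i D))"
      by (simp add: moment_def power_minus[of "1 / D"] power_one_over)
    also have "D ^ k = D ^ n * D ^ (m - n) * D ^ 2" using n by (simp add: k_eq power_add[symmetric])
    finally show ?thesis using nz by (simp add: moment_def)
  qed
  have p: "prim (moment (g_at j) n) (- (1 / D)) = w * (-1) ^ n * prim (moment (g_at ?i) (m - n)) D" if D: "Im D > 0" for D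
  proof -
    define u where "u D = prim (moment (g_at j) n) (- (1 / D))" for D
    define v where "v D = w * (-1) ^ n * prim (moment (g_at ?i) (m - n)) D" for D
    define h where "h D = w * (-1) ^ n * moment (g_at ?i) (m - n) D" for D
    have "u D = v D"
    proof (rule holomorphic_unique_primitive[of u h v \<i> D])
      fix z :: complex assume z: "Im z > 0"
      hence nz: "z \<noteq> 0" by auto
      have up: "Im (- (1 / z)) > 0" using moebius_in_upper[OF SL_S z] by simp
      have "((\<lambda>D. - (1 / D)) has_field_derivative 1 / z ^ 2) (at z)"
        using nz by (auto intro!: derivative_eq_intros simp: power2_eq_square)
      from DERIV_chain2[OF prim_moment[OF hol_g_at[OF j] up] this]
      have "(u has_field_derivative moment (g_at j) n (- (1 / z)) * (1 / z ^ 2)) (at z)" unfolding u_def .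
      thus "(u has_field_derivative h z) (at z)"
        unfolding b[OF z] h_def using nz by (simp add: mult.assoc)
      show "(v has_field_derivative h z) (at z)"
        unfolding v_def h_def by (intro DERIV_cmult prim_moment hol_g_at i z)
    qed (use D in \<open>auto simp: u_def v_def\<close>)
    thus ?thesis by (simp add: u_def v_def)
  qed
  show ?thesis by (rule that[OF w(1) b p])
qed

lemma Complex_0_inverse: "t \<noteq> 0 \<Longrightarrow> Complex 0 t = - (1 / Complex 0 (inverse t))"
  by (simp add: complex_eq_iff Re_divide Im_divide power2_eq_square inverse_eq_divide)

text \<open>Inversion carries the behaviour of \<open>g_at j\<close> at the cusp 0 to that of the
  form with index S(j) at i infinity, where it decays.\<close>

lemma moment_limit_0_tendsto:
  assumes j: "j \<in> {1..r}" "act S_mat j \<notin> E" and n: "n \<le> m"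
  shows "((\<lambda>t. prim (moment (g_at j) n) (Complex 0 t)) \<longlongrightarrow> moment_limit_0 j n) (at_right 0)"
proof -
  let ?i = "act S_mat j"
  have i: "?i \<in> {1..r} - E" using act(1)[OF j(1) SL_S] j by blast
  obtain w where w: "\<And>D. Im D > 0 \<Longrightarrow> prim (moment (g_at j) n) (- (1 / D)) = w * (-1) ^ n * prim (moment (g_at ?i) (m - n)) D"
    using moment_inversion[OF j(1) n] by metis
  have "((\<lambda>y. w * (-1) ^ n * prim (moment (g_at ?i) (m - n)) (Complex 0 y)) \<longlongrightarrow> w * (-1) ^ n * moment_limit ?i (m - n)) at_top"
    by (intro tendsto_intros moment_limit_tendsto i) simp
  moreover have "\<forall>\<^sub>F y in at_top. w * (-1) ^ n * prim (moment (g_at ?i) (m - n)) (Complex 0 y) = prim (moment (g_at j) n) (Complex 0 (inverse y))"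
    using eventually_gt_at_top[of 0]
  proof eventually_elim
    case (elim y)
    thus ?case using w[of "Complex 0 y"] Complex_0_inverse[of "inverse y"] by simp
  qed
  ultimately have "((\<lambda>y. prim (moment (g_at j) n) (Complex 0 (inverse y))) \<longlongrightarrow> w * (-1) ^ n * moment_limit ?i (m - n)) at_top"
    by (rule Lim_transform_eventually)
  hence lim: "((\<lambda>t. prim (moment (g_at j) n) (Complex 0 t)) \<longlongrightarrow> w * (-1) ^ n * moment_limit ?i (m - n)) (at_right 0)"
    by (subst filterlim_at_right_to_top)
  hence "moment_limit_0 j n = w * (-1) ^ n * moment_limit ?i (m - n)"
    unfolding moment_limit_0_def by (intro tendsto_Lim) auto
  thus ?thesis using lim by simp
qed

text \<open>After inversion the exponential decay at i infinity outweighs the factor D^2.\<close>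

lemma moment_bounded_near_0:
  assumes j: "j \<in> {1..r}" "act S_mat j \<notin> E" and n: "n \<le> m"
  obtains K where "\<And>t. 0 < t \<Longrightarrow> t \<le> 1 \<Longrightarrow> cmod (moment (g_at j) n (Complex 0 t)) \<le> K"
proof -
  let ?i = "act S_mat j"
  have i: "?i \<in> {1..r} - E" using act(1)[OF j(1) SL_S] j by blast
  obtain w where w: "cmod w = 1" "\<And>D. Im D > 0 \<Longrightarrow> moment (g_at j) n (- (1 / D)) = w * (-1) ^ n * (D ^ 2 * moment (g_at ?i) (m - n) D)"
    using moment_inversion[OF j(1) n] by metis
  have "decays (\<lambda>D. moment (g_at ?i) (m - n) D * D ^ 2)"
    by (intro decays_mult decays_moment decays_g_at i moderate_power moderate_id)
  then obtain C c where C: "C \<ge> 0" "c > 0" "\<And>z. z \<in> strip \<Longrightarrow> cmod (moment (g_at ?i) (m - n) z * z ^ 2) \<le> C * exp (- c * Im z)"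
    using decaysE by blast
  have "cmod (moment (g_at j) n (Complex 0 t)) \<le> C" if t: "0 < t" "t \<le> 1" for t
  proof -
    define D where "D = Complex 0 (inverse t)"
    have inv: "inverse t \<ge> 1" using t by (simp add: one_le_inverse)
    have D: "Im D > 0" "D \<in> strip" using inv t by (auto simp: D_def strip_def)
    have "cmod (moment (g_at j) n (Complex 0 t)) = cmod (moment (g_at ?i) (m - n) D * D ^ 2)"
      using w(2)[OF D(1)] w(1) Complex_0_inverse[of t] t by (simp add: D_def norm_mult norm_power)
    also have "\<dots> \<le> C * exp (- c * Im D)" by (rule C(3)[OF D(2)])
    also have "\<dots> \<le> C * 1" using C(1,2) D(1) by (intro mult_left_mono) auto
    finally show ?thesis by simp
  qed
  thus ?thesis using that by blast
qed

text \<open>The value of \<open>G\<^sub>j(\<rho>,i;i\<infinity>,0)\<close>.\<close>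

definition G_value_M :: "nat \<Rightarrow> complex" where
  "G_value_M j = (\<Sum>n\<le>m. sbinom n * (prim (comoment (f_at j) n) \<i> - prim (comoment (f_at j) n) (rim (-1/2))) * cnj (moment_limit_0 j n - moment_limit j n))"

text \<open>S maps \<rho> to \<rho> + 1, fixes i and exchanges i/y with i y, so G(\<rho>+1,i;i,iy)
  for j equals G(\<rho>,i;i,i/y) for S(j); then y tends to infinity.\<close>

lemma G_value_nonE_S:
  assumes jM: "j \<in> M"
  shows "G_value_nonE j (rim (1/2)) \<i> = (\<Sum>n\<le>m. sbinom n * (prim (comoment (f_at (act S_mat j)) n) \<i> -
    prim (comoment (f_at (act S_mat j)) n) (rim (-1/2))) * cnj (moment_limit_0 (act S_mat j) n))"
proof -
  let ?i = "act S_mat j"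
  have j: "j \<in> {1..r}" "j \<in> {1..r} - E" using jM by (auto simp: M_def)
  have i: "?i \<in> {1..r}" by (rule act(1)[OF j(1) SL_S])
  have Si: "act S_mat ?i \<notin> E" using act_S_act_S[OF j(1)] j by simp
  obtain w where w: "cmod w = 1"
    "\<And>s. Im s > 0 \<Longrightarrow> slash k (f_at j) S_mat s = w * f_at ?i s"
    "\<And>s. Im s > 0 \<Longrightarrow> slash k (g_at j) S_mat s = w * g_at ?i s"
    using twist[OF j(1) SL_S] by metis
  have S_rim: "moebius S_mat (rim (-1/2)) = rim (1/2)" using rim_reflect(1)[of "-1/2"] by simp
  have up: "Im (rim (-1/2)) > 0" by (rule Im_rim_pos) simp
  have eq: "double_integral (f_at ?i) (g_at ?i) (rim (-1/2)) \<i> \<i> (Complex 0 (inverse y)) = double_integral (f_at j) (g_at j) (rim (1/2)) \<i> \<i> (Complex 0 y)"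
    if y: "y > 0" for y
  proof -
    have "moebius S_mat (Complex 0 (inverse y)) = Complex 0 y" using Complex_0_inverse[of y] y by simp
    moreover have "moebius S_mat \<i> = \<i>" by simp
    moreover have "double_integral (f_at j) (g_at j) (moebius S_mat (rim (-1/2))) (moebius S_mat \<i>) (moebius S_mat \<i>) (moebius S_mat (Complex 0 (inverse y)))
        = double_integral (f_at ?i) (g_at ?i) (rim (-1/2)) \<i> \<i> (Complex 0 (inverse y))"
      by (rule double_integral_transform[OF hol_f_at[OF j(1)] hol_f_at[OF i] hol_g_at[OF j(1)] hol_g_at[OF i] SL_S w(2,3,1) up]) (use y in auto)
    ultimately show ?thesis by (simp only: S_rim)
  qed
  have lim1: "((\<lambda>y. double_integral (f_at j) (g_at j) (rim (1/2)) \<i> \<i> (Complex 0 y)) \<longlongrightarrow> G_value_nonE j (rim (1/2)) \<i>) at_top"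
    unfolding double_integral_def G_value_nonE_def prim_i diff_0_right by (intro tendsto_intros moment_limit_tendsto j(2)) simp
  have lim2: "((\<lambda>y. double_integral (f_at j) (g_at j) (rim (1/2)) \<i> \<i> (Complex 0 y)) \<longlongrightarrow>
     (\<Sum>n\<le>m. sbinom n * (prim (comoment (f_at ?i) n) \<i> - prim (comoment (f_at ?i) n) (rim (-1/2))) * cnj (moment_limit_0 ?i n))) at_top"
  proof (rule Lim_transform_eventually)
    show "((\<lambda>y. double_integral (f_at ?i) (g_at ?i) (rim (-1/2)) \<i> \<i> (Complex 0 (inverse y))) \<longlongrightarrow>
     (\<Sum>n\<le>m. sbinom n * (prim (comoment (f_at ?i) n) \<i> - prim (comoment (f_at ?i) n) (rim (-1/2))) * cnj (moment_limit_0 ?i n))) at_top"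
      unfolding double_integral_def
    proof (intro tendsto_intros)
      fix n assume "n \<in> {..m}"
      hence "((\<lambda>t. prim (moment (g_at ?i) n) (Complex 0 t) - prim (moment (g_at ?i) n) \<i>) \<longlongrightarrow> moment_limit_0 ?i n - 0) (at_right 0)"
        by (intro tendsto_diff moment_limit_0_tendsto i Si) auto
      thus "((\<lambda>y. prim (moment (g_at ?i) n) (Complex 0 (inverse y)) - prim (moment (g_at ?i) n) \<i>) \<longlongrightarrow> moment_limit_0 ?i n) at_top"
        by (subst (asm) filterlim_at_right_to_top) simp
    qed
    show "\<forall>\<^sub>F y in at_top. double_integral (f_at ?i) (g_at ?i) (rim (-1/2)) \<i> \<i> (Complex 0 (inverse y)) = double_integral (f_at j) (g_at j) (rim (1/2)) \<i> \<i> (Complex 0 y)"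
      using eventually_gt_at_top[of 0] by eventually_elim (rule eq)
  qed
  show ?thesis by (rule tendsto_unique[OF trivial_limit_at_top_linorder lim1 lim2])
qed

text \<open>The outer path is broken at i. Reindexed by S, the half from \<rho> + 1 to i gives
  G(\<rho>,i;i,0); the other half is minus G(\<rho>,i;i,i\<infinity>). Together the inner path runs
  from i infinity to 0.\<close>

lemma sum_G_value_nonE_M: "(\<Sum>j\<in>M. G_value_nonE j (rim (1/2)) (rim (-1/2))) = (\<Sum>j\<in>M. G_value_M j)"
proof -
  define X where "X j = (\<Sum>n\<le>m. sbinom n * (prim (comoment (f_at j) n) \<i> - prim (comoment (f_at j) n) (rim (-1/2))) * cnj (moment_limit_0 j n))" for j
  have "G_value_nonE j (rim (1/2)) (rim (-1/2)) = G_value_nonE j (rim (1/2)) \<i> + G_value_nonE j \<i> (rim (-1/2))" for j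
    unfolding G_value_nonE_def sum.distrib[symmetric] by (intro sum.cong) (auto simp: algebra_simps)
  hence "(\<Sum>j\<in>M. G_value_nonE j (rim (1/2)) (rim (-1/2))) = (\<Sum>j\<in>M. X (act S_mat j)) + (\<Sum>j\<in>M. G_value_nonE j \<i> (rim (-1/2)))"
    by (simp add: sum.distrib G_value_nonE_S X_def)
  also have "(\<Sum>j\<in>M. X (act S_mat j)) = (\<Sum>j\<in>M. X j)" by (rule sum_M)
  also have "(\<Sum>j\<in>M. X j) + (\<Sum>j\<in>M. G_value_nonE j \<i> (rim (-1/2))) = (\<Sum>j\<in>M. G_value_M j)"
    unfolding sum.distrib[symmetric] X_def G_value_nonE_def G_value_M_def
    by (intro sum.cong refl) (auto simp: algebra_simps)
  finally show ?thesis .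
qed

text \<open>Bundles everything the theorem asserts about one quadruple of endpoints with the value
  in terms of primitives.\<close>

definition evaluates :: "nat \<Rightarrow> hpoint \<Rightarrow> hpoint \<Rightarrow> hpoint \<Rightarrow> hpoint \<Rightarrow> complex \<Rightarrow> bool" where
  "evaluates j A B C D v \<longleftrightarrow> G_convergent k (f_at j) (g_at j) A B C D \<and>
     (\<forall>n\<le>m. line_integrable A B (comoment (f_at j) n) \<and> line_integrable C D (moment (g_at j) n)) \<and>
     G_integral k (f_at j) (g_at j) A B C D = (\<Sum>n\<le>m. sbinom n * line_integral A B (comoment (f_at j) n) * cnj (line_integral C D (moment (g_at j) n))) \<and>
     G_integral k (f_at j) (g_at j) A B C D = v"

lemma evaluatesI:
  assumes "\<And>n. n \<le> m \<Longrightarrow> line_integrable A B (comoment (f_at j) n)" "\<And>n. n \<le> m \<Longrightarrow> line_integrable C D (moment (g_at j) n)"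
    and "\<And>n. n \<le> m \<Longrightarrow> line_integral A B (comoment (f_at j) n) = a n" "\<And>n. n \<le> m \<Longrightarrow> line_integral C D (moment (g_at j) n) = b n"
  shows "evaluates j A B C D (\<Sum>n\<le>m. sbinom n * a n * cnj (b n))"
  unfolding evaluates_def using G_integral_bilinear[OF assms(1,2)] assms by auto

lemma rim_neq: "Re (rim (1/2)) \<noteq> Re (rim (-1/2))" "Re (rim (-1/2)) \<noteq> Re \<i>" "Re \<i> \<noteq> Re (\<i> + 1)"
  by auto

lemma evaluates_E:
  assumes jE: "j \<in> E"
  shows "evaluates j (Pt (rim (1/2))) I_Inf (Pt \<i>) (Pt (\<i> + 1)) (G_value_E j)"
  unfolding G_value_E_def
proof (rule evaluatesI)
  have j: "j \<in> {1..r}" using jE E_subset by blast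
  have y: "Im (rim (1/2)) \<ge> 1/2" using Im_rim_ge[of "1/2"] unfolding Im_rim by auto
  fix n
  note A = line_integral_to_I_Inf[OF prim_comoment[OF hol_f_at[OF j]] holomorphic_comoment[OF hol_f_at[OF j]] decays_comoment[OF decays_f_at[OF jE]],
      where a = "rim (1/2)", OF _ comoment_limit_tendsto[OF jE]]
  show "line_integrable (Pt (rim (1/2))) I_Inf (comoment (f_at j) n)" by (rule A(1)) (use y in auto)
  show "line_integral (Pt (rim (1/2))) I_Inf (comoment (f_at j) n) = comoment_limit j n - prim (comoment (f_at j) n) (rim (1/2))" by (rule A(2)) (use y in auto)
  note B = line_integral_arc[OF prim_moment[OF hol_g_at[OF j]] holomorphic_moment[OF hol_g_at[OF j]]]
  show "line_integrable (Pt \<i>) (Pt (\<i> + 1)) (moment (g_at j) n)" by (rule B(1)) auto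
  show "line_integral (Pt \<i>) (Pt (\<i> + 1)) (moment (g_at j) n) = prim (moment (g_at j) n) (\<i> + 1) - prim (moment (g_at j) n) \<i>" by (rule B(2)) auto
qed

lemma evaluates_nonE:
  assumes jE: "j \<in> {1..r} - E"
  shows "evaluates j (Pt (rim (1/2))) (Pt (rim (-1/2))) (Pt \<i>) I_Inf (G_value_nonE j (rim (1/2)) (rim (-1/2)))"
  unfolding G_value_nonE_def
proof (rule evaluatesI)
  have j: "j \<in> {1..r}" using jE by blast
  have up: "Im (rim (1/2)) > 0" "Im (rim (-1/2)) > 0" by (auto intro!: Im_rim_pos)
  fix n
  note A = line_integral_arc[OF prim_comoment[OF hol_f_at[OF j]] holomorphic_comoment[OF hol_f_at[OF j]] _ _ rim_neq(1)]
  show "line_integrable (Pt (rim (1/2))) (Pt (rim (-1/2))) (comoment (f_at j) n)" by (rule A(1)) (use up in auto)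
  show "line_integral (Pt (rim (1/2))) (Pt (rim (-1/2))) (comoment (f_at j) n) = prim (comoment (f_at j) n) (rim (-1/2)) - prim (comoment (f_at j) n) (rim (1/2))"
    by (rule A(2)) (use up in auto)
  have L: "((\<lambda>y. prim (moment (g_at j) n) (Complex (Re \<i>) y)) \<longlongrightarrow> moment_limit j n) at_top" by (rule moment_limit_tendsto[OF jE]) simp
  note B = line_integral_to_I_Inf[OF prim_moment[OF hol_g_at[OF j]] holomorphic_moment[OF hol_g_at[OF j]] decays_moment[OF decays_g_at[OF jE]] L]
  show "line_integrable (Pt \<i>) I_Inf (moment (g_at j) n)" by (rule B(1)) auto
  show "line_integral (Pt \<i>) I_Inf (moment (g_at j) n) = moment_limit j n" by (subst B(2)) auto
qed

lemma evaluates_M: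
  assumes jM: "j \<in> M"
  shows "evaluates j (Pt (rim (-1/2))) (Pt \<i>) I_Inf (Pt 0) (G_value_M j)"
  unfolding G_value_M_def
proof (rule evaluatesI)
  have j: "j \<in> {1..r}" "j \<in> {1..r} - E" "act S_mat j \<notin> E" using jM by (auto simp: M_def)
  have up: "Im (rim (-1/2)) > 0" by (auto intro!: Im_rim_pos)
  fix n assume n: "n \<le> m"
  note A = line_integral_arc[OF prim_comoment[OF hol_f_at[OF j(1)]] holomorphic_comoment[OF hol_f_at[OF j(1)]] _ _ rim_neq(2)]
  show "line_integrable (Pt (rim (-1/2))) (Pt \<i>) (comoment (f_at j) n)" by (rule A(1)) (use up in auto)
  show "line_integral (Pt (rim (-1/2))) (Pt \<i>) (comoment (f_at j) n) = prim (comoment (f_at j) n) \<i> - prim (comoment (f_at j) n) (rim (-1/2))"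
    by (rule A(2)) (use up in auto)
  \<comment> \<open>Here S(j) lies outside \<open>E\<close>, so the moment is under control at the
    cusp 0 as well.\<close>
  obtain K where K: "\<And>t. 0 < t \<Longrightarrow> t \<le> 1 \<Longrightarrow> cmod (moment (g_at j) n (Complex 0 t)) \<le> K"
    using moment_bounded_near_0[OF j(1,3) n] by blast
  have L: "((\<lambda>y. prim (moment (g_at j) n) (Complex 0 y)) \<longlongrightarrow> moment_limit j n) at_top" by (rule moment_limit_tendsto[OF j(2)]) simp
  note B = line_integral_I_Inf_0[OF prim_moment[OF hol_g_at[OF j(1)]] holomorphic_moment[OF hol_g_at[OF j(1)]] decays_moment[OF decays_g_at[OF j(2)]] K L moment_limit_0_tendsto[OF j(1,3) n]]
  show "line_integrable I_Inf (Pt 0) (moment (g_at j) n)" by (rule B(1))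
  show "line_integral I_Inf (Pt 0) (moment (g_at j) n) = moment_limit_0 j n - moment_limit j n" by (rule B(2))
qed

end

lemma rho_eq_rim: "exp (2 * of_real pi * \<i> / 3) = rim (-1/2)"
proof -
  have "2 * of_real pi * \<i> / 3 = \<i> * of_real (2 * pi / 3)" by simp
  hence "exp (2 * of_real pi * \<i> / 3) = cis (2 * pi / 3)" by (simp only: cis_conv_exp)
  also have "\<dots> = rim (-1/2)"
    by (simp add: complex_eq_iff rim_def cos_120 sin_120 real_sqrt_divide power2_eq_square)
  finally show ?thesis .
qed

theorem theorem3p8:
  fixes k N r :: nat
    and chi :: "int \<Rightarrow> complex"
    and f g :: "complex \<Rightarrow> complex"
    and \<gamma> :: "nat \<Rightarrow> int^2^2"
    and f' g' :: "nat \<Rightarrow> complex \<Rightarrow> complex"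
    and S :: "nat \<Rightarrow> nat"
    and E :: "nat set"
    and \<rho> :: complex
  assumes "k \<ge> 2" and "N \<ge> 1"
    and "dirichlet_character N chi"
    and "f \<in> modular_forms k N chi" and "g \<in> modular_forms k N chi"
    and "\<forall>\<alpha>\<in>carrier SL2Z. vanishes_at_cusp k f \<alpha> \<or> vanishes_at_cusp k g \<alpha>"
    and "r = index_Gamma0 N"
    and "carrier SL2Z = (\<Union>j\<in>{1..r}. Gamma0 N #>\<^bsub>SL2Z\<^esub> \<gamma> j)"
    and "disjoint_family_on (\<lambda>j. Gamma0 N #>\<^bsub>SL2Z\<^esub> \<gamma> j) {1..r}"
    and "\<And>j. f' j = slash k f (\<gamma> j)" and "\<And>j. g' j = slash k g (\<gamma> j)"
    and "E = {j \<in> {1..r}. vanishes_at_i_inf (f' j)}"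
    and "\<forall>j\<in>{1..r}. S j \<in> {1..r} \<and> \<gamma> j \<otimes>\<^bsub>SL2Z\<^esub> S_mat \<in> Gamma0 N #>\<^bsub>SL2Z\<^esub> \<gamma> (S j)"
    and "\<rho> = exp (2 * of_real pi * \<i> / 3)"
  shows "petersson_convergent N k f g \<and>
      of_nat r * (2 * \<i>) ^ (k - 1) * petersson N k f g =
        (\<Sum>j\<in>E. G_integral k (f' j) (g' j) (Pt (\<rho> + 1)) I_Inf (Pt \<i>) (Pt (\<i> + 1)))
      + (\<Sum>j | j \<in> {1..r} \<and> j \<notin> E \<and> j \<in> S ` E.
           G_integral k (f' j) (g' j) (Pt (\<rho> + 1)) (Pt \<rho>) (Pt \<i>) I_Inf)
      + (\<Sum>j | j \<in> {1..r} \<and> j \<notin> E \<and> j \<notin> S ` E.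
           G_integral k (f' j) (g' j) (Pt \<rho>) (Pt \<i>) I_Inf (Pt 0)) \<and>
      (\<forall>j A B C D.
        j \<in> E \<and> (A, B, C, D) = (Pt (\<rho> + 1), I_Inf, Pt \<i>, Pt (\<i> + 1)) \<or>
        j \<in> {1..r} \<and> j \<notin> E \<and> j \<in> S ` E \<and> (A, B, C, D) = (Pt (\<rho> + 1), Pt \<rho>, Pt \<i>, I_Inf) \<or>
        j \<in> {1..r} \<and> j \<notin> E \<and> j \<notin> S ` E \<and> (A, B, C, D) = (Pt \<rho>, Pt \<i>, I_Inf, Pt 0)
        \<longrightarrow>
        G_convergent k (f' j) (g' j) A B C D \<and>
        (\<forall>n\<le>k - 2. line_integrable A B (\<lambda>\<tau>. \<tau> ^ (k - 2 - n) * f' j \<tau>) \<and>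
                   line_integrable C D (\<lambda>\<tau>. \<tau> ^ n * g' j \<tau>)) \<and>
        G_integral k (f' j) (g' j) A B C D =
          (\<Sum>n\<le>k - 2. (-1) ^ n * of_nat ((k - 2) choose n) *
             line_integral A B (\<lambda>\<tau>. \<tau> ^ (k - 2 - n) * f' j \<tau>) *
             cnj (line_integral C D (\<lambda>\<tau>. \<tau> ^ n * g' j \<tau>))))"
proof -
  define m where "m = k - 2"
  interpret H: haberland N r \<gamma> k m chi f g
    using assms(1-9) by unfold_locales (auto simp: m_def)
  have f': "f' j = H.f_at j" and g': "g' j = H.g_at j" for j
    using assms(10,11) by (auto simp: H.f_at_def H.g_at_def)
  have E: "E = H.E" unfolding assms(12) H.E_def f' ..
  have S: "S j = H.act S_mat j" if "j \<in> {1..r}" for j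
    using assms(13) that by (intro H.act_eq[symmetric]) auto
  \<comment> \<open>The involution turns the image S(E) into a preimage.\<close>
  have SE: "j \<in> S ` E \<longleftrightarrow> H.act S_mat j \<in> H.E" if j: "j \<in> {1..r}" for j
  proof
    assume "j \<in> S ` E"
    then obtain i where "i \<in> H.E" "j = S i" unfolding E by blast
    thus "H.act S_mat j \<in> H.E" using S[of i] H.act_S_act_S[of i] H.E_subset by auto
  next
    assume i: "H.act S_mat j \<in> H.E"
    hence "S (H.act S_mat j) = j" using S H.E_subset H.act_S_act_S[OF j] by auto
    thus "j \<in> S ` E" unfolding E using i by force
  qed
  have \<rho>: "\<rho> = rim (-1/2)" "\<rho> + 1 = rim (1/2)"
    unfolding assms(14) rho_eq_rim by (simp_all add: rim_def complex_eq_iff)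
  have M: "{j. j \<in> {1..r} \<and> j \<notin> E \<and> j \<notin> S ` E} = H.M"
    using SE by (auto simp: H.M_def E)
  \<comment> \<open>On R the value keeps the endpoints \<rho> + 1 and \<rho>; on \<open>H.M\<close>
    it is exchanged for the value from \<rho> to i, which is legitimate only for the whole
    sum.\<close>
  define R where "R = {j. j \<in> {1..r} \<and> j \<notin> E \<and> j \<in> S ` E}"
  have R: "R \<subseteq> {1..r} - H.E" by (auto simp: R_def E)
  have split: "(\<Sum>j\<in>{1..r} - H.E. h j) = (\<Sum>j\<in>R. h j) + (\<Sum>j\<in>H.M. h j)" for h :: "nat \<Rightarrow> complex"
  proof -
    have "{1..r} - H.E = R \<union> H.M" "R \<inter> H.M = {}" unfolding M[symmetric] by (auto simp: R_def E)
    moreover have "finite R" "finite H.M" using finite_subset[OF R] by (auto simp: H.M_def)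
    ultimately show ?thesis by (simp only: sum.union_disjoint)
  qed
  have ev1: "H.evaluates j (Pt (\<rho> + 1)) I_Inf (Pt \<i>) (Pt (\<i> + 1)) (H.G_value_E j)" if "j \<in> E" for j
    using H.evaluates_E[of j] that unfolding \<rho>(2) E by simp
  have ev2: "H.evaluates j (Pt (\<rho> + 1)) (Pt \<rho>) (Pt \<i>) I_Inf (H.G_value_nonE j (rim (1/2)) (rim (-1/2)))" if "j \<in> R" for j
    using H.evaluates_nonE[of j] that R unfolding \<rho>(2) unfolding \<rho>(1) by blast
  have ev3: "H.evaluates j (Pt \<rho>) (Pt \<i>) I_Inf (Pt 0) (H.G_value_M j)" if "j \<in> H.M" for j
    using H.evaluates_M[of j] that unfolding \<rho>(1) by simp
  have G: "G_integral k (f' j) (g' j) A B C D = v" if "H.evaluates j A B C D v" for j A B C D v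
    using that unfolding H.evaluates_def f' g' by blast
  have conv: "G_convergent k (f' j) (g' j) A B C D \<and>
        (\<forall>n\<le>k - 2. line_integrable A B (\<lambda>\<tau>. \<tau> ^ (k - 2 - n) * f' j \<tau>) \<and>
                   line_integrable C D (\<lambda>\<tau>. \<tau> ^ n * g' j \<tau>)) \<and>
        G_integral k (f' j) (g' j) A B C D =
          (\<Sum>n\<le>k - 2. (-1) ^ n * of_nat ((k - 2) choose n) *
             line_integral A B (\<lambda>\<tau>. \<tau> ^ (k - 2 - n) * f' j \<tau>) *
             cnj (line_integral C D (\<lambda>\<tau>. \<tau> ^ n * g' j \<tau>)))" if "H.evaluates j A B C D v" for j A B C D v
    using that unfolding H.evaluates_def H.comoment_def[abs_def] H.moment_def[abs_def] H.sbinom_def f' g' m_def[symmetric] by blast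
  have "of_nat r * (2 * \<i>) ^ (k - 1) * petersson N k f g =
      (\<Sum>j\<in>H.E. H.G_value_E j) + (\<Sum>j\<in>{1..r} - H.E. H.G_value_nonE j (rim (1/2)) (rim (-1/2)))"
    unfolding H.petersson_eq(2)[OF assms(7)] H.sum_domain_integral ..
  also have "\<dots> = (\<Sum>j\<in>E. H.G_value_E j) + (\<Sum>j\<in>R. H.G_value_nonE j (rim (1/2)) (rim (-1/2))) + (\<Sum>j\<in>H.M. H.G_value_M j)"
    unfolding split H.sum_G_value_nonE_M E by simp
  also have "\<dots> = (\<Sum>j\<in>E. G_integral k (f' j) (g' j) (Pt (\<rho> + 1)) I_Inf (Pt \<i>) (Pt (\<i> + 1)))
      + (\<Sum>j\<in>R. G_integral k (f' j) (g' j) (Pt (\<rho> + 1)) (Pt \<rho>) (Pt \<i>) I_Inf)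
      + (\<Sum>j\<in>H.M. G_integral k (f' j) (g' j) (Pt \<rho>) (Pt \<i>) I_Inf (Pt 0))"
    by (intro arg_cong2[where f = "(+)"] sum.cong refl G[symmetric] ev1 ev2 ev3)
  finally show ?thesis
    using H.petersson_eq(1)[OF assms(7)] conv[OF ev1] conv[OF ev2] conv[OF ev3]
    unfolding R_def M[symmetric] by auto
qed

end
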